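(* The following statements hold. (1) A family of finite graphs is triangle-abundant if and only if it contains a triangle-abundant graph. (2) A family of $K_3$-coloured finite graphs is triangle-abundant if and only if it contains a triangle-abundant $K_3$-coloured graph. (3) Let $F$ and $H$ be finite simple graphs with $e(F)>0$. The graph $H$ is $F$-abundant if and only if there is an $F$-colouring $\sigma$ of $H$ such that $(H,\sigma)$ is $F$-abundant.
   Context: All graphs are finite and simple; families may be infinite. $v(H)=|V(H)|$, $e(H)=|E(H)|$. A homomorphism is an edge-preserving map of vertex sets; an embedding is an injective homomorphism; $\mathrm{Emb}(H,G)$ is the number of embeddings of $H$ into $G$. Copies are not required to be induced. An $F$-colouring of a graph $G$ is a homomorphism $\kappa_G:G\to F$; the sets $V_a(G)=\kappa_G^{-1}(a)$, $a\in V(F)$, form an $F$-partition of $G$, and a graph with such a fixed partition is called $F$-partite. An $F$-coloured graph is a pair $(H,\sigma)$ with $\sigma:H\to F$ an $F$-colouring. If $G$ has a fixed $F$-partition, $\mathrm{Emb}_\sigma(H,G)$ is the number of embeddings $\phi:H\to G$ with $\kappa_G\circ\phi=\sigma$. Triangle-abundance, used in (1) and (2). Let $N(H,G)=\mathrm{Emb}(H,G)/|\mathrm{Aut}(H)|$. A family $\mathcal U$ of graphs is triangle-abundant if there is $C>0$ such that, for every $0<\varepsilon\le1$, there is $n_0(\varepsilon)$ for which every $n$-vertex graph $G$ with $n\ge n_0(\varepsilon)$ that has at least $\varepsilon n^2$ pairwise edge-disjoint triangles contains some $H\in\mathcal U$ satisfying $N(H,G)\ge\varepsilon^C n^{v(H)}$.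 For a $K_3$-coloured graph $(H,\sigma)$, let $\mathrm{Aut}(H,\sigma)$ be the set of automorphisms $\alpha$ of $H$ with $\sigma\circ\alpha=\sigma$, and $N_\sigma(H,G)=\mathrm{Emb}_\sigma(H,G)/|\mathrm{Aut}(H,\sigma)|$. A family $\mathcal H$ of $K_3$-coloured graphs is triangle-abundant if there is $C>0$ such that, for every $0<\varepsilon\le1$, there is $n_0(\varepsilon)$ for which every $n$-vertex graph $G$ with $n\ge n_0(\varepsilon)$ that has a $K_3$-partition (fixed, and used to define $N_\sigma$) and a collection of at least $\varepsilon n^2$ pairwise edge-disjoint triangles whose three vertices lie in the three prescribed parts contains some $(H,\sigma)\in\mathcal H$ satisfying $N_\sigma(H,G)\ge\varepsilon^C n^{v(H)}$. In both definitions the member may depend on $G$ and $\varepsilon$. A single graph (or $K_3$-coloured graph) is triangle-abundant if the family consisting of it alone is triangle-abundant. $F$-abundance, used in (3). An $n$-vertex graph $G$ is $\varepsilon$-far from being $F$-free if at least $\varepsilon n^2$ edges must be deleted from $G$ to leave no copy of $F$. The graph $H$ is $F$-abundant if there are constants $c,C>0$ such that, for every $0<\varepsilon\le1$, there is $n_0(\varepsilon)$ for which every $\varepsilon$-far $n$-vertex graph $G$ with $n\ge n_0(\varepsilon)$ satisfies $\mathrm{Emb}(H,G)\ge c\varepsilon^Cn^{v(H)}$. An $n$-vertex $F$-partite graph $G$ is uniformly $\varepsilon$-far from being $F$-free if there is a collection $\mathcal C$ of embeddings $\psi:F\to G$ such that the sets $\psi(E(F))$, $\psi\in\mathcal C$,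 are pairwise disjoint, $\kappa_G\circ\psi=\mathrm{id}_{V(F)}$ for every $\psi\in\mathcal C$, and every vertex of $G$ belongs to $\psi(V(F))$ for at least $\varepsilon n$ members $\psi\in\mathcal C$. The $F$-coloured graph $(H,\sigma)$ is $F$-abundant if there are constants $c,C>0$ such that, for every $0<\varepsilon\le1$, there is $n_0(\varepsilon)$ for which every uniformly $\varepsilon$-far $n$-vertex $F$-partite graph $G$ with $n\ge n_0(\varepsilon)$ satisfies $\mathrm{Emb}_\sigma(H,G)\ge c\varepsilon^Cn^{v(H)}$. *)

theory Defs
  imports Complex_Main "HOL-Library.FuncSet" "HOL-Library.Disjoint_Sets"
begin

record 'a sgraph =
  verts :: "'a set"
  edges :: "'a set set"

definition simple_graph :: "'a sgraph \<Rightarrow> bool" where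
  "simple_graph G \<longleftrightarrow> finite (verts G) \<and> (\<forall>e\<in>edges G. e \<subseteq> verts G \<and> card e = 2)"

abbreviation order :: "'a sgraph \<Rightarrow> nat" where
  "order G \<equiv> card (verts G)"

text \<open>Edges are two-element sets, so requiring \<open>f ` e\<close> to be an edge of a simple graph
  in particular forces the two ends of \<open>e\<close> to have distinct images.\<close>

definition is_hom :: "'a sgraph \<Rightarrow> 'b sgraph \<Rightarrow> ('a \<Rightarrow> 'b) \<Rightarrow> bool" where
  "is_hom H G f \<longleftrightarrow> f \<in> verts H \<rightarrow> verts G \<and> (\<forall>e\<in>edges H. f ` e \<in> edges G)"

text \<open>Maps that are counted are restricted to \<open>extensional\<close> functions, so that each map of
  vertex sets is represented by exactly one HOL function.\<close>

definition embeddings :: "'a sgraph \<Rightarrow> 'b sgraph \<Rightarrow> ('a \<Rightarrow> 'b) set" where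
  "embeddings H G =
     {\<phi> \<in> extensional (verts H). is_hom H G \<phi> \<and> inj_on \<phi> (verts H)}"

definition Emb :: "'a sgraph \<Rightarrow> 'b sgraph \<Rightarrow> nat" where
  "Emb H G = card (embeddings H G)"

definition automorphisms :: "'a sgraph \<Rightarrow> ('a \<Rightarrow> 'a) set" where
  "automorphisms H =
     {\<alpha> \<in> extensional (verts H). bij_betw \<alpha> (verts H) (verts H) \<and>
        (\<forall>x\<in>verts H. \<forall>y\<in>verts H. {x, y} \<in> edges H \<longleftrightarrow> {\<alpha> x, \<alpha> y} \<in> edges H)}"

definition copies :: "'a sgraph \<Rightarrow> 'b sgraph \<Rightarrow> real" where
  "copies H G = real (Emb H G) / real (card (automorphisms H))"

text \<open>An \<open>F\<close>-colouring of \<open>G\<close> is a homomorphism \<open>\<kappa>\<close> from \<open>G\<close> to \<open>F\<close>; its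
  values outside \<open>verts G\<close> are irrelevant everywhere below. An \<open>F\<close>-partite graph is a
  graph \<open>G\<close> together with such a \<open>\<kappa>\<close>, which is passed as a separate argument.\<close>

definition colouring :: "'f sgraph \<Rightarrow> 'a sgraph \<Rightarrow> ('a \<Rightarrow> 'f) \<Rightarrow> bool" where
  "colouring F G \<kappa> \<longleftrightarrow> is_hom G F \<kappa>"

definition Emb_col :: "'a sgraph \<Rightarrow> ('a \<Rightarrow> 'f) \<Rightarrow> 'b sgraph \<Rightarrow> ('b \<Rightarrow> 'f) \<Rightarrow> nat" where
  "Emb_col H \<sigma> G \<kappa> = card {\<phi> \<in> embeddings H G. \<forall>x\<in>verts H. \<kappa> (\<phi> x) = \<sigma> x}"

definition automorphisms_col :: "'a sgraph \<Rightarrow> ('a \<Rightarrow> 'f) \<Rightarrow> ('a \<Rightarrow> 'a) set" where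
  "automorphisms_col H \<sigma> = {\<alpha> \<in> automorphisms H. \<forall>x\<in>verts H. \<sigma> (\<alpha> x) = \<sigma> x}"

definition copies_col :: "'a sgraph \<Rightarrow> ('a \<Rightarrow> 'f) \<Rightarrow> 'b sgraph \<Rightarrow> ('b \<Rightarrow> 'f) \<Rightarrow> real" where
  "copies_col H \<sigma> G \<kappa> = real (Emb_col H \<sigma> G \<kappa>) / real (card (automorphisms_col H \<sigma>))"

definition pairs :: "'a set \<Rightarrow> 'a set set" where
  "pairs t = {e. e \<subseteq> t \<and> card e = 2}"

text \<open>A triangle is represented by its vertex set \<open>t\<close>; its edge set is then \<open>pairs t\<close>.\<close>

definition triangles :: "'a sgraph \<Rightarrow> 'a set set" where
  "triangles G = {t. t \<subseteq> verts G \<and> card t = 3 \<and> pairs t \<subseteq> edges G}"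

definition K3 :: "nat sgraph" where
  "K3 = \<lparr>verts = {0, 1, 2}, edges = pairs {0, 1, 2}\<rparr>"

text \<open>The definitions of abundance quantify over all finite host graphs. As a definition
  cannot quantify over types, hosts have vertices in \<^typ>\<open>nat\<close>; every finite graph is
  isomorphic to such a graph and all the counts involved are isomorphism invariant.\<close>

definition triangle_abundant :: "'a sgraph set \<Rightarrow> bool" where
  "triangle_abundant U \<longleftrightarrow>
     (\<exists>C::real. C > 0 \<and>
       (\<forall>\<epsilon>::real. 0 < \<epsilon> \<and> \<epsilon> \<le> 1 \<longrightarrow>
         (\<exists>n0::nat. \<forall>G::nat sgraph.
           simple_graph G \<and> order G \<ge> n0 \<and>
           (\<exists>T. T \<subseteq> triangles G \<and> disjoint_family_on pairs T \<and>
                real (card T) \<ge> \<epsilon> * real (order G) ^ 2) \<longrightarrow>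
           (\<exists>H\<in>U. copies H G \<ge> \<epsilon> powr C * real (order G) ^ order H))))"

definition triangle_abundant_col :: "('a sgraph \<times> ('a \<Rightarrow> nat)) set \<Rightarrow> bool" where
  "triangle_abundant_col U \<longleftrightarrow>
     (\<exists>C::real. C > 0 \<and>
       (\<forall>\<epsilon>::real. 0 < \<epsilon> \<and> \<epsilon> \<le> 1 \<longrightarrow>
         (\<exists>n0::nat. \<forall>(G::nat sgraph) \<kappa>.
           simple_graph G \<and> colouring K3 G \<kappa> \<and> order G \<ge> n0 \<and>
           (\<exists>T. T \<subseteq> triangles G \<and> (\<forall>t\<in>T. \<kappa> ` t = verts K3) \<and> disjoint_family_on pairs T \<and>
                real (card T) \<ge> \<epsilon> * real (order G) ^ 2) \<longrightarrow>
           (\<exists>(H, \<sigma>)\<in>U. copies_col H \<sigma> G \<kappa> \<ge> \<epsilon> powr C * real (order G) ^ order H))))"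

definition is_free :: "'f sgraph \<Rightarrow> 'a sgraph \<Rightarrow> bool" where
  "is_free F G \<longleftrightarrow> embeddings F G = {}"

definition far_from_free :: "'f sgraph \<Rightarrow> real \<Rightarrow> 'a sgraph \<Rightarrow> bool" where
  "far_from_free F \<epsilon> G \<longleftrightarrow>
     (\<forall>D. D \<subseteq> edges G \<and> is_free F (G\<lparr>edges := edges G - D\<rparr>) \<longrightarrow>
          real (card D) \<ge> \<epsilon> * real (order G) ^ 2)"

definition abundant :: "'f sgraph \<Rightarrow> 'a sgraph \<Rightarrow> bool" where
  "abundant F H \<longleftrightarrow>
     (\<exists>c C::real. c > 0 \<and> C > 0 \<and>
       (\<forall>\<epsilon>::real. 0 < \<epsilon> \<and> \<epsilon> \<le> 1 \<longrightarrow>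
         (\<exists>n0::nat. \<forall>G::nat sgraph.
           simple_graph G \<and> order G \<ge> n0 \<and> far_from_free F \<epsilon> G \<longrightarrow>
           real (Emb H G) \<ge> c * \<epsilon> powr C * real (order G) ^ order H)))"

definition uniformly_far :: "'f sgraph \<Rightarrow> real \<Rightarrow> 'a sgraph \<Rightarrow> ('a \<Rightarrow> 'f) \<Rightarrow> bool" where
  "uniformly_far F \<epsilon> G \<kappa> \<longleftrightarrow>
     (\<exists>\<C>. \<C> \<subseteq> embeddings F G \<and>
          disjoint_family_on (\<lambda>\<psi>. (\<lambda>e. \<psi> ` e) ` edges F) \<C> \<and>
          (\<forall>\<psi>\<in>\<C>. \<forall>a\<in>verts F. \<kappa> (\<psi> a) = a) \<and>
          (\<forall>v\<in>verts G. real (card {\<psi> \<in> \<C>. v \<in> \<psi> ` verts F}) \<ge> \<epsilon> * real (order G)))"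

definition abundant_col :: "'f sgraph \<Rightarrow> 'a sgraph \<Rightarrow> ('a \<Rightarrow> 'f) \<Rightarrow> bool" where
  "abundant_col F H \<sigma> \<longleftrightarrow>
     (\<exists>c C::real. c > 0 \<and> C > 0 \<and>
       (\<forall>\<epsilon>::real. 0 < \<epsilon> \<and> \<epsilon> \<le> 1 \<longrightarrow>
         (\<exists>n0::nat. \<forall>(G::nat sgraph) \<kappa>.
           simple_graph G \<and> colouring F G \<kappa> \<and> order G \<ge> n0 \<and> uniformly_far F \<epsilon> G \<kappa> \<longrightarrow>
           real (Emb_col H \<sigma> G \<kappa>) \<ge> c * \<epsilon> powr C * real (order G) ^ order H)))"

end

theory Submission
  imports Defs "HOL-Library.Nat_Bijection" "HOL-Computational_Algebra.Primes"
begin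

text \<open>
  Abundance can be tested on products of host graphs. If \<open>G\<^sub>1\<close> and \<open>G\<^sub>2\<close> are coloured by
  \<open>F\<close>, their fibre product over \<open>F\<close> has as vertices the pairs of vertices of equal colour, with
  edges taken coordinatewise. Homomorphisms into it are pairs of homomorphisms that induce the
  same colouring, so homomorphism densities are submultiplicative; edge-disjoint coloured copies
  of \<open>F\<close> can be paired as well, so the parameter \<open>\<epsilon>\<close> is multiplicative. A host that violates the bound \<open>\<epsilon> powr C\<close> for one graph therefore still does
  so, with a smaller \<open>C\<close>, after it is multiplied by another host, provided that the parameters of
  the two factors are polynomially related. Powers of the two hosts bring this about: they replace
  \<open>\<epsilon>\<close> by \<open>\<epsilon> ^ k\<close> and keep the exponent \<open>C\<close>. Hence finitely many graphs that fail to be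
  abundant fail simultaneously on one host (\<open>host_combine\<close>, \<open>thin_finite_family\<close>).

  Infinite families are reduced to finite ones. Isolated vertices only contribute factors that are
  polynomial in \<open>\<epsilon>\<close> (\<open>core_exists\<close>, \<open>thin_core\<close>), so they can be removed. Graphs without isolated
  vertices see only the non-isolated part of a host; adding isolated vertices until the host is
  \<open>1 / \<epsilon>\<close> times larger changes \<open>\<epsilon>\<close> polynomially but makes the density of every such graph on
  \<open>m\<close> vertices at most \<open>\<epsilon> ^ m\<close>. All graphs with many vertices are dealt with at once in this
  way, and up to isomorphism only finitely many remain (\<open>thin_family\<close>).

  Blow-ups preserve densities and produce hosts of arbitrarily large order (\<open>host_blowup\<close>); on large
  hosts the non-injective homomorphisms are negligible (\<open>card_list_homs_le_embs\<close>), so it does not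
  matter whether homomorphisms or embeddings are counted.

  It remains to compare hosts with and without a partition. The tensor product of \<open>G\<close> with
  \<open>F\<close> is coloured by its second coordinate, inherits the edge-disjoint copies of \<open>F\<close> in \<open>G\<close>, and has
  as many homomorphisms from \<open>H\<close> with a prescribed colouring as it has homomorphisms to \<open>G\<close> from
  \<open>H\<close> (\<open>host_lift\<close>). This turns uncoloured hosts into coloured ones, and after vertices of low
  degree have been deleted (\<open>min_degree_subset\<close>) it shows that abundance of some \<open>(H, \<sigma>)\<close>
  implies abundance of \<open>H\<close>. Conversely, if every colouring of \<open>H\<close> fails, then a common host
  for these finitely many colourings has few homomorphisms from \<open>H\<close>, as each of them induces a
  colouring.
\<close>

section \<open>Packings, homomorphisms with colour lists, and hosts\<close>

definition packing :: "'f sgraph \<Rightarrow> 'a sgraph \<Rightarrow> ('f \<Rightarrow> 'a) set \<Rightarrow> bool" where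
  "packing F G P \<longleftrightarrow>
     P \<subseteq> embeddings F G \<and> disjoint_family_on (\<lambda>\<psi>. (\<lambda>e. \<psi> ` e) ` edges F) P"

definition col_packing :: "'f sgraph \<Rightarrow> 'a sgraph \<Rightarrow> ('a \<Rightarrow> 'f) \<Rightarrow> ('f \<Rightarrow> 'a) set \<Rightarrow> bool" where
  "col_packing F G \<kappa> P \<longleftrightarrow> packing F G P \<and> (\<forall>\<psi>\<in>P. \<forall>a\<in>verts F. \<kappa> (\<psi> a) = a)"

text \<open>Every vertex \<open>x\<close> of \<open>H\<close> has a list \<open>S x\<close> of admissible colours. Singleton lists give
  the homomorphisms that respect a colouring, full lists give all homomorphisms; the two cases can so
  be treated together.\<close>

definition list_homs ::
  "'h sgraph \<Rightarrow> ('h \<Rightarrow> 'f set) \<Rightarrow> 'a sgraph \<Rightarrow> ('a \<Rightarrow> 'f) \<Rightarrow> ('h \<Rightarrow> 'a) set" where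
  "list_homs H S G \<kappa> =
     {\<phi> \<in> verts H \<rightarrow>\<^sub>E verts G. (\<forall>e\<in>edges H. \<phi> ` e \<in> edges G) \<and> (\<forall>x\<in>verts H. \<kappa> (\<phi> x) \<in> S x)}"

text \<open>The normalisation uses a number \<open>n\<close> that may exceed the order of \<open>G\<close>: it stands for
  a graph with \<open>n\<close> vertices of which those outside \<open>G\<close> are isolated. Isolated vertices can then be
  added and removed without changing the graph.\<close>

definition dens ::
  "'h sgraph \<Rightarrow> ('h \<Rightarrow> 'f set) \<Rightarrow> nat \<Rightarrow> 'a sgraph \<Rightarrow> ('a \<Rightarrow> 'f) \<Rightarrow> real" where
  "dens H S n G \<kappa> = real (card (list_homs H S G \<kappa>)) / real n ^ order H"

text \<open>As in \<open>dens\<close>, the order of \<open>G\<close> is replaced by a nominal order \<open>n\<close>, relative to which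
  \<open>q\<close> bounds the number of edge-disjoint copies of \<open>F\<close> from below.\<close>

definition host :: "'f sgraph \<Rightarrow> nat \<Rightarrow> 'a sgraph \<Rightarrow> ('a \<Rightarrow> 'f) \<Rightarrow> real \<Rightarrow> bool" where
  "host F n G \<kappa> q \<longleftrightarrow>
     simple_graph G \<and> colouring F G \<kappa> \<and> order G \<le> n \<and> 0 < n \<and>
     (\<exists>P. col_packing F G \<kappa> P \<and> q * real n ^ 2 \<le> real (card P))"

lemma simple_graph_finite_edges: "simple_graph G \<Longrightarrow> finite (edges G)"
  unfolding simple_graph_def by (meson PowI finite_Pow_iff finite_subset subsetI)

lemma edge_D:
  assumes "simple_graph G" "e \<in> edges G"
  shows "e \<subseteq> verts G" "card e = 2" "e \<noteq> {}" "finite e"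
proof -
  show "e \<subseteq> verts G" and c: "card e = 2" using assms unfolding simple_graph_def by blast+
  from c show "e \<noteq> {}" by auto
  from c show "finite e" by (metis card.infinite zero_neq_numeral)
qed

lemma finite_embeddings:
  assumes "finite (verts H)" "finite (verts G)" shows "finite (embeddings H G)"
proof -
  have "embeddings H G \<subseteq> verts H \<rightarrow>\<^sub>E verts G"
    unfolding embeddings_def is_hom_def by (auto simp: PiE_def)
  then show ?thesis using assms by (meson finite_PiE finite_subset)
qed

lemma finite_list_homs:
  assumes "finite (verts H)" "finite (verts G)" shows "finite (list_homs H S G \<kappa>)"
  unfolding list_homs_def using assms by (simp add: finite_PiE)

lemma card_list_homs_le:
  assumes "finite (verts H)" "finite (verts G)"
  shows "card (list_homs H S G \<kappa>) \<le> order G ^ order H"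
proof -
  have "card (list_homs H S G \<kappa>) \<le> card (verts H \<rightarrow>\<^sub>E verts G)"
    using assms by (intro card_mono finite_PiE) (auto simp: list_homs_def)
  then show ?thesis using assms by (simp add: card_funcsetE)
qed

lemma dens_nonneg: "0 \<le> dens H S n G \<kappa>"
  by (simp add: dens_def)

lemma dens_le_1:
  assumes "finite (verts H)" "host F n G \<kappa> q"
  shows "dens H S n G \<kappa> \<le> 1"
proof -
  have G: "finite (verts G)" "order G \<le> n" "0 < n"
    using assms(2) by (auto simp: host_def simple_graph_def)
  have "card (list_homs H S G \<kappa>) \<le> n ^ order H"
    using card_list_homs_le[OF assms(1) G(1), of S \<kappa>] power_mono[OF G(2), of "order H"] by linarith
  then have "real (card (list_homs H S G \<kappa>)) \<le> real n ^ order H"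
    by (metis of_nat_le_iff of_nat_power)
  then show ?thesis using G by (simp add: dens_def divide_le_eq)
qed

lemma host_mono: "host F n G \<kappa> q \<Longrightarrow> q' \<le> q \<Longrightarrow> host F n G \<kappa> q'"
  unfolding host_def by (smt (verit) mult_right_mono zero_le_power2)

lemma packing_finite:
  assumes "packing F G P" "simple_graph F" "simple_graph G" shows "finite P"
  using assms finite_embeddings unfolding packing_def simple_graph_def
  by (metis finite_subset)

lemma packing_eqI:
  assumes "packing F G P" "\<psi> \<in> P" "\<psi>' \<in> P" "e \<in> edges F" "\<psi> ` e = \<psi>' ` e"
  shows "\<psi> = \<psi>'"
  using assms unfolding packing_def disjoint_family_on_def by blast

text \<open>When the members of \<open>P\<close> are sections of \<open>\<kappa>\<close>, injectivity is automatic, and two images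
  of edges can only agree if they are images of the same edge of \<open>F\<close>; so disjointness has to be
  checked edge by edge only.\<close>

lemma col_packingI:
  assumes F: "simple_graph F"
    and ext: "\<And>\<psi>. \<psi> \<in> P \<Longrightarrow> \<psi> \<in> verts F \<rightarrow>\<^sub>E verts G"
    and hom: "\<And>\<psi> e. \<psi> \<in> P \<Longrightarrow> e \<in> edges F \<Longrightarrow> \<psi> ` e \<in> edges G"
    and col: "\<And>\<psi> a. \<psi> \<in> P \<Longrightarrow> a \<in> verts F \<Longrightarrow> \<kappa> (\<psi> a) = a"
    and dis: "\<And>\<psi> \<psi>' e. \<psi> \<in> P \<Longrightarrow> \<psi>' \<in> P \<Longrightarrow> e \<in> edges F \<Longrightarrow> \<psi> ` e = \<psi>' ` e \<Longrightarrow> \<psi> = \<psi>'"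
  shows "col_packing F G \<kappa> P"
proof -
  have sub: "P \<subseteq> embeddings F G"
  proof
    fix \<psi> assume "\<psi> \<in> P"
    then show "\<psi> \<in> embeddings F G"
      using ext hom inj_on_inverseI[of "verts F" \<kappa> \<psi>] col
      by (auto simp: embeddings_def is_hom_def PiE_def)
  qed
  have fixed: "\<kappa> ` \<psi> ` e = e" if "\<psi> \<in> P" "e \<in> edges F" for \<psi> e
  proof -
    have "\<kappa> (\<psi> a) = a" if "a \<in> e" for a
      using col[OF \<open>\<psi> \<in> P\<close>] edge_D(1)[OF F \<open>e \<in> edges F\<close>] that by blast
    then show ?thesis by (simp add: image_image)
  qed
  have "disjoint_family_on (\<lambda>\<psi>. (\<lambda>e. \<psi> ` e) ` edges F) P"
    unfolding disjoint_family_on_def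
  proof (intro ballI impI, rule ccontr)
    fix \<psi> \<psi>' assume a: "\<psi> \<in> P" "\<psi>' \<in> P" "\<psi> \<noteq> \<psi>'"
      and "(\<lambda>e. \<psi> ` e) ` edges F \<inter> (\<lambda>e. \<psi>' ` e) ` edges F \<noteq> {}"
    then obtain e e' where e: "e \<in> edges F" "e' \<in> edges F" "\<psi> ` e = \<psi>' ` e'" by blast
    have "\<kappa> ` \<psi> ` e = e" "\<kappa> ` \<psi>' ` e' = e'"
      using fixed[OF a(1) e(1)] fixed[OF a(2) e(2)] by simp_all
    then have "e = e'" using e(3) by simp
    then show False using dis[OF a(1,2) e(1)] e(3) a(3) by simp
  qed
  then show ?thesis using sub col by (auto simp: col_packing_def packing_def)
qed

lemma col_packingD:
  assumes "col_packing F G \<kappa> P" "\<psi> \<in> P"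
  shows "\<psi> \<in> verts F \<rightarrow>\<^sub>E verts G" "e \<in> edges F \<Longrightarrow> \<psi> ` e \<in> edges G"
    "a \<in> verts F \<Longrightarrow> \<kappa> (\<psi> a) = a" "inj_on \<psi> (verts F)"
  using assms by (auto simp: col_packing_def packing_def embeddings_def is_hom_def PiE_def)

section \<open>Products of host graphs\<close>

abbreviation p1 :: "nat \<Rightarrow> nat" where "p1 z \<equiv> fst (prod_decode z)"
abbreviation p2 :: "nat \<Rightarrow> nat" where "p2 z \<equiv> snd (prod_decode z)"

text \<open>A subgraph of a product of two graphs on the natural numbers, encoded on the natural
  numbers again so that the construction can be iterated. Fibre products, blow-ups and the product
  with \<open>F\<close> differ only in the vertex set \<open>V\<close> and in the condition \<open>Q\<close> on the two projections
  of an edge.\<close>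

definition pullback :: "(nat \<times> nat) set \<Rightarrow> (nat set \<Rightarrow> nat set \<Rightarrow> bool) \<Rightarrow> nat sgraph" where
  "pullback V Q =
     \<lparr>verts = prod_encode ` V,
      edges = {e. e \<subseteq> prod_encode ` V \<and> card e = 2 \<and> Q (p1 ` e) (p2 ` e)}\<rparr>"

lemma simple_pullback: "finite V \<Longrightarrow> simple_graph (pullback V Q)"
  by (auto simp: simple_graph_def pullback_def)

lemma order_pullback: "order (pullback V Q) = card V"
  by (simp add: pullback_def card_image inj_prod_encode)

lemma pair_map_edge:
  assumes "card e = 2" "inj_on f e \<or> inj_on g e" "\<And>a. a \<in> e \<Longrightarrow> (f a, g a) \<in> V"
    and "Q (f ` e) (g ` e)" "\<And>a. a \<in> e \<Longrightarrow> h a = prod_encode (f a, g a)"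
  shows "h ` e \<in> edges (pullback V Q)"
proof -
  have "inj_on h e" using assms(2,5) by (auto simp: inj_on_def)
  then have "card (h ` e) = 2" using assms(1) by (simp add: card_image)
  moreover have "p1 ` h ` e = f ` e" "p2 ` h ` e = g ` e"
    using assms(5) by (auto simp: image_image intro!: image_cong)
  ultimately show ?thesis using assms(3-5) by (auto simp: pullback_def)
qed

text \<open>A map into a product is determined by its two coordinates.\<close>

lemma list_homs_pullback_le:
  assumes "finite A" "finite B"
    and "\<And>\<phi>. \<phi> \<in> list_homs H S (pullback V Q) \<kappa> \<Longrightarrow>
      restrict (p1 \<circ> \<phi>) (verts H) \<in> A \<and> restrict (p2 \<circ> \<phi>) (verts H) \<in> B"
  shows "card (list_homs H S (pullback V Q) \<kappa>) \<le> card A * card B"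
proof -
  let ?X = "list_homs H S (pullback V Q) \<kappa>"
  let ?f = "\<lambda>\<phi>. (restrict (p1 \<circ> \<phi>) (verts H), restrict (p2 \<circ> \<phi>) (verts H))"
  have "inj_on ?f ?X"
  proof (rule inj_onI)
    fix \<phi> \<phi>' assume a: "\<phi> \<in> ?X" "\<phi>' \<in> ?X" "?f \<phi> = ?f \<phi>'"
    show "\<phi> = \<phi>'"
    proof (rule extensionalityI)
      show "\<phi> \<in> extensional (verts H)" "\<phi>' \<in> extensional (verts H)"
        using a by (auto simp: list_homs_def PiE_def)
      fix x assume "x \<in> verts H"
      then have "p1 (\<phi> x) = p1 (\<phi>' x)" "p2 (\<phi> x) = p2 (\<phi>' x)"
        using a(3) by (auto dest: fun_cong[where x=x] simp: restrict_def)
      then have "prod_decode (\<phi> x) = prod_decode (\<phi>' x)" by (simp add: prod_eq_iff)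
      then show "\<phi> x = \<phi>' x" by (metis prod_decode_inverse)
    qed
  qed
  moreover have "?f ` ?X \<subseteq> A \<times> B" using assms(3) by auto
  ultimately have "card ?X \<le> card (A \<times> B)" using assms(1,2) by (meson card_inj_on_le finite_SigmaI)
  then show ?thesis by (simp add: card_cartesian_product)
qed

lemma list_homs_pullbackD:
  assumes "simple_graph H" "\<phi> \<in> list_homs H S (pullback V Q) \<kappa>"
  shows "x \<in> verts H \<Longrightarrow> (p1 (\<phi> x), p2 (\<phi> x)) \<in> V"
    "x \<in> verts H \<Longrightarrow> \<kappa> (\<phi> x) \<in> S x"
    "e \<in> edges H \<Longrightarrow> Q (restrict (p1 \<circ> \<phi>) (verts H) ` e) (restrict (p2 \<circ> \<phi>) (verts H) ` e)"
proof -
  show "\<kappa> (\<phi> x) \<in> S x" if "x \<in> verts H" using assms that by (simp add: list_homs_def)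
  show "(p1 (\<phi> x), p2 (\<phi> x)) \<in> V" if "x \<in> verts H"
  proof -
    have "\<phi> x \<in> prod_encode ` V" using assms that by (auto simp: list_homs_def pullback_def)
    then show ?thesis by auto
  qed
  assume e: "e \<in> edges H"
  then have "e \<subseteq> verts H" using edge_D(1)[OF assms(1)] by blast
  then have "restrict (p1 \<circ> \<phi>) (verts H) ` e = p1 ` \<phi> ` e"
    "restrict (p2 \<circ> \<phi>) (verts H) ` e = p2 ` \<phi> ` e"
    by (auto simp: image_image intro!: image_cong)
  then show "Q (restrict (p1 \<circ> \<phi>) (verts H) ` e) (restrict (p2 \<circ> \<phi>) (verts H) ` e)"
    using assms(2) e by (auto simp: list_homs_def pullback_def)
qed

definition pair_map :: "'f set \<Rightarrow> ('f \<Rightarrow> nat) \<Rightarrow> ('f \<Rightarrow> nat) \<Rightarrow> 'f \<Rightarrow> nat" where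
  "pair_map A f g = (\<lambda>a\<in>A. prod_encode (f a, g a))"

lemma pair_map_apply [simp]: "a \<in> A \<Longrightarrow> pair_map A f g a = prod_encode (f a, g a)"
  by (simp add: pair_map_def)

lemma pair_map_proj:
  assumes "e \<subseteq> A" shows "p1 ` pair_map A f g ` e = f ` e" "p2 ` pair_map A f g ` e = g ` e"
  using assms by (auto simp: image_image subset_iff intro!: image_cong)

lemma pair_map_eqD:
  assumes "pair_map A f g = pair_map A f' g'" "f \<in> extensional A" "f' \<in> extensional A"
    "g \<in> extensional A" "g' \<in> extensional A"
  shows "f = f' \<and> g = g'"
proof -
  have "f a = f' a \<and> g a = g' a" if "a \<in> A" for a
    using fun_cong[OF assms(1), of a] that by simp
  then show ?thesis using assms(2-5) by (meson extensionalityI)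
qed

lemma colouring_pullback:
  assumes "\<And>x y. (x, y) \<in> V \<Longrightarrow> \<kappa> (prod_encode (x, y)) \<in> verts F"
    and "\<And>e. e \<subseteq> prod_encode ` V \<Longrightarrow> card e = 2 \<Longrightarrow> Q (p1 ` e) (p2 ` e) \<Longrightarrow> \<kappa> ` e \<in> edges F"
  shows "colouring F (pullback V Q) \<kappa>"
  using assms by (auto simp: colouring_def is_hom_def pullback_def)

text \<open>The fibre product over \<open>F\<close>. A pair of coloured copies of \<open>F\<close> gives a copy in the
  product, and one edge of that copy determines both members of the pair because it projects to an
  edge of each of them.\<close>

lemma host_product:
  fixes G1 G2 :: "nat sgraph"
  assumes F: "simple_graph F" "edges F \<noteq> {}"
    and h1: "host F n1 G1 \<kappa>1 q1" and h2: "host F n2 G2 \<kappa>2 q2" and q: "0 \<le> q1" "0 \<le> q2"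
  shows "\<exists>(G::nat sgraph) \<kappa>. host F (n1 * n2) G \<kappa> (q1 * q2) \<and>
    (\<forall>(H::'h sgraph) S. simple_graph H \<longrightarrow>
       dens H S (n1 * n2) G \<kappa> \<le> dens H S n1 G1 \<kappa>1 * dens H S n2 G2 \<kappa>2)"
proof -
  define V where "V = {(x, y). x \<in> verts G1 \<and> y \<in> verts G2 \<and> \<kappa>1 x = \<kappa>2 y}"
  define Q where "Q = (\<lambda>e1 e2. e1 \<in> edges G1 \<and> e2 \<in> edges G2)"
  define G where "G = pullback V Q"
  define \<kappa> where "\<kappa> = \<kappa>1 \<circ> p1"
  obtain P1 where P1: "col_packing F G1 \<kappa>1 P1" "q1 * real n1 ^ 2 \<le> real (card P1)"
    using h1 by (auto simp: host_def)
  obtain P2 where P2: "col_packing F G2 \<kappa>2 P2" "q2 * real n2 ^ 2 \<le> real (card P2)"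
    using h2 by (auto simp: host_def)
  have G1: "simple_graph G1" "colouring F G1 \<kappa>1" "order G1 \<le> n1" "0 < n1"
    and G2: "simple_graph G2" "colouring F G2 \<kappa>2" "order G2 \<le> n2" "0 < n2"
    using h1 h2 by (auto simp: host_def)
  have fin: "finite (verts G1)" "finite (verts G2)" using G1 G2 by (auto simp: simple_graph_def)
  have VS: "V \<subseteq> verts G1 \<times> verts G2" by (auto simp: V_def)
  then have finV: "finite V" using fin finite_subset by blast
  have sG: "simple_graph G" unfolding G_def using finV by (rule simple_pullback)
  have cG: "colouring F G \<kappa>"
    unfolding G_def
  proof (rule colouring_pullback)
    fix x y assume "(x, y) \<in> V"
    then have "x \<in> verts G1" by (simp add: V_def)
    then show "\<kappa> (prod_encode (x, y)) \<in> verts F"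
      using G1(2) by (auto simp: \<kappa>_def colouring_def is_hom_def)
  next
    fix e assume "Q (p1 ` e) (p2 ` e)"
    then have "\<kappa>1 ` p1 ` e \<in> edges F"
      using G1(2) by (auto simp: Q_def colouring_def is_hom_def)
    then show "\<kappa> ` e \<in> edges F" by (simp add: \<kappa>_def image_comp)
  qed
  have oG: "order G \<le> n1 * n2"
  proof -
    have "card V \<le> card (verts G1 \<times> verts G2)" by (intro card_mono VS finite_SigmaI fin)
    also have "\<dots> \<le> n1 * n2" using G1(3) G2(3) by (simp add: card_cartesian_product mult_le_mono)
    finally show ?thesis by (simp add: G_def order_pullback)
  qed
  define P where "P = (\<lambda>(f, g). pair_map (verts F) f g) ` (P1 \<times> P2)"
  note D1 = col_packingD[OF P1(1)] and D2 = col_packingD[OF P2(1)]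
  have pP: "col_packing F G \<kappa> P"
  proof (rule col_packingI[OF F(1)])
    fix \<psi> assume "\<psi> \<in> P"
    then obtain f g where fg: "f \<in> P1" "g \<in> P2" "\<psi> = pair_map (verts F) f g" by (auto simp: P_def)
    have inV: "(f a, g a) \<in> V" if "a \<in> verts F" for a
      using D1(1,3)[OF fg(1)] D2(1,3)[OF fg(2)] that by (auto simp: V_def)
    then show "\<psi> \<in> verts F \<rightarrow>\<^sub>E verts G" using fg(3) by (auto simp: G_def pullback_def pair_map_def)
    show "\<kappa> (\<psi> a) = a" if "a \<in> verts F" for a
      using D1(3)[OF fg(1) that] that fg(3) by (simp add: \<kappa>_def)
    show "\<psi> ` e \<in> edges G" if e: "e \<in> edges F" for e
      unfolding G_def
    proof (rule pair_map_edge)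
      have eF: "e \<subseteq> verts F" "card e = 2" using edge_D[OF F(1) e] by auto
      then show "card e = 2" "\<And>a. a \<in> e \<Longrightarrow> (f a, g a) \<in> V"
        "\<And>a. a \<in> e \<Longrightarrow> \<psi> a = prod_encode (f a, g a)"
        using inV fg(3) by auto
      show "inj_on f e \<or> inj_on g e" using D1(4)[OF fg(1)] eF by (meson inj_on_subset)
      show "Q (f ` e) (g ` e)" using D1(2)[OF fg(1) e] D2(2)[OF fg(2) e] by (simp add: Q_def)
    qed
  next
    fix \<psi> \<psi>' e assume a: "\<psi> \<in> P" "\<psi>' \<in> P" "e \<in> edges F" "\<psi> ` e = \<psi>' ` e"
    obtain f g where fg: "f \<in> P1" "g \<in> P2" "\<psi> = pair_map (verts F) f g" using a(1) by (auto simp: P_def)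
    obtain f' g' where fg': "f' \<in> P1" "g' \<in> P2" "\<psi>' = pair_map (verts F) f' g'"
      using a(2) by (auto simp: P_def)
    have "f ` e = f' ` e" "g ` e = g' ` e"
      using pair_map_proj[OF edge_D(1)[OF F(1) a(3)]] a(4) fg(3) fg'(3) by metis+
    then have "f = f'" "g = g'"
      using packing_eqI P1(1) P2(1) fg(1,2) fg'(1,2) a(3) by (metis col_packing_def)+
    then show "\<psi> = \<psi>'" using fg fg' by simp
  qed
  have "inj_on (\<lambda>(f, g). pair_map (verts F) f g) (P1 \<times> P2)"
  proof (rule inj_onI, clarify)
    fix f g f' g'
    assume *: "f \<in> P1" "g \<in> P2" "f' \<in> P1" "g' \<in> P2"
      and eq: "pair_map (verts F) f g = pair_map (verts F) f' g'"
    show "f = f' \<and> g = g'"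
      by (rule pair_map_eqD[OF eq]) (use D1(1) D2(1) * in \<open>auto simp: PiE_def\<close>)
  qed
  then have cP: "card P = card P1 * card P2"
    by (simp add: P_def card_image card_cartesian_product)
  have "q1 * q2 * real (n1 * n2) ^ 2 = (q1 * real n1 ^ 2) * (q2 * real n2 ^ 2)"
    by (simp add: power_mult_distrib)
  also have "\<dots> \<le> real (card P1) * real (card P2)"
    using P1(2) P2(2) q by (intro mult_mono) auto
  finally have "q1 * q2 * real (n1 * n2) ^ 2 \<le> real (card P)" by (simp add: cP)
  then have host: "host F (n1 * n2) G \<kappa> (q1 * q2)"
    unfolding host_def using sG cG oG G1(4) G2(4) pP by auto
  have "dens H S (n1 * n2) G \<kappa> \<le> dens H S n1 G1 \<kappa>1 * dens H S n2 G2 \<kappa>2"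
    if H: "simple_graph H" for H :: "'h sgraph" and S
  proof -
    have fH: "finite (verts H)" using H by (simp add: simple_graph_def)
    have "card (list_homs H S G \<kappa>) \<le> card (list_homs H S G1 \<kappa>1) * card (list_homs H S G2 \<kappa>2)"
      unfolding G_def
    proof (rule list_homs_pullback_le)
      show "finite (list_homs H S G1 \<kappa>1)" "finite (list_homs H S G2 \<kappa>2)"
        using finite_list_homs fH fin by auto
      fix \<phi> assume "\<phi> \<in> list_homs H S (pullback V Q) \<kappa>"
      note D = list_homs_pullbackD[OF H this]
      have "\<kappa>1 (p1 (\<phi> x)) \<in> S x \<and> \<kappa>2 (p2 (\<phi> x)) \<in> S x \<and> p1 (\<phi> x) \<in> verts G1 \<and> p2 (\<phi> x) \<in> verts G2"
        if "x \<in> verts H" for x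
        using D(1)[OF that] D(2)[OF that] by (auto simp: V_def \<kappa>_def)
      moreover have "restrict (p1 \<circ> \<phi>) (verts H) ` e \<in> edges G1 \<and>
          restrict (p2 \<circ> \<phi>) (verts H) ` e \<in> edges G2" if "e \<in> edges H" for e
        using D(3)[OF that] by (simp add: Q_def)
      ultimately show "restrict (p1 \<circ> \<phi>) (verts H) \<in> list_homs H S G1 \<kappa>1 \<and>
          restrict (p2 \<circ> \<phi>) (verts H) \<in> list_homs H S G2 \<kappa>2"
        by (auto simp: list_homs_def)
    qed
    then have "real (card (list_homs H S G \<kappa>)) \<le>
        real (card (list_homs H S G1 \<kappa>1)) * real (card (list_homs H S G2 \<kappa>2))"
      by (metis of_nat_le_iff of_nat_mult)
    then show ?thesis
      using G1(4) G2(4) by (simp add: dens_def power_mult_distrib divide_right_mono)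
  qed
  then show ?thesis using host by blast
qed

lemma host_power:
  fixes G :: "nat sgraph"
  assumes F: "simple_graph F" "edges F \<noteq> {}"
    and h: "host F n G \<kappa> q" and q: "0 \<le> q"
  shows "\<exists>n' (G'::nat sgraph) \<kappa>'. host F n' G' \<kappa>' (q ^ Suc k) \<and>
    (\<forall>(H::'h sgraph) S. simple_graph H \<longrightarrow> dens H S n' G' \<kappa>' \<le> dens H S n G \<kappa> ^ Suc k)"
proof (induction k)
  case 0
  then show ?case using h by auto
next
  case (Suc k)
  then obtain n' and G' :: "nat sgraph" and \<kappa>' where h': "host F n' G' \<kappa>' (q ^ Suc k)"
    and d': "\<And>(H::'h sgraph) S. simple_graph H \<Longrightarrow> dens H S n' G' \<kappa>' \<le> dens H S n G \<kappa> ^ Suc k"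
    by blast
  obtain G'' :: "nat sgraph" and \<kappa>'' where h'': "host F (n * n') G'' \<kappa>'' (q * q ^ Suc k)"
    and d'': "\<And>(H::'h sgraph) S. simple_graph H \<Longrightarrow>
       dens H S (n * n') G'' \<kappa>'' \<le> dens H S n G \<kappa> * dens H S n' G' \<kappa>'"
    using host_product[OF F h h'] q by fastforce
  have "dens H S (n * n') G'' \<kappa>'' \<le> dens H S n G \<kappa> ^ Suc (Suc k)" if "simple_graph H"
    for H :: "'h sgraph" and S
    using d''[OF that, of S] mult_left_mono[OF d'[OF that, of S] dens_nonneg[of H S n G \<kappa>]] by simp
  then show ?case using h'' by (metis power_Suc)
qed

section \<open>Combining finitely many hosts\<close>

lemma scale_up:
  fixes a B :: real
  assumes "0 < a" "a \<le> B"
  shows "\<exists>k. B \<le> real (Suc k) * a \<and> real (Suc k) * a \<le> 2 * B"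
proof -
  define k where "k = nat \<lfloor>B / a\<rfloor>"
  have "real k = of_int \<lfloor>B / a\<rfloor>" using assms by (simp add: k_def)
  then have k: "real k \<le> B / a" "B / a < real k + 1" by linarith+
  have "real k * a \<le> B" "B < (real k + 1) * a"
    using k assms by (simp_all add: field_simps)
  then show ?thesis using assms by (intro exI[of _ k]) (simp add: algebra_simps)
qed

text \<open>Powers \<open>k\<^sub>1\<close> and \<open>k\<^sub>2\<close> are chosen such that \<open>a\<^sub>i k\<^sub>i\<close> lies between \<open>B\<close> and \<open>2 B\<close> for a common
  \<open>B\<close>. The product of the two powers has parameter \<open>exp (- a)\<close> with \<open>a \<le> 4 B\<close>, while either
  factor alone bounds the density by \<open>exp (- 4 C B)\<close>: only a factor \<open>4\<close> in the exponent is lost.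
  Large \<open>B\<close> makes \<open>a\<close> as large as desired.\<close>

lemma host_combine:
  fixes G1 G2 :: "nat sgraph"
  assumes F: "simple_graph F" "edges F \<noteq> {}"
    and h1: "host F n1 G1 \<kappa>1 (exp (- a1))" "0 < a1"
    and h2: "host F n2 G2 \<kappa>2 (exp (- a2))" "0 < a2"
  shows "\<exists>a n (G::nat sgraph) \<kappa>. A \<le> a \<and> 0 < a \<and> host F n G \<kappa> (exp (- a)) \<and>
    (\<forall>(H::'h sgraph) S C. simple_graph H \<longrightarrow> 0 \<le> C \<longrightarrow>
       dens H S n1 G1 \<kappa>1 \<le> exp (- (4 * C) * a1) \<or> dens H S n2 G2 \<kappa>2 \<le> exp (- (4 * C) * a2) \<longrightarrow>
       dens H S n G \<kappa> \<le> exp (- C * a))"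
proof -
  define B where "B = max A (max a1 a2)"
  obtain k1 where k1: "B \<le> real (Suc k1) * a1" "real (Suc k1) * a1 \<le> 2 * B"
    using scale_up[of a1 B] h1(2) unfolding B_def by fastforce
  obtain k2 where k2: "B \<le> real (Suc k2) * a2" "real (Suc k2) * a2 \<le> 2 * B"
    using scale_up[of a2 B] h2(2) unfolding B_def by fastforce
  define a where "a = real (Suc k1) * a1 + real (Suc k2) * a2"
  have B: "0 < B" "A \<le> B" using h1 by (auto simp: B_def)
  have a: "A \<le> a" "0 < a" "a \<le> 4 * B" using k1 k2 B by (auto simp: a_def)
  obtain m1 and K1 :: "nat sgraph" and \<mu>1 where K1: "host F m1 K1 \<mu>1 (exp (- a1) ^ Suc k1)"
    and d1: "\<And>(H::'h sgraph) S. simple_graph H \<Longrightarrow> dens H S m1 K1 \<mu>1 \<le> dens H S n1 G1 \<kappa>1 ^ Suc k1"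
    using host_power[OF F h1(1), of k1] exp_ge_zero by metis
  obtain m2 and K2 :: "nat sgraph" and \<mu>2 where K2: "host F m2 K2 \<mu>2 (exp (- a2) ^ Suc k2)"
    and d2: "\<And>(H::'h sgraph) S. simple_graph H \<Longrightarrow> dens H S m2 K2 \<mu>2 \<le> dens H S n2 G2 \<kappa>2 ^ Suc k2"
    using host_power[OF F h2(1), of k2] exp_ge_zero by metis
  obtain G :: "nat sgraph" and \<kappa> where G: "host F (m1 * m2) G \<kappa> (exp (- a1) ^ Suc k1 * exp (- a2) ^ Suc k2)"
    and d: "\<And>(H::'h sgraph) S. simple_graph H \<Longrightarrow>
      dens H S (m1 * m2) G \<kappa> \<le> dens H S m1 K1 \<mu>1 * dens H S m2 K2 \<mu>2"
    using host_product[OF F K1 K2] by fastforce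
  have "exp (- a1) ^ Suc k1 * exp (- a2) ^ Suc k2 = exp (- a)"
    unfolding a_def exp_of_nat_mult[symmetric] exp_add[symmetric] by (simp add: algebra_simps)
  then have G: "host F (m1 * m2) G \<kappa> (exp (- a))" using G by simp
  have key: "exp (- (4 * C) * b) ^ Suc k \<le> exp (- C * a)"
    if "B \<le> real (Suc k) * b" "0 \<le> C" for b k and C :: real
  proof -
    have "C * a \<le> C * (4 * (real (Suc k) * b))" using a(3) that by (intro mult_left_mono) auto
    then show ?thesis unfolding exp_of_nat_mult[symmetric] by (simp add: algebra_simps)
  qed
  have "dens H S (m1 * m2) G \<kappa> \<le> exp (- C * a)"
    if H: "simple_graph H" and C: "0 \<le> C"
      and t: "dens H S n1 G1 \<kappa>1 \<le> exp (- (4 * C) * a1) \<or> dens H S n2 G2 \<kappa>2 \<le> exp (- (4 * C) * a2)"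
    for H :: "'h sgraph" and S C
  proof -
    have fH: "finite (verts H)" using H by (simp add: simple_graph_def)
    note nn = dens_nonneg[of H S m1 K1 \<mu>1] dens_nonneg[of H S m2 K2 \<mu>2]
    from t show ?thesis
    proof
      assume "dens H S n1 G1 \<kappa>1 \<le> exp (- (4 * C) * a1)"
      then have "dens H S n1 G1 \<kappa>1 ^ Suc k1 \<le> exp (- (4 * C) * a1) ^ Suc k1"
        by (intro power_mono dens_nonneg)
      moreover have "dens H S m1 K1 \<mu>1 * dens H S m2 K2 \<mu>2 \<le> dens H S m1 K1 \<mu>1"
        using mult_left_mono[OF dens_le_1[OF fH K2, of S] nn(1)] by simp
      ultimately show ?thesis using d[OF H, of S] d1[OF H, of S] key[OF k1(1) C] by linarith
    next
      assume "dens H S n2 G2 \<kappa>2 \<le> exp (- (4 * C) * a2)"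
      then have "dens H S n2 G2 \<kappa>2 ^ Suc k2 \<le> exp (- (4 * C) * a2) ^ Suc k2"
        by (intro power_mono dens_nonneg)
      moreover have "dens H S m1 K1 \<mu>1 * dens H S m2 K2 \<mu>2 \<le> dens H S m2 K2 \<mu>2"
        using mult_right_mono[OF dens_le_1[OF fH K1, of S] nn(2)] by simp
      ultimately show ?thesis using d[OF H, of S] d2[OF H, of S] key[OF k2(1) C] by linarith
    qed
  qed
  then show ?thesis using G a by blast
qed

text \<open>Failure of abundance on hosts that need not be large, with \<open>\<epsilon> = exp (- a)\<close>: powers of
  a host multiply \<open>a\<close>.\<close>

definition thin :: "'f sgraph \<Rightarrow> 'h sgraph \<Rightarrow> ('h \<Rightarrow> 'f set) \<Rightarrow> bool" where
  "thin F H S \<longleftrightarrow> (\<forall>C>0. \<exists>a n (G::nat sgraph) \<kappa>.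
     0 < a \<and> host F n G \<kappa> (exp (- a)) \<and> dens H S n G \<kappa> \<le> exp (- C * a))"

text \<open>A copy of \<open>F\<close> itself is a host; it starts the induction for an empty family.\<close>

lemma host_exists:
  assumes F: "simple_graph F" "edges F \<noteq> {}"
  shows "\<exists>a n (G::nat sgraph) \<kappa>. 0 < a \<and> host F n G \<kappa> (exp (- a))"
proof -
  have fin: "finite (verts F)" using F by (simp add: simple_graph_def)
  then obtain g :: "'a \<Rightarrow> nat" where g: "inj_on g (verts F)"
    using finite_imp_inj_to_nat_seg by blast
  define G where "G = \<lparr>verts = g ` verts F, edges = (\<lambda>e. g ` e) ` edges F\<rparr>"
  define \<kappa> where "\<kappa> = inv_into (verts F) g"
  have \<kappa>: "\<kappa> (g a) = a" if "a \<in> verts F" for a using g that by (simp add: \<kappa>_def)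
  have \<kappa>e: "\<kappa> ` g ` e = e" if "e \<in> edges F" for e
    using \<kappa> edge_D(1)[OF F(1) that] by (force simp: image_image subset_iff)
  have sG: "simple_graph G"
    unfolding simple_graph_def
  proof (intro conjI ballI)
    show "finite (verts G)" using fin by (simp add: G_def)
    fix e' assume "e' \<in> edges G"
    then obtain e where e: "e \<in> edges F" "e' = g ` e" by (auto simp: G_def)
    then show "e' \<subseteq> verts G" using edge_D(1)[OF F(1)] by (auto simp: G_def)
    show "card e' = 2" using e edge_D[OF F(1) e(1)] g by (metis card_image inj_on_subset)
  qed
  have cG: "colouring F G \<kappa>"
    using \<kappa> \<kappa>e by (auto simp: colouring_def is_hom_def G_def)
  have P: "col_packing F G \<kappa> {restrict g (verts F)}"
  proof (rule col_packingI[OF F(1)])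
    fix \<psi> e assume "\<psi> \<in> {restrict g (verts F)}" "e \<in> edges F"
    moreover have "restrict g (verts F) ` e = g ` e"
      using edge_D(1)[OF F(1) \<open>e \<in> edges F\<close>] by (auto intro!: image_cong)
    ultimately show "\<psi> ` e \<in> edges G" by (auto simp: G_def)
  qed (use \<kappa> in \<open>auto simp: G_def\<close>)
  define n where "n = order F"
  have n: "0 < n" "order G = n"
    using edge_D[OF F(1)] F(2) fin g by (auto simp: n_def card_gt_0_iff G_def card_image)
  define a where "a = 1 + 2 * ln (real n)"
  have "0 < a"
  proof -
    have "0 \<le> ln (real n)" using n(1) by (intro ln_ge_zero) simp
    then show ?thesis by (simp add: a_def)
  qed
  have "exp (2 * ln (real n)) = real n ^ 2" using n by (simp add: exp_double)
  moreover have "exp (- a) = exp (- 1) / exp (2 * ln (real n))"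
    unfolding exp_diff[symmetric] by (simp add: a_def)
  ultimately have "exp (- a) * real n ^ 2 = exp (-1)" using n by simp
  also have "\<dots> \<le> 1" by simp
  finally have "host F n G \<kappa> (exp (- a))"
    unfolding host_def using sG cG n P by auto
  then show ?thesis using \<open>0 < a\<close> by blast
qed

lemma thin_finite_family:
  fixes I :: "('h sgraph \<times> ('h \<Rightarrow> 'f set)) set"
  assumes F: "simple_graph F" "edges F \<noteq> {}"
    and I: "finite I" "\<And>H S. (H, S) \<in> I \<Longrightarrow> simple_graph H \<and> thin F H S"
    and C: "0 < C"
  shows "\<exists>a n (G::nat sgraph) \<kappa>. A \<le> a \<and> 0 < a \<and> host F n G \<kappa> (exp (- a)) \<and>
    (\<forall>(H, S)\<in>I. dens H S n G \<kappa> \<le> exp (- C * a))"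
  using I C
proof (induction I arbitrary: C A rule: finite_induct)
  case empty
  obtain a n and G :: "nat sgraph" and \<kappa> where "0 < a" "host F n G \<kappa> (exp (- a))"
    using host_exists[OF F] by blast
  then show ?case
    using host_combine[OF F, of n G \<kappa> a n G \<kappa> a A] by fastforce
next
  case (insert i I)
  obtain H0 S0 where i: "i = (H0, S0)" by fastforce
  obtain a1 n1 and G1 :: "nat sgraph" and \<kappa>1 where 1: "0 < a1" "host F n1 G1 \<kappa>1 (exp (- a1))"
    "\<forall>(H, S)\<in>I. dens H S n1 G1 \<kappa>1 \<le> exp (- (4 * C) * a1)"
    using insert.IH[of "4 * C"] insert.prems by (metis insertI2 mult_pos_pos zero_less_numeral)
  have "thin F H0 S0" using insert.prems i by blast
  then obtain a2 n2 and G2 :: "nat sgraph" and \<kappa>2 where 2: "0 < a2" "host F n2 G2 \<kappa>2 (exp (- a2))"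
    "dens H0 S0 n2 G2 \<kappa>2 \<le> exp (- (4 * C) * a2)"
    using insert.prems(2) unfolding thin_def by (metis mult_pos_pos zero_less_numeral)
  obtain a n and G :: "nat sgraph" and \<kappa> where 3: "A \<le> a" "0 < a" "host F n G \<kappa> (exp (- a))"
    and d: "\<And>(H::'h sgraph) S. simple_graph H \<Longrightarrow>
      dens H S n1 G1 \<kappa>1 \<le> exp (- (4 * C) * a1) \<or> dens H S n2 G2 \<kappa>2 \<le> exp (- (4 * C) * a2) \<Longrightarrow>
      dens H S n G \<kappa> \<le> exp (- C * a)"
    using host_combine[OF F 1(2,1) 2(2,1), of A] insert.prems(2) by (metis less_eq_real_def)
  have "\<forall>(H, S)\<in>insert i I. dens H S n G \<kappa> \<le> exp (- C * a)"
  proof (intro ballI, clarify)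
    fix H S assume HS: "(H, S) \<in> insert i I"
    show "dens H S n G \<kappa> \<le> exp (- C * a)"
      by (rule d) (use HS insert.prems(1) i 1(3) 2(3) in auto)
  qed
  then show ?case using 3 by blast
qed

section \<open>Blow-ups and isolated vertices\<close>

lemma line_unique:
  fixes p i j i' j' s t :: nat
  assumes p: "prime p" and lt: "i < p" "j < p" "i' < p" "j' < p" "s < p" "t < p" and st: "s \<noteq> t"
    and s: "(i + j * s) mod p = (i' + j' * s) mod p" and t: "(i + j * t) mod p = (i' + j' * t) mod p"
  shows "i = i' \<and> j = j'"
proof -
  have bound: "\<bar>int u - int v\<bar> < int p" if "u < p" "v < p" for u v
    using that by linarith
  have small: "z = 0" if "int p dvd z" "\<bar>z\<bar> < int p" for z :: int
    using dvd_imp_le_int[OF _ that(1)] that(2) by (cases "z = 0") simp_all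
  have dvd: "int p dvd (int i + int j * int r) - (int i' + int j' * int r)"
    if "(i + j * r) mod p = (i' + j' * r) mod p" for r
  proof -
    have "(int i + int j * int r) mod int p = (int i' + int j' * int r) mod int p"
      using arg_cong[OF that, of int] by (simp add: of_nat_mod)
    then show ?thesis by (simp add: mod_eq_dvd_iff)
  qed
  have "int p dvd ((int i + int j * int s) - (int i' + int j' * int s)) -
      ((int i + int j * int t) - (int i' + int j' * int t))"
    using dvd[OF s] dvd[OF t] by (rule dvd_diff)
  also have "\<dots> = (int j - int j') * (int s - int t)" by (simp add: algebra_simps)
  finally have "int p dvd int j - int j' \<or> int p dvd int s - int t"
    using p by (simp add: prime_dvd_mult_iff)
  moreover have "\<not> int p dvd int s - int t"
  proof
    assume "int p dvd int s - int t"
    from small[OF this bound[OF lt(5,6)]] show False using st by simp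
  qed
  ultimately have "int p dvd int j - int j'" by blast
  from small[OF this bound[OF lt(2,4)]] have j: "j = j'" by simp
  then have "int p dvd int i - int i'" using dvd[OF s] by simp
  from small[OF this bound[OF lt(1,3)]] show ?thesis using j by simp
qed

text \<open>Every vertex is replaced by \<open>p\<close> copies. Each copy of \<open>F\<close> must give \<open>p\<^sup>2\<close>
  edge-disjoint copies, so that no factor is lost. They are indexed by the lines \<open>i + j s\<close>
  over the field with \<open>p\<close> elements, evaluated at points \<open>s = g a\<close> that number the vertices of
  \<open>F\<close>: a line is determined by its values at two points, that is, by one edge.\<close>

lemma host_blowup:
  fixes G :: "nat sgraph"
  assumes F: "simple_graph F" "edges F \<noteq> {}" and h: "host F n G \<kappa> q" and p: "prime p" "order F < p"
  shows "\<exists>(G'::nat sgraph) \<kappa>'. host F (n * p) G' \<kappa>' q \<and> order G' = order G * p \<and>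
    (\<forall>(H::'h sgraph) S. simple_graph H \<longrightarrow> dens H S (n * p) G' \<kappa>' \<le> dens H S n G \<kappa>)"
proof -
  define V where "V = verts G \<times> {..<p}"
  define Q where "Q = (\<lambda>e1 (e2 :: nat set). e1 \<in> edges G)"
  define G' where "G' = pullback V Q"
  define \<kappa>' where "\<kappa>' = \<kappa> \<circ> p1"
  obtain P where P: "col_packing F G \<kappa> P" "q * real n ^ 2 \<le> real (card P)"
    using h by (auto simp: host_def)
  have G: "simple_graph G" "colouring F G \<kappa>" "order G \<le> n" "0 < n"
    using h by (auto simp: host_def)
  have fin: "finite (verts G)" "finite (verts F)" using G F(1) by (auto simp: simple_graph_def)
  have finV: "finite V" using fin by (simp add: V_def)
  have p0: "0 < p" using p by (simp add: prime_gt_0_nat)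
  obtain g where g: "bij_betw g (verts F) {..<order F}"
    using ex_bij_betw_finite_nat[OF fin(2)] by (auto simp: lessThan_atLeast0)
  have gp: "g a < p" if "a \<in> verts F" for a using bij_betw_apply[OF g that] p(2) by simp
  have sG: "simple_graph G'" unfolding G'_def using finV by (rule simple_pullback)
  have cG: "colouring F G' \<kappa>'"
    unfolding G'_def
  proof (rule colouring_pullback)
    fix x y assume "(x, y) \<in> V"
    then show "\<kappa>' (prod_encode (x, y)) \<in> verts F"
      using G(2) by (auto simp: V_def \<kappa>'_def colouring_def is_hom_def)
  next
    fix e assume "Q (p1 ` e) (p2 ` e)"
    then have "\<kappa> ` p1 ` e \<in> edges F" using G(2) by (auto simp: Q_def colouring_def is_hom_def)
    then show "\<kappa>' ` e \<in> edges F" by (simp add: \<kappa>'_def image_comp)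
  qed
  have oG: "order G' = order G * p"
    by (simp add: G'_def order_pullback V_def card_cartesian_product)
  define line where "line = (\<lambda>(i, j) a. (i + j * g a) mod p)"
  define M where "M = (\<lambda>(f, ij). pair_map (verts F) f (line ij))"
  define P' where "P' = M ` (P \<times> ({..<p} \<times> {..<p}))"
  note D = col_packingD[OF P(1)]
  have unique: "\<psi> = \<psi>' \<and> ij = ij'"
    if a: "\<psi> \<in> P" "\<psi>' \<in> P" "ij \<in> {..<p} \<times> {..<p}" "ij' \<in> {..<p} \<times> {..<p}" "e \<in> edges F"
      and eq: "M (\<psi>, ij) ` e = M (\<psi>', ij') ` e" for \<psi> \<psi>' ij ij' e
  proof -
    have eF: "e \<subseteq> verts F" "card e = 2" using edge_D[OF F(1) a(5)] by auto
    have "\<psi> ` e = \<psi>' ` e"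
      using pair_map_proj(1)[OF eF(1), of \<psi> "line ij"] pair_map_proj(1)[OF eF(1), of \<psi>' "line ij'"]
        eq by (simp add: M_def)
    then have same: "\<psi> = \<psi>'"
      using packing_eqI[OF _ a(1,2,5)] P(1) unfolding col_packing_def by blast
    have line: "line ij b = line ij' b" if "b \<in> e" for b
    proof -
      have "M (\<psi>, ij) b \<in> M (\<psi>', ij') ` e" using eq that by blast
      then obtain c where c: "c \<in> e" "M (\<psi>, ij) b = M (\<psi>', ij') c" by blast
      then have "\<psi> b = \<psi> c" "line ij b = line ij' c"
        using subsetD[OF eF(1) that] subsetD[OF eF(1) c(1)] same by (simp_all add: M_def)
      moreover have "b = c" using \<open>\<psi> b = \<psi> c\<close> D(4)[OF a(1)] that c(1) eF(1) by (auto dest: inj_onD)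
      ultimately show ?thesis by simp
    qed
    obtain b c where bc: "e = {b, c}" "b \<noteq> c" using eF(2) by (auto simp: card_2_iff)
    have "g b \<noteq> g c" using g eF(1) bc by (auto simp: bij_betw_def inj_on_def)
    obtain i j where ij: "ij = (i, j)" by (cases ij)
    obtain i' j' where ij': "ij' = (i', j')" by (cases ij')
    have "i = i' \<and> j = j'"
    proof (rule line_unique[OF p(1)])
      show "i < p" "j < p" "i' < p" "j' < p" using a(3,4) ij ij' by auto
      show "g b < p" "g c < p" using gp eF(1) bc(1) by auto
      show "g b \<noteq> g c" by fact
      show "(i + j * g b) mod p = (i' + j' * g b) mod p" "(i + j * g c) mod p = (i' + j' * g c) mod p"
        using line[of b] line[of c] bc(1) ij ij' by (simp_all add: line_def)
    qed
    then show ?thesis using same ij ij' by simp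
  qed
  have pP: "col_packing F G' \<kappa>' P'"
  proof (rule col_packingI[OF F(1)])
    fix \<psi> assume "\<psi> \<in> P'"
    then obtain f ij where f: "f \<in> P" "\<psi> = pair_map (verts F) f (line ij)"
      by (auto simp: P'_def M_def)
    have inV: "(f a, line ij a) \<in> V" if "a \<in> verts F" for a
      using D(1)[OF f(1)] that p0 by (auto simp: V_def line_def split: prod.split)
    then show "\<psi> \<in> verts F \<rightarrow>\<^sub>E verts G'" using f(2) by (auto simp: G'_def pullback_def pair_map_def)
    show "\<kappa>' (\<psi> a) = a" if "a \<in> verts F" for a
      using D(3)[OF f(1) that] that f(2) by (simp add: \<kappa>'_def)
    show "\<psi> ` e \<in> edges G'" if e: "e \<in> edges F" for e
      unfolding G'_def
    proof (rule pair_map_edge)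
      have eF: "e \<subseteq> verts F" "card e = 2" using edge_D[OF F(1) e] by auto
      then show "card e = 2" "\<And>a. a \<in> e \<Longrightarrow> (f a, line ij a) \<in> V"
        "\<And>a. a \<in> e \<Longrightarrow> \<psi> a = prod_encode (f a, line ij a)"
        using inV f(2) by auto
      show "inj_on f e \<or> inj_on (line ij) e" using D(4)[OF f(1)] eF by (meson inj_on_subset)
      show "Q (f ` e) (line ij ` e)" using D(2)[OF f(1) e] by (simp add: Q_def)
    qed
  next
    fix \<psi> \<psi>' e assume a: "\<psi> \<in> P'" "\<psi>' \<in> P'" "e \<in> edges F" "\<psi> ` e = \<psi>' ` e"
    obtain f ij where f: "f \<in> P" "ij \<in> {..<p} \<times> {..<p}" "\<psi> = M (f, ij)"
      using a(1) unfolding P'_def by blast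
    obtain f' ij' where f': "f' \<in> P" "ij' \<in> {..<p} \<times> {..<p}" "\<psi>' = M (f', ij')"
      using a(2) unfolding P'_def by blast
    show "\<psi> = \<psi>'" using unique[OF f(1) f'(1) f(2) f'(2) a(3)] a(4) f(3) f'(3) by simp
  qed
  have "q * real (n * p) ^ 2 \<le> real (card P')"
  proof -
    obtain e where e: "e \<in> edges F" using F(2) by blast
    have "inj_on M (P \<times> ({..<p} \<times> {..<p}))"
    proof (rule inj_onI)
      fix x y assume *: "x \<in> P \<times> ({..<p} \<times> {..<p})" "y \<in> P \<times> ({..<p} \<times> {..<p})" "M x = M y"
      obtain f ij where x: "x = (f, ij)" by (cases x)
      obtain f' ij' where y: "y = (f', ij')" by (cases y)
      note xy = x y
      show "x = y" using unique[of f f' ij ij' e] * e xy by auto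
    qed
    then have "card P' = card P * p ^ 2"
      by (simp add: P'_def card_image card_cartesian_product power2_eq_square)
    then show ?thesis
      using mult_right_mono[OF P(2), of "real p ^ 2"] by (simp add: power_mult_distrib mult.assoc)
  qed
  then have host: "host F (n * p) G' \<kappa>' q"
    unfolding host_def using sG cG oG G(3,4) p0 pP by auto
  have "dens H S (n * p) G' \<kappa>' \<le> dens H S n G \<kappa>"
    if H: "simple_graph H" for H :: "'h sgraph" and S
  proof -
    have fH: "finite (verts H)" using H by (simp add: simple_graph_def)
    have "card (list_homs H S G' \<kappa>') \<le> card (list_homs H S G \<kappa>) * card (verts H \<rightarrow>\<^sub>E {..<p})"
      unfolding G'_def
    proof (rule list_homs_pullback_le)
      show "finite (list_homs H S G \<kappa>)" "finite (verts H \<rightarrow>\<^sub>E {..<p})"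
        using finite_list_homs fH fin by (auto intro: finite_PiE)
      fix \<phi> assume "\<phi> \<in> list_homs H S (pullback V Q) \<kappa>'"
      note E = list_homs_pullbackD[OF H this]
      have "\<kappa> (p1 (\<phi> x)) \<in> S x \<and> p1 (\<phi> x) \<in> verts G \<and> p2 (\<phi> x) < p" if "x \<in> verts H" for x
        using E(1)[OF that] E(2)[OF that] by (auto simp: V_def \<kappa>'_def)
      moreover have "restrict (p1 \<circ> \<phi>) (verts H) ` e \<in> edges G" if "e \<in> edges H" for e
        using E(3)[OF that] by (simp add: Q_def)
      ultimately show "restrict (p1 \<circ> \<phi>) (verts H) \<in> list_homs H S G \<kappa> \<and>
          restrict (p2 \<circ> \<phi>) (verts H) \<in> verts H \<rightarrow>\<^sub>E {..<p}"
        by (auto simp: list_homs_def)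
    qed
    then have "real (card (list_homs H S G' \<kappa>')) \<le> real (card (list_homs H S G \<kappa>)) * real p ^ order H"
      using fH by (simp add: card_funcsetE flip: of_nat_mult of_nat_power)
    then show ?thesis using p0 G(4) by (simp add: dens_def power_mult_distrib field_simps)
  qed
  then show ?thesis using host oG by blast
qed

lemma host_pad:
  fixes G :: "nat sgraph"
  assumes F: "simple_graph F" "edges F \<noteq> {}" and h: "host F n G \<kappa> q"
  shows "\<exists>(G'::nat sgraph) \<kappa>'. host F n G' \<kappa>' q \<and> order G' = n \<and>
    (\<forall>(H::'h sgraph) S. (\<forall>x\<in>verts H. \<exists>e\<in>edges H. x \<in> e) \<longrightarrow>
      list_homs H S G' \<kappa>' = list_homs H S G \<kappa>)"
proof -
  have G: "simple_graph G" "colouring F G \<kappa>" "order G \<le> n" "0 < n"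
    using h by (auto simp: host_def)
  obtain P where P: "col_packing F G \<kappa> P" "q * real n ^ 2 \<le> real (card P)"
    using h by (auto simp: host_def)
  have fin: "finite (verts G)" using G by (simp add: simple_graph_def)
  obtain a0 where a0: "a0 \<in> verts F" using F edge_D[OF F(1)] by blast
  obtain N where N: "N \<subseteq> - verts G" "finite N" "card N = n - order G"
    using infinite_arbitrarily_large[of "- verts G"] fin finite_compl[OF fin] by auto
  define G' where "G' = \<lparr>verts = verts G \<union> N, edges = edges G\<rparr>"
  define \<kappa>' where "\<kappa>' = (\<lambda>x. if x \<in> verts G then \<kappa> x else a0)"
  have \<kappa>e: "\<kappa>' ` e = \<kappa> ` e" if "e \<in> edges G" for e
    using edge_D(1)[OF G(1) that] by (auto simp: \<kappa>'_def)
  have sG: "simple_graph G'" using G(1) fin N by (auto simp: simple_graph_def G'_def)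
  have cG: "colouring F G' \<kappa>'"
    using G(2) a0 \<kappa>e by (auto simp: colouring_def is_hom_def G'_def \<kappa>'_def)
  have oG: "order G' = n"
    using fin N G(3) by (simp add: G'_def card_Un_disjoint disjoint_eq_subset_Compl Int_commute)
  note D = col_packingD[OF P(1)]
  have "col_packing F G' \<kappa>' P"
  proof (rule col_packingI[OF F(1)])
    fix \<psi> assume p: "\<psi> \<in> P"
    show "\<psi> \<in> verts F \<rightarrow>\<^sub>E verts G'" using D(1)[OF p] by (auto simp: G'_def)
    show "\<psi> ` e \<in> edges G'" if "e \<in> edges F" for e using D(2)[OF p that] by (simp add: G'_def)
    show "\<kappa>' (\<psi> a) = a" if "a \<in> verts F" for a
      using D(1,3)[OF p] that by (auto simp: \<kappa>'_def)
    fix \<psi>' e assume "\<psi>' \<in> P" "e \<in> edges F" "\<psi> ` e = \<psi>' ` e"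
    then show "\<psi> = \<psi>'" using packing_eqI[OF _ p] P(1) unfolding col_packing_def by blast
  qed
  then have host: "host F n G' \<kappa>' q" unfolding host_def using sG cG oG G(4) P(2) by auto
  have "list_homs H S G' \<kappa>' = list_homs H S G \<kappa>"
    if H: "\<forall>x\<in>verts H. \<exists>e\<in>edges H. x \<in> e" for H :: "'h sgraph" and S
  proof -
    have inG: "\<phi> x \<in> verts G" if "\<forall>e\<in>edges H. \<phi> ` e \<in> edges G" "x \<in> verts H" for \<phi> x
      using that H edge_D(1)[OF G(1)] by blast
    show ?thesis
    proof (intro equalityI subsetI)
      fix \<phi> assume \<phi>: "\<phi> \<in> list_homs H S G' \<kappa>'"
      then have "\<And>x. x \<in> verts H \<Longrightarrow> \<phi> x \<in> verts G"
        by (intro inG) (auto simp: list_homs_def G'_def)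
      then show "\<phi> \<in> list_homs H S G \<kappa>"
        using \<phi> by (auto simp: list_homs_def G'_def \<kappa>'_def PiE_def)
    next
      fix \<phi> assume \<phi>: "\<phi> \<in> list_homs H S G \<kappa>"
      then have "\<And>x. x \<in> verts H \<Longrightarrow> \<phi> x \<in> verts G" by (auto simp: list_homs_def)
      then show "\<phi> \<in> list_homs H S G' \<kappa>'"
        using \<phi> by (auto simp: list_homs_def G'_def \<kappa>'_def PiE_def)
    qed
  qed
  then show ?thesis using host oG by blast
qed

lemma host_resize:
  assumes "host F n G \<kappa> q" "n \<le> n'"
  shows "host F n' G \<kappa> (q * (real n / real n') ^ 2)"
  using assms by (auto simp: host_def power_divide)

section \<open>Removing isolated vertices\<close>

text \<open>The non-isolated part \<open>H'\<close> of \<open>H\<close> is moved to an initial segment of the natural numbers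
  and its lists are cut down to colours that occur, so that for bounded \<open>m\<close> there are only
  finitely many pairs \<open>(H', S')\<close>. An isolated vertex can be mapped independently to any vertex with an
  admissible colour; this gives the upper bound and the lower bound on the number of
  homomorphisms from \<open>H\<close>.\<close>

lemma core_exists:
  fixes H :: "'h sgraph" and F :: "'f sgraph"
  assumes H: "simple_graph H"
  shows "\<exists>m (H'::nat sgraph) S'. simple_graph H' \<and> verts H' = {..<m} \<and> m \<le> order H \<and>
    (\<forall>x\<in>verts H'. \<exists>e\<in>edges H'. x \<in> e) \<and> S' \<in> {..<m} \<rightarrow>\<^sub>E Pow (verts F) \<and>
    (\<forall>(G::nat sgraph) \<kappa>. simple_graph G \<longrightarrow> colouring F G \<kappa> \<longrightarrow>
      card (list_homs H S G \<kappa>) \<le> card (list_homs H' S' G \<kappa>) * order G ^ (order H - m) \<and>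
      (\<forall>w. (\<forall>x\<in>verts H. w \<le> card {v \<in> verts G. \<kappa> v \<in> S x}) \<longrightarrow>
         card (list_homs H' S' G \<kappa>) * w ^ (order H - m) \<le> card (list_homs H S G \<kappa>)))"
proof -
  have fH: "finite (verts H)" using H by (simp add: simple_graph_def)
  define W where "W = \<Union> (edges H)"
  define J where "J = verts H - W"
  have W: "W \<subseteq> verts H" using edge_D(1)[OF H] by (auto simp: W_def)
  have fW: "finite W" using W fH finite_subset by blast
  define m where "m = card W"
  have m: "m \<le> order H" using W fH by (simp add: m_def card_mono)
  have cJ: "card J = order H - m" using W fW by (simp add: J_def m_def card_Diff_subset)
  have fJ: "finite J" using fH by (simp add: J_def)
  obtain f where f: "bij_betw f {..<m} W"
    using ex_bij_betw_nat_finite[OF fW] by (auto simp: lessThan_atLeast0 m_def)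
  have fi: "inj_on f {..<m}" and fW': "f ` {..<m} = W" using f by (auto simp: bij_betw_def)
  define r where "r = inv_into {..<m} f"
  have r: "r x \<in> {..<m}" "f (r x) = x" if "x \<in> W" for x
    using that fW' by (auto simp: r_def f_inv_into_f inv_into_into simp flip: lessThan_iff)
  have rf: "r (f i) = i" if "i \<in> {..<m}" for i using that fi by (simp add: r_def)
  define H' where "H' = \<lparr>verts = {..<m}, edges = {e. e \<subseteq> {..<m} \<and> f ` e \<in> edges H}\<rparr>"
  define S' where "S' = (\<lambda>i\<in>{..<m}. S (f i) \<inter> verts F)"
  have sH': "simple_graph H'"
    unfolding simple_graph_def
  proof (intro conjI ballI)
    fix e assume e: "e \<in> edges H'"
    then show "e \<subseteq> verts H'" by (simp add: H'_def)
    have "card (f ` e) = 2" using e edge_D(2)[OF H] by (simp add: H'_def)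
    moreover have "inj_on f e" using e fi by (auto simp: H'_def intro: inj_on_subset)
    ultimately show "card e = 2" by (simp add: card_image)
  qed (simp add: H'_def)
  have pre: "r ` e \<in> edges H' \<and> f ` r ` e = e" if "e \<in> edges H" for e
  proof -
    have "e \<subseteq> W" using that by (auto simp: W_def)
    then have "f ` r ` e = e" using r(2) by (force simp: image_image subset_iff)
    moreover have "r ` e \<subseteq> {..<m}" using r(1) \<open>e \<subseteq> W\<close> by blast
    ultimately show ?thesis using that by (simp add: H'_def)
  qed
  have noiso: "\<exists>e\<in>edges H'. i \<in> e" if "i \<in> verts H'" for i
  proof -
    have i: "i \<in> {..<m}" using that by (simp add: H'_def)
    then obtain e where e: "e \<in> edges H" "f i \<in> e" using fW' by (auto simp: W_def)
    then have "i \<in> r ` e" using rf[OF i] by (metis imageI)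
    then show ?thesis using pre[OF e(1)] by blast
  qed
  have S': "S' \<in> {..<m} \<rightarrow>\<^sub>E Pow (verts F)" by (auto simp: S'_def)
  have bounds: "card (list_homs H S G \<kappa>) \<le> card (list_homs H' S' G \<kappa>) * order G ^ (order H - m) \<and>
      (\<forall>w. (\<forall>x\<in>verts H. w \<le> card {v \<in> verts G. \<kappa> v \<in> S x}) \<longrightarrow>
         card (list_homs H' S' G \<kappa>) * w ^ (order H - m) \<le> card (list_homs H S G \<kappa>))"
    if sG: "simple_graph G" and cG: "colouring F G \<kappa>" for G :: "nat sgraph" and \<kappa>
  proof (intro conjI allI impI)
    have fG: "finite (verts G)" using sG by (simp add: simple_graph_def)
    have col: "\<kappa> v \<in> verts F" if "v \<in> verts G" for v
      using cG that by (auto simp: colouring_def is_hom_def)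
    let ?X = "list_homs H S G \<kappa>" and ?X' = "list_homs H' S' G \<kappa>"
    have fX: "finite ?X" using finite_list_homs fH fG by blast
    have fX': "finite ?X'" using finite_list_homs sH' fG by (metis simple_graph_def)
    define \<Phi> where "\<Phi> = (\<lambda>\<phi>::'h \<Rightarrow> nat. (\<lambda>i\<in>{..<m}. \<phi> (f i), restrict \<phi> J))"
    have "inj_on \<Phi> ?X"
    proof (rule inj_onI)
      fix \<phi> \<phi>' assume a: "\<phi> \<in> ?X" "\<phi>' \<in> ?X" "\<Phi> \<phi> = \<Phi> \<phi>'"
      have e1: "(\<lambda>i\<in>{..<m}. \<phi> (f i)) = (\<lambda>i\<in>{..<m}. \<phi>' (f i))" and e2: "restrict \<phi> J = restrict \<phi>' J"
        using a(3) by (auto simp: \<Phi>_def)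
      show "\<phi> = \<phi>'"
      proof (rule extensionalityI)
        show "\<phi> \<in> extensional (verts H)" "\<phi>' \<in> extensional (verts H)"
          using a by (auto simp: list_homs_def PiE_def)
        fix x assume x: "x \<in> verts H"
        show "\<phi> x = \<phi>' x"
        proof (cases "x \<in> W")
          case True
          then show ?thesis using fun_cong[OF e1, of "r x"] r[OF True] by simp
        next
          case False
          then show ?thesis using fun_cong[OF e2, of x] x by (simp add: J_def)
        qed
      qed
    qed
    moreover have "\<Phi> ` ?X \<subseteq> ?X' \<times> (J \<rightarrow>\<^sub>E verts G)"
    proof
      fix z assume "z \<in> \<Phi> ` ?X"
      then obtain \<phi> where \<phi>: "\<phi> \<in> ?X" "z = \<Phi> \<phi>" by blast
      let ?g = "\<lambda>i\<in>{..<m}. \<phi> (f i)"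
      have fm: "f i \<in> verts H" if "i < m" for i using that fW' W by auto
      have "?g ` e \<in> edges G" if "e \<in> edges H'" for e
      proof -
        have e: "e \<subseteq> {..<m}" "f ` e \<in> edges H" using that by (auto simp: H'_def)
        then have "?g ` e = \<phi> ` f ` e" by (auto simp: image_image subset_iff intro!: image_cong)
        then show ?thesis using \<phi>(1) e by (simp add: list_homs_def)
      qed
      moreover have "\<phi> (f i) \<in> verts G \<and> \<kappa> (\<phi> (f i)) \<in> S (f i) \<inter> verts F" if "i < m" for i
        using \<phi>(1) fm[OF that] col by (auto simp: list_homs_def)
      ultimately have "?g \<in> ?X'" by (auto simp: list_homs_def H'_def S'_def)
      moreover have "restrict \<phi> J \<in> J \<rightarrow>\<^sub>E verts G" using \<phi>(1) by (auto simp: list_homs_def J_def)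
      ultimately show "z \<in> ?X' \<times> (J \<rightarrow>\<^sub>E verts G)" using \<phi>(2) by (simp add: \<Phi>_def)
    qed
    ultimately have "card ?X \<le> card (?X' \<times> (J \<rightarrow>\<^sub>E verts G))"
      using fX' fJ fG by (meson card_inj_on_le finite_PiE finite_SigmaI)
    then show "card ?X \<le> card ?X' * order G ^ (order H - m)"
      using fJ cJ by (simp add: card_cartesian_product card_funcsetE)
    fix w assume w: "\<forall>x\<in>verts H. w \<le> card {v \<in> verts G. \<kappa> v \<in> S x}"
    define L where "L = (\<Pi>\<^sub>E x\<in>J. {v \<in> verts G. \<kappa> v \<in> S x})"
    define \<Psi> where "\<Psi> = (\<lambda>(\<phi>, g). \<lambda>x\<in>verts H. if x \<in> W then \<phi> (r x) else (g x :: nat))"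
    have "inj_on \<Psi> (?X' \<times> L)"
    proof (rule inj_onI)
      fix y z assume a: "y \<in> ?X' \<times> L" "z \<in> ?X' \<times> L" "\<Psi> y = \<Psi> z"
      obtain \<phi> g where y: "y = (\<phi>, g)" by (cases y)
      obtain \<phi>' g' where z: "z = (\<phi>', g')" by (cases z)
      have "\<phi> = \<phi>'"
      proof (rule extensionalityI)
        show "\<phi> \<in> extensional {..<m}" "\<phi>' \<in> extensional {..<m}"
          using a y z by (auto simp: list_homs_def PiE_def H'_def)
        fix i assume i: "i \<in> {..<m}"
        then have "f i \<in> W" using fW' by blast
        then show "\<phi> i = \<phi>' i" using fun_cong[OF a(3), of "f i"] y z rf[OF i] W by (auto simp: \<Psi>_def)
      qed
      moreover have "g = g'"
      proof (rule extensionalityI)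
        show "g \<in> extensional J" "g' \<in> extensional J"
          using a y z by (auto simp: L_def PiE_def)
        fix x assume "x \<in> J"
        then show "g x = g' x" using fun_cong[OF a(3), of x] y z by (auto simp: \<Psi>_def J_def)
      qed
      ultimately show "y = z" using y z by simp
    qed
    moreover have "\<Psi> ` (?X' \<times> L) \<subseteq> ?X"
    proof
      fix z assume "z \<in> \<Psi> ` (?X' \<times> L)"
      then obtain \<phi> g where g: "\<phi> \<in> ?X'" "g \<in> L" "z = \<Psi> (\<phi>, g)" by auto
      have "z ` e \<in> edges G" if e: "e \<in> edges H" for e
      proof -
        have "e \<subseteq> W" using e by (auto simp: W_def)
        then have "z ` e = \<phi> ` r ` e"
          using W g(3) by (auto simp: \<Psi>_def image_image subset_iff intro!: image_cong)
        then show ?thesis using pre[OF e] g(1) by (simp add: list_homs_def)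
      qed
      moreover have "z x \<in> verts G \<and> \<kappa> (z x) \<in> S x" if x: "x \<in> verts H" for x
      proof (cases "x \<in> W")
        case True
        have "\<phi> (r x) \<in> verts G" "\<kappa> (\<phi> (r x)) \<in> S' (r x)"
          using g(1) r(1)[OF True] by (auto simp: list_homs_def H'_def)
        then show ?thesis using True x g(3) r[OF True] by (simp add: \<Psi>_def S'_def)
      next
        case False
        then have "x \<in> J" using x by (simp add: J_def)
        then have "g x \<in> {v \<in> verts G. \<kappa> v \<in> S x}" using g(2) unfolding L_def by (rule PiE_mem[rotated])
        then show ?thesis using False x g(3) by (simp add: \<Psi>_def)
      qed
      ultimately show "z \<in> ?X" using g(3) by (auto simp: list_homs_def \<Psi>_def)
    qed
    ultimately have "card (?X' \<times> L) \<le> card ?X" using fX by (meson card_inj_on_le)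
    moreover have "w ^ (order H - m) \<le> card L"
    proof -
      have "w ^ card J = (\<Prod>x\<in>J. w)" by simp
      also have "\<dots> \<le> (\<Prod>x\<in>J. card {v \<in> verts G. \<kappa> v \<in> S x})"
        using w by (intro prod_mono) (auto simp: J_def)
      also have "\<dots> = card L" using fJ by (simp add: L_def card_PiE)
      finally show ?thesis by (simp add: cJ)
    qed
    ultimately show "card ?X' * w ^ (order H - m) \<le> card ?X"
      by (metis card_cartesian_product le_trans mult_le_mono2)
  qed
  show ?thesis
    by (rule exI[of _ m], rule exI[of _ H'], rule exI[of _ S'])
       (use sH' m noiso S' bounds in \<open>simp add: H'_def\<close>)
qed

text \<open>An edge \<open>{c, d}\<close> of \<open>F\<close> maps edge-disjoint coloured copies injectively to pairs of a
  vertex of colour \<open>c\<close> and a vertex of colour \<open>d\<close>, so there are at least \<open>q n\<close> of the former.\<close>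

lemma host_class_large:
  fixes G :: "nat sgraph"
  assumes F: "simple_graph F" and h: "host F n G \<kappa> q" and e: "e \<in> edges F" "c \<in> e"
  shows "q * real n \<le> real (card {v \<in> verts G. \<kappa> v = c})"
proof -
  obtain P where P: "col_packing F G \<kappa> P" "q * real n ^ 2 \<le> real (card P)"
    using h by (auto simp: host_def)
  have G: "simple_graph G" "order G \<le> n" "0 < n" using h by (auto simp: host_def)
  have fG: "finite (verts G)" using G by (simp add: simple_graph_def)
  obtain d where d: "e = {c, d}" using edge_D(2)[OF F e(1)] e(2) by (auto simp: card_2_iff)
  have cd: "c \<in> verts F" "d \<in> verts F" using edge_D(1)[OF F e(1)] d by auto
  let ?V = "{v \<in> verts G. \<kappa> v = c}"
  note D = col_packingD[OF P(1)]
  have "inj_on (\<lambda>\<psi>. (\<psi> c, \<psi> d)) P"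
  proof (rule inj_onI)
    fix \<psi> \<psi>' assume a: "\<psi> \<in> P" "\<psi>' \<in> P" "(\<psi> c, \<psi> d) = (\<psi>' c, \<psi>' d)"
    then have "\<psi> ` e = \<psi>' ` e" using d by simp
    then show "\<psi> = \<psi>'" using packing_eqI[OF _ a(1,2) e(1)] P(1) unfolding col_packing_def by blast
  qed
  moreover have "(\<lambda>\<psi>. (\<psi> c, \<psi> d)) ` P \<subseteq> ?V \<times> verts G"
    using D(1,3) cd by fastforce
  ultimately have "card P \<le> card (?V \<times> verts G)"
    by (rule card_inj_on_le) (use fG in auto)
  also have "\<dots> \<le> card ?V * n" using G(2) by (simp add: card_cartesian_product)
  finally have "real (card P) \<le> real (card ?V) * real n" by (metis of_nat_le_iff of_nat_mult)
  then have "(q * real n) * real n \<le> real (card ?V) * real n" using P(2) by (simp add: power2_eq_square)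
  then show ?thesis using G(3) by simp
qed

lemma dens_resize:
  assumes "n \<le> n'" "0 < n"
  shows "dens H S n' G \<kappa> \<le> dens H S n G \<kappa>"
  unfolding dens_def using assms by (intro divide_left_mono power_mono mult_pos_pos) auto

text \<open>In a host with parameter \<open>exp (- a)\<close> each of the \<open>k\<close> isolated vertices has at least
  \<open>exp (- a) n\<close> admissible images. Removing them raises the density by a factor of at most
  \<open>exp (k a)\<close>, which costs \<open>k\<close> in the exponent; and \<open>k\<close> is fixed before the exponent.\<close>

lemma thin_core:
  fixes H :: "'h sgraph" and H' :: "nat sgraph"
  assumes F: "simple_graph F" and thin: "thin F H S"
    and S: "\<And>x. x \<in> verts H \<Longrightarrow> \<exists>c\<in>S x. \<exists>e\<in>edges F. c \<in> e"
    and H': "order H' \<le> order H"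
    and le: "\<And>(G::nat sgraph) \<kappa> w. simple_graph G \<Longrightarrow> colouring F G \<kappa> \<Longrightarrow>
      (\<forall>x\<in>verts H. w \<le> card {v \<in> verts G. \<kappa> v \<in> S x}) \<Longrightarrow>
      card (list_homs H' S' G \<kappa>) * w ^ (order H - order H') \<le> card (list_homs H S G \<kappa>)"
  shows "thin F H' S'"
  unfolding thin_def
proof (intro allI impI)
  fix C :: real assume "0 < C"
  define k where "k = order H - order H'"
  have "0 < C + real k" using \<open>0 < C\<close> by simp
  then obtain a n and G :: "nat sgraph" and \<kappa> where a: "0 < a" and h: "host F n G \<kappa> (exp (- a))"
    and d: "dens H S n G \<kappa> \<le> exp (- (C + real k) * a)"
    using thin unfolding thin_def by blast
  have G: "simple_graph G" "colouring F G \<kappa>" "0 < n" using h by (auto simp: host_def)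
  have fG: "finite (verts G)" using G by (simp add: simple_graph_def)
  define w where "w = nat \<lceil>exp (- a) * real n\<rceil>"
  have w: "exp (- a) * real n \<le> real w" unfolding w_def by linarith
  have "w \<le> card {v \<in> verts G. \<kappa> v \<in> S x}" if x: "x \<in> verts H" for x
  proof -
    obtain c e where c: "c \<in> S x" "e \<in> edges F" "c \<in> e" using S[OF x] by blast
    have "{v \<in> verts G. \<kappa> v = c} \<subseteq> {v \<in> verts G. \<kappa> v \<in> S x}" using c by auto
    then have "card {v \<in> verts G. \<kappa> v = c} \<le> card {v \<in> verts G. \<kappa> v \<in> S x}"
      using fG by (intro card_mono) auto
    then have "exp (- a) * real n \<le> real (card {v \<in> verts G. \<kappa> v \<in> S x})"
      using host_class_large[OF F h c(2,3)] by linarith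
    then show ?thesis unfolding w_def by linarith
  qed
  then have "card (list_homs H' S' G \<kappa>) * w ^ k \<le> card (list_homs H S G \<kappa>)"
    using le[OF G(1,2)] by (simp add: k_def)
  then have "real (card (list_homs H' S' G \<kappa>)) * real w ^ k \<le> real (card (list_homs H S G \<kappa>))"
    by (metis of_nat_le_iff of_nat_mult of_nat_power)
  moreover have "(exp (- a) * real n) ^ k \<le> real w ^ k" using w by (intro power_mono) auto
  ultimately have "real (card (list_homs H' S' G \<kappa>)) * (exp (- a) * real n) ^ k
      \<le> real (card (list_homs H S G \<kappa>))"
    by (meson mult_left_mono of_nat_0_le_iff order_trans)
  then have "real (card (list_homs H' S' G \<kappa>)) * (exp (- a) * real n) ^ k / real n ^ order H \<le> dens H S n G \<kappa>"
    unfolding dens_def by (intro divide_right_mono) auto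
  moreover have "real (card (list_homs H' S' G \<kappa>)) * (exp (- a) * real n) ^ k / real n ^ order H =
      dens H' S' n G \<kappa> * exp (- a) ^ k"
  proof -
    have "real n ^ order H = real n ^ order H' * real n ^ k"
      using H' by (simp add: k_def flip: power_add)
    then show ?thesis using G(3) by (simp add: dens_def power_mult_distrib)
  qed
  ultimately have "dens H' S' n G \<kappa> * exp (- a) ^ k \<le> exp (- C * a) * exp (- a) ^ k"
    using d by (simp add: exp_add[symmetric] exp_of_nat_mult[symmetric] algebra_simps)
  then have "dens H' S' n G \<kappa> \<le> exp (- C * a)" by simp
  then show "\<exists>a n (G::nat sgraph) \<kappa>. 0 < a \<and> host F n G \<kappa> (exp (- a)) \<and>
      dens H' S' n G \<kappa> \<le> exp (- C * a)"
    using a h by blast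
qed

text \<open>The exponent \<open>C\<close> fixes a threshold \<open>M\<close>. The cores with fewer than \<open>M\<close> vertices
  form a finite family, which has a common host; that host is then padded with isolated vertices,
  which handles the cores with at least \<open>M\<close> vertices, and finally blown up.\<close>

lemma thin_family:
  fixes U :: "('h sgraph \<times> ('h \<Rightarrow> 'f set)) set"
  assumes F: "simple_graph F" "edges F \<noteq> {}"
    and U: "\<And>H S. (H, S) \<in> U \<Longrightarrow> simple_graph H \<and> thin F H S \<and>
      (\<forall>x\<in>verts H. \<exists>c\<in>S x. \<exists>e\<in>edges F. c \<in> e)"
    and C: "0 < C"
  shows "\<exists>\<epsilon>. 0 < \<epsilon> \<and> \<epsilon> < 1 \<and> (\<forall>n0. \<exists>(G::nat sgraph) \<kappa> P. simple_graph G \<and> colouring F G \<kappa> \<and>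
    n0 \<le> order G \<and> col_packing F G \<kappa> P \<and> \<epsilon> * real (order G) ^ 2 \<le> real (card P) \<and>
    (\<forall>(H, S)\<in>U. real (card (list_homs H S G \<kappa>)) < \<epsilon> powr C * real (order G) ^ order H))"
proof -
  define C0 where "C0 = C + 1"
  define M where "M = nat \<lceil>4 * C0\<rceil>"
  have M: "4 * C0 \<le> real M" unfolding M_def by linarith
  define core where "core = (\<lambda>H (S :: 'h \<Rightarrow> 'f set) m (H'::nat sgraph) S'.
    simple_graph H' \<and> verts H' = {..<m} \<and> m \<le> order H \<and>
    (\<forall>x\<in>verts H'. \<exists>e\<in>edges H'. x \<in> e) \<and> S' \<in> {..<m} \<rightarrow>\<^sub>E Pow (verts F) \<and>
    (\<forall>(G::nat sgraph) \<kappa>. simple_graph G \<longrightarrow> colouring F G \<kappa> \<longrightarrow>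
      card (list_homs H S G \<kappa>) \<le> card (list_homs H' S' G \<kappa>) * order G ^ (order H - m) \<and>
      (\<forall>w. (\<forall>x\<in>verts H. w \<le> card {v \<in> verts G. \<kappa> v \<in> S x}) \<longrightarrow>
         card (list_homs H' S' G \<kappa>) * w ^ (order H - m) \<le> card (list_homs H S G \<kappa>))))"
  have core: "\<exists>m H' S'. core H S m H' S'" if "(H, S) \<in> U" for H S
    unfolding core_def by (rule core_exists) (use U[OF that] in blast)
  have core_thin: "thin F H' S'" if "(H, S) \<in> U" "core H S m H' S'" for H S m H' S'
  proof -
    have c: "verts H' = {..<m}" "m \<le> order H"
      "\<And>(G::nat sgraph) \<kappa> w. simple_graph G \<Longrightarrow> colouring F G \<kappa> \<Longrightarrow>
        (\<forall>x\<in>verts H. w \<le> card {v \<in> verts G. \<kappa> v \<in> S x}) \<Longrightarrow>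
        card (list_homs H' S' G \<kappa>) * w ^ (order H - m) \<le> card (list_homs H S G \<kappa>)"
      using that(2) unfolding core_def by blast+
    have o: "order H' = m" by (simp add: c(1))
    show ?thesis
    proof (rule thin_core[OF F(1)])
      show "thin F H S" using U[OF that(1)] by blast
      show "\<exists>c\<in>S x. \<exists>e\<in>edges F. c \<in> e" if "x \<in> verts H" for x
        using U[OF \<open>(H, S) \<in> U\<close>] that by blast
      show "order H' \<le> order H" using o c(2) by simp
      show "card (list_homs H' S' G \<kappa>) * w ^ (order H - order H') \<le> card (list_homs H S G \<kappa>)"
        if "simple_graph G" "colouring F G \<kappa>" "\<forall>x\<in>verts H. w \<le> card {v \<in> verts G. \<kappa> v \<in> S x}"
        for G :: "nat sgraph" and \<kappa> w
        unfolding o using c(3)[OF that] .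
    qed
  qed
  define J where "J = {(H'::nat sgraph, S'). \<exists>m<M. simple_graph H' \<and> verts H' = {..<m} \<and>
     S' \<in> {..<m} \<rightarrow>\<^sub>E Pow (verts F) \<and> thin F H' S'}"
  have JS: "J \<subseteq> (\<Union>m<M. (\<lambda>E. \<lparr>verts = {..<m}, edges = E\<rparr>) ` Pow (Pow {..<m}) \<times>
      ({..<m} \<rightarrow>\<^sub>E Pow (verts F)))"
  proof
    fix z assume "z \<in> J"
    then obtain H' S' m where z: "z = (H', S')" "m < M" "simple_graph H'" "verts H' = {..<m}"
      "S' \<in> {..<m} \<rightarrow>\<^sub>E Pow (verts F)" by (auto simp: J_def)
    have "edges H' \<in> Pow (Pow {..<m})" using z(3,4) by (auto simp: simple_graph_def)
    moreover have "H' = \<lparr>verts = {..<m}, edges = edges H'\<rparr>" using z(4) by simp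
    ultimately have "H' \<in> (\<lambda>E. \<lparr>verts = {..<m}, edges = E\<rparr>) ` Pow (Pow {..<m})" by (rule image_eqI[rotated])
    then show "z \<in> (\<Union>m<M. (\<lambda>E. \<lparr>verts = {..<m}, edges = E\<rparr>) ` Pow (Pow {..<m}) \<times>
      ({..<m} \<rightarrow>\<^sub>E Pow (verts F)))" using z by blast
  qed
  have "finite (verts F)" using F(1) by (simp add: simple_graph_def)
  then have finJ: "finite J"
    by (intro finite_subset[OF JS] finite_UN_I finite_SigmaI finite_imageI finite_PiE) simp_all
  have "\<exists>a n (G::nat sgraph) \<kappa>. ln 4 \<le> a \<and> 0 < a \<and> host F n G \<kappa> (exp (- a)) \<and>
      (\<forall>(H, S)\<in>J. dens H S n G \<kappa> \<le> exp (- (4 * C0) * a))"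
  proof (rule thin_finite_family[OF F finJ])
    show "simple_graph H \<and> thin F H S" if "(H, S) \<in> J" for H S using that unfolding J_def by blast
    show "0 < 4 * C0" using C by (simp add: C0_def)
  qed
  then obtain a n and G :: "nat sgraph" and \<kappa> where a: "ln 4 \<le> a" "0 < a"
    and h: "host F n G \<kappa> (exp (- a))"
    and dJ: "\<forall>(H, S)\<in>J. dens H S n G \<kappa> \<le> exp (- (4 * C0) * a)"
    by blast
  have n: "0 < n" "order G \<le> n" using h by (auto simp: host_def)
  have ea: "4 \<le> exp a" using a by (metis exp_le_cancel_iff exp_ln zero_less_numeral)
  \<comment> \<open>Padding by the factor \<open>k\<close> divides the parameter by \<open>k\<^sup>2 \<le> 4 exp (2 a) \<le> exp (3 a)\<close>, so it
      becomes \<open>exp (- 4 a)\<close>; hence the factors \<open>4\<close> in the exponent and in the threshold.\<close>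
  define k where "k = nat \<lceil>exp a\<rceil>"
  have k: "exp a \<le> real k" "real k \<le> 2 * exp a" unfolding k_def using ea by linarith+
  then have k0: "0 < k" using ea by (auto intro: gr0I)
  define N where "N = n * k"
  have N: "0 < N" "n \<le> N" using n k0 by (auto simp: N_def)
  define \<epsilon> where "\<epsilon> = exp (- 4 * a)"
  have hN: "host F N G \<kappa> \<epsilon>"
  proof (rule host_mono)
    show "host F N G \<kappa> (exp (- a) * (real n / real N) ^ 2)" using host_resize[OF h N(2)] .
    have "real k ^ 2 \<le> (2 * exp a) ^ 2" using k by (intro power_mono) auto
    also have "\<dots> \<le> exp a * exp a ^ 2" using ea by (simp add: power_mult_distrib)
    also have "\<dots> = exp (a + (a + a))" by (simp only: exp_add power2_eq_square)
    finally have "real k ^ 2 \<le> exp (3 * a)" by simp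
    then have "exp (- a) / exp (3 * a) \<le> exp (- a) / real k ^ 2"
      using k0 by (intro divide_left_mono) auto
    then show "\<epsilon> \<le> exp (- a) * (real n / real N) ^ 2"
      using n by (simp add: \<epsilon>_def N_def power_divide flip: exp_diff)
  qed
  have powr: "\<epsilon> powr C0 = exp (- (4 * C0) * a)" by (simp add: \<epsilon>_def powr_def)
  have dN: "dens H' S' N G \<kappa> \<le> \<epsilon> powr C0" if HU: "(H, S) \<in> U" and c: "core H S m H' S'" for H S m H' S'
  proof (cases "m < M")
    case True
    have "simple_graph H'" "verts H' = {..<m}" "S' \<in> {..<m} \<rightarrow>\<^sub>E Pow (verts F)"
      using c unfolding core_def by blast+
    then have "(H', S') \<in> J" using True core_thin[OF HU c] unfolding J_def by blast
    then have "dens H' S' n G \<kappa> \<le> \<epsilon> powr C0" using dJ powr by auto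
    then show ?thesis using dens_resize[OF N(2) n(1)] order_trans by blast
  next
    case False
    have "verts H' = {..<m}" using c unfolding core_def by blast
    then have o: "finite (verts H')" "order H' = m" by simp_all
    have fG: "finite (verts G)" using h by (simp add: host_def simple_graph_def)
    have "card (list_homs H' S' G \<kappa>) \<le> order G ^ m"
      using card_list_homs_le[OF o(1) fG] o(2) by simp
    also have "\<dots> \<le> n ^ m" using n by (intro power_mono) auto
    finally have "real (card (list_homs H' S' G \<kappa>)) \<le> real n ^ m" by (metis of_nat_le_iff of_nat_power)
    then have "dens H' S' N G \<kappa> \<le> real n ^ m / real N ^ m"
      unfolding dens_def o(2) by (intro divide_right_mono) auto
    also have "\<dots> = (1 / real k) ^ m" using n by (simp add: N_def power_divide power_mult_distrib)
    also have "\<dots> \<le> exp (- a) ^ m"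
      using k(1) k0 by (intro power_mono) (auto simp: exp_minus field_simps)
    also have "\<dots> = exp (real m * - a)" by (rule exp_of_nat_mult[symmetric])
    also have "\<dots> \<le> \<epsilon> powr C0"
    proof -
      have "4 * C0 \<le> real m" using M False by linarith
      then show ?thesis using a(2) by (simp add: powr)
    qed
    finally show ?thesis .
  qed
  obtain G1 :: "nat sgraph" and \<kappa>1 where h1: "host F N G1 \<kappa>1 \<epsilon>" "order G1 = N"
    and eq1: "\<And>(H::nat sgraph) S. (\<forall>x\<in>verts H. \<exists>e\<in>edges H. x \<in> e) \<Longrightarrow>
      list_homs H S G1 \<kappa>1 = list_homs H S G \<kappa>"
    using host_pad[OF F hN] by blast
  have "\<exists>(G::nat sgraph) \<kappa> P. simple_graph G \<and> colouring F G \<kappa> \<and>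
    n0 \<le> order G \<and> col_packing F G \<kappa> P \<and> \<epsilon> * real (order G) ^ 2 \<le> real (card P) \<and>
    (\<forall>(H, S)\<in>U. real (card (list_homs H S G \<kappa>)) < \<epsilon> powr C * real (order G) ^ order H)" for n0
  proof -
    obtain p where p: "prime p" "max (order F) n0 < p" using bigger_prime by blast
    then have pF: "order F < p" by simp
    obtain G2 :: "nat sgraph" and \<kappa>2 where h2: "host F (N * p) G2 \<kappa>2 \<epsilon>" and o2: "order G2 = N * p"
      and d2: "\<And>(H::nat sgraph) S. simple_graph H \<Longrightarrow> dens H S (N * p) G2 \<kappa>2 \<le> dens H S N G1 \<kappa>1"
      using host_blowup[OF F h1(1) p(1) pF] h1(2) by blast
    obtain P where G2: "simple_graph G2" "colouring F G2 \<kappa>2" and P: "col_packing F G2 \<kappa>2 P"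
      "\<epsilon> * real (order G2) ^ 2 \<le> real (card P)"
      using h2 o2 by (auto simp: host_def)
    have "p \<le> N * p" using N(1) by simp
    then have n0: "n0 \<le> order G2" using p(2) o2 by linarith
    have o0: "0 < order G2" using h2 o2 by (simp add: host_def)
    have "real (card (list_homs H S G2 \<kappa>2)) < \<epsilon> powr C * real (order G2) ^ order H"
      if HU: "(H, S) \<in> U" for H S
    proof -
      obtain m H' S' where c: "core H S m H' S'" using core[OF HU] by blast
      have "verts H' = {..<m}" using c unfolding core_def by blast
      then have o': "order H' = m" by simp
      have c1: "simple_graph H'" "m \<le> order H"
        and c2: "\<forall>x\<in>verts H'. \<exists>e\<in>edges H'. x \<in> e"
        and c3: "card (list_homs H S G2 \<kappa>2) \<le> card (list_homs H' S' G2 \<kappa>2) * order G2 ^ (order H - m)"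
        using c G2 unfolding core_def by blast+
      have "dens H' S' (order G2) G2 \<kappa>2 \<le> dens H' S' N G1 \<kappa>1" using d2[OF c1(1)] o2 by simp
      also have "\<dots> = dens H' S' N G \<kappa>" using eq1[OF c2] by (simp add: dens_def)
      also have "\<dots> \<le> \<epsilon> powr C0" by (rule dN[OF HU c])
      also have "\<dots> < \<epsilon> powr C"
        using a(2) by (simp add: \<epsilon>_def powr_def C0_def)
      finally have "real (card (list_homs H' S' G2 \<kappa>2)) < \<epsilon> powr C * real (order G2) ^ m"
        using o0 by (simp add: dens_def o' divide_less_eq)
      then have "real (card (list_homs H' S' G2 \<kappa>2)) * real (order G2) ^ (order H - m) <
          \<epsilon> powr C * real (order G2) ^ m * real (order G2) ^ (order H - m)"
        using o0 by (intro mult_strict_right_mono) auto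
      moreover have "real (order G2) ^ m * real (order G2) ^ (order H - m) = real (order G2) ^ order H"
        using c1(2) by (simp flip: power_add)
      moreover have "real (card (list_homs H S G2 \<kappa>2)) \<le>
          real (card (list_homs H' S' G2 \<kappa>2)) * real (order G2) ^ (order H - m)"
        using c3 by (metis of_nat_le_iff of_nat_mult of_nat_power)
      ultimately show ?thesis by (simp add: mult.assoc)
    qed
    then show ?thesis using G2 P n0 by blast
  qed
  moreover have "0 < \<epsilon>" "\<epsilon> < 1" using a(2) by (auto simp: \<epsilon>_def)
  ultimately show ?thesis by blast
qed

section \<open>From failing abundance to thinness\<close>

definition list_embs ::
  "'h sgraph \<Rightarrow> ('h \<Rightarrow> 'f set) \<Rightarrow> 'a sgraph \<Rightarrow> ('a \<Rightarrow> 'f) \<Rightarrow> ('h \<Rightarrow> 'a) set" where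
  "list_embs H S G \<kappa> = {\<phi> \<in> embeddings H G. \<forall>x\<in>verts H. \<kappa> (\<phi> x) \<in> S x}"

lemma list_embs_subset: "list_embs H S G \<kappa> \<subseteq> list_homs H S G \<kappa>"
  by (auto simp: list_embs_def list_homs_def embeddings_def is_hom_def PiE_def)

lemma card_list_embs_le:
  assumes "finite (verts H)" "finite (verts G)"
  shows "card (list_embs H S G \<kappa>) \<le> card (list_homs H S G \<kappa>)"
  by (intro card_mono finite_list_homs list_embs_subset assms)

lemma card_merging_maps_le:
  assumes A: "finite A" and B: "finite B" and xy: "x \<in> A" "y \<in> A" "x \<noteq> y"
  shows "card {\<phi> \<in> A \<rightarrow>\<^sub>E B. \<phi> x = \<phi> y} \<le> card B ^ (card A - 1)"
proof -
  let ?M = "{\<phi> \<in> A \<rightarrow>\<^sub>E B. \<phi> x = \<phi> y}"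
  let ?r = "\<lambda>\<phi>. restrict \<phi> (A - {x})"
  have "inj_on ?r ?M"
  proof (rule inj_onI)
    fix \<phi> \<phi>' assume a: "\<phi> \<in> ?M" "\<phi>' \<in> ?M" "?r \<phi> = ?r \<phi>'"
    have eq: "\<phi> z = \<phi>' z" if "z \<in> A - {x}" for z using fun_cong[OF a(3), of z] that by simp
    show "\<phi> = \<phi>'"
    proof (rule extensionalityI)
      show "\<phi> \<in> extensional A" "\<phi>' \<in> extensional A" using a by (auto simp: PiE_def)
      fix z assume "z \<in> A"
      then show "\<phi> z = \<phi>' z" using eq[of z] eq[of y] a xy by (cases "z = x") auto
    qed
  qed
  moreover have "?r ` ?M \<subseteq> (A - {x}) \<rightarrow>\<^sub>E B"
    by (rule image_subsetI) (simp only: restrict_PiE_iff, auto)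
  ultimately have "card ?M \<le> card ((A - {x}) \<rightarrow>\<^sub>E B)"
    by (rule card_inj_on_le) (use A B in \<open>auto intro: finite_PiE\<close>)
  then show ?thesis using A xy by (simp add: card_funcsetE)
qed

text \<open>A homomorphism that is not injective identifies two vertices of \<open>H\<close>; for each pair
  there are at most \<open>n ^ (v - 1)\<close> such maps.\<close>

lemma card_list_homs_le_embs:
  assumes H: "simple_graph H" and G: "simple_graph G" and \<delta>: "0 \<le> \<delta>" "real (order H ^ 2) \<le> \<delta> * real (order G)"
  shows "real (card (list_homs H S G \<kappa>)) \<le>
    real (card (list_embs H S G \<kappa>)) + \<delta> * real (order G) ^ order H"
proof -
  let ?V = "verts H" and ?n = "order G"
  define D where "D = {(x, y). x \<in> ?V \<and> y \<in> ?V \<and> x \<noteq> y}"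
  define Mg where "Mg = (\<lambda>(x, y). {\<phi> \<in> ?V \<rightarrow>\<^sub>E verts G. \<phi> x = \<phi> y})"
  have fin: "finite ?V" "finite (verts G)" using H G by (auto simp: simple_graph_def)
  have DS: "D \<subseteq> ?V \<times> ?V" by (auto simp: D_def)
  then have fD: "finite D" using fin finite_subset by blast
  have cD: "card D \<le> order H ^ 2"
    using card_mono[OF finite_SigmaI[OF fin(1) fin(1)] DS]
    by (simp add: card_cartesian_product power2_eq_square)
  have "list_homs H S G \<kappa> \<subseteq> list_embs H S G \<kappa> \<union> (\<Union>z\<in>D. Mg z)"
  proof
    fix \<phi> assume \<phi>: "\<phi> \<in> list_homs H S G \<kappa>"
    show "\<phi> \<in> list_embs H S G \<kappa> \<union> (\<Union>z\<in>D. Mg z)"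
    proof (cases "inj_on \<phi> ?V")
      case True
      then show ?thesis
        using \<phi> by (auto simp: list_homs_def list_embs_def embeddings_def is_hom_def PiE_def)
    next
      case False
      then obtain x y where "x \<in> ?V" "y \<in> ?V" "x \<noteq> y" "\<phi> x = \<phi> y" by (auto simp: inj_on_def)
      then have "(x, y) \<in> D" "\<phi> \<in> Mg (x, y)" using \<phi> by (auto simp: list_homs_def D_def Mg_def)
      then show ?thesis by blast
    qed
  qed
  moreover have fe: "finite (list_embs H S G \<kappa>)"
    using finite_subset[OF list_embs_subset finite_list_homs] fin by blast
  moreover have "finite (\<Union>z\<in>D. Mg z)" using fD fin by (auto simp: Mg_def intro!: finite_PiE)
  ultimately have "card (list_homs H S G \<kappa>) \<le> card (list_embs H S G \<kappa> \<union> (\<Union>z\<in>D. Mg z))"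
    by (intro card_mono) auto
  also have "\<dots> \<le> card (list_embs H S G \<kappa>) + card (\<Union>z\<in>D. Mg z)" by (rule card_Un_le)
  also have "card (\<Union>z\<in>D. Mg z) \<le> (\<Sum>z\<in>D. card (Mg z))" by (rule card_UN_le[OF fD])
  also have "\<dots> \<le> (\<Sum>z\<in>D. ?n ^ (order H - 1))"
    using fin card_merging_maps_le by (intro sum_mono) (fastforce simp: D_def Mg_def)
  finally have "card (list_homs H S G \<kappa>) \<le> card (list_embs H S G \<kappa>) + card D * ?n ^ (order H - 1)"
    by simp
  then have 1: "real (card (list_homs H S G \<kappa>)) \<le>
      real (card (list_embs H S G \<kappa>)) + real (card D) * real ?n ^ (order H - 1)"
    by (metis of_nat_add of_nat_le_iff of_nat_mult of_nat_power)
  have "real (card D) * real ?n ^ (order H - 1) \<le> \<delta> * real ?n ^ order H"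
  proof (cases "order H")
    case 0
    then have "card D = 0" using cD by simp
    then show ?thesis using 0 \<delta> by simp
  next
    case (Suc k)
    have "real (card D) \<le> real (order H ^ 2)" using cD by (metis of_nat_le_iff)
    then have "real (card D) \<le> \<delta> * real ?n" using \<delta>(2) by linarith
    then have "real (card D) * real ?n ^ k \<le> (\<delta> * real ?n) * real ?n ^ k"
      by (intro mult_right_mono) auto
    then show ?thesis using Suc by (simp add: mult.assoc)
  qed
  then show ?thesis using 1 by linarith
qed

text \<open>The constants \<open>A\<close> and \<open>K\<close> are absorbed into the exponent because \<open>\<epsilon>\<close> is bounded away
  from \<open>1\<close>: for \<open>L = log\<^sub>2 (K A)\<close> both are at most \<open>(1 / \<epsilon>) powr L\<close>.\<close>

lemma thinI:
  assumes K: "1 \<le> K" and A: "1 \<le> A"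
    and w: "\<And>C. 0 < C \<Longrightarrow> \<exists>\<epsilon> n (G::nat sgraph) \<kappa>. 0 < \<epsilon> \<and> \<epsilon> \<le> 1/2 \<and> host F n G \<kappa> (\<epsilon> / K) \<and>
      dens H S n G \<kappa> \<le> A * \<epsilon> powr C"
  shows "thin F H S"
  unfolding thin_def
proof (intro allI impI)
  fix C :: real assume C: "0 < C"
  define L where "L = ln (K * A) / ln 2"
  have KA: "0 \<le> ln K" "0 \<le> ln A" "ln (K * A) = ln K + ln A" using K A by (auto simp: ln_mult)
  have L: "0 \<le> L" using KA by (simp add: L_def)
  define C1 where "C1 = C + C * L + L"
  have "0 < C1" using C L by (simp add: C1_def add_pos_nonneg)
  then obtain \<epsilon> n and G :: "nat sgraph" and \<kappa> where \<epsilon>: "0 < \<epsilon>" "\<epsilon> \<le> 1/2"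
    and h: "host F n G \<kappa> (\<epsilon> / K)" and d: "dens H S n G \<kappa> \<le> A * \<epsilon> powr C1"
    using w by blast
  define l where "l = - ln \<epsilon>"
  have "ln \<epsilon> \<le> ln (1/2)" using \<epsilon> by (subst ln_le_cancel_iff) auto
  then have l: "ln 2 \<le> l" by (simp add: l_def ln_div)
  have "0 < l" using l ln_gt_zero[of 2] by linarith
  have "ln K + ln A = L * ln 2" using KA by (simp add: L_def)
  also have "\<dots> \<le> L * l" using L l by (intro mult_left_mono)
  finally have KAl: "ln K + ln A \<le> L * l" .
  define a where "a = l + ln K"
  have a: "0 < a" using \<open>0 < l\<close> KA by (simp add: a_def)
  have "exp (- a) = \<epsilon> / K"
    using \<epsilon> K by (simp add: a_def l_def exp_diff)
  then have "host F n G \<kappa> (exp (- a))" using h by simp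
  moreover have "dens H S n G \<kappa> \<le> exp (- C * a)"
  proof -
    have "C * ln K \<le> C * (L * l)" using KAl KA C by (intro mult_left_mono) auto
    then have "ln A - C1 * l \<le> - C * a" using KAl KA by (simp add: C1_def a_def algebra_simps)
    then have "exp (ln A - C1 * l) \<le> exp (- C * a)" by simp
    moreover have "exp (ln A - C1 * l) = A * \<epsilon> powr C1"
      using A \<epsilon> by (simp add: powr_def l_def exp_add)
    ultimately show ?thesis using d by linarith
  qed
  ultimately show "\<exists>a n (G::nat sgraph) \<kappa>. 0 < a \<and> host F n G \<kappa> (exp (- a)) \<and>
      dens H S n G \<kappa> \<le> exp (- C * a)"
    using a by blast
qed

lemma card_packing_le:
  assumes F: "simple_graph F" "edges F \<noteq> {}" and G: "simple_graph G" and P: "packing F G P"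
  shows "real (card P) \<le> real (order G) ^ 2 / 2"
proof -
  obtain e where e: "e \<in> edges F" using F by blast
  have fG: "finite (verts G)" using G by (simp add: simple_graph_def)
  have "inj_on (\<lambda>\<psi>. \<psi> ` e) P" by (rule inj_onI) (rule packing_eqI[OF P _ _ e])
  moreover have "(\<lambda>\<psi>. \<psi> ` e) ` P \<subseteq> edges G"
    using P e by (auto simp: packing_def embeddings_def is_hom_def)
  ultimately have "card P \<le> card (edges G)"
    by (rule card_inj_on_le) (rule simple_graph_finite_edges[OF G])
  also have "\<dots> \<le> card {e. e \<subseteq> verts G \<and> card e = 2}"
    using G fG by (intro card_mono) (auto simp: simple_graph_def)
  also have "\<dots> = order G choose 2" using n_subsets[OF fG] by simp
  also have "\<dots> \<le> order G * (order G - 1) div 2" by (simp add: choose_two)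
  finally have "2 * card P \<le> order G * (order G - 1)" by linarith
  also have "\<dots> \<le> order G ^ 2" by (simp add: power2_eq_square)
  finally have "real (2 * card P) \<le> real (order G ^ 2)" by (rule of_nat_mono)
  then show ?thesis by simp
qed

text \<open>The tensor product of \<open>G\<close> with \<open>F\<close>, coloured by the second coordinate. A copy \<open>\<psi>\<close> of
  \<open>F\<close> in \<open>G\<close> becomes the graph \<open>a \<mapsto> (\<psi> a, a)\<close> of \<open>\<psi>\<close>. A homomorphism into the product
  with colours \<open>\<sigma>\<close> is determined by its first coordinate, and there are at most
  \<open>order F ^ order H\<close> possible colourings.\<close>

lemma host_lift:
  fixes G :: "nat sgraph" and F :: "'f sgraph"
  assumes F: "simple_graph F" "edges F \<noteq> {}" and G: "simple_graph G" "0 < order G"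
    and P: "packing F G P" and q: "q * real (order G) ^ 2 \<le> real (card P)"
  shows "\<exists>(G'::nat sgraph) \<kappa>'. host F (order G * order F) G' \<kappa>' (q / real (order F) ^ 2) \<and>
    (\<forall>(H::'h sgraph) S. simple_graph H \<longrightarrow> card (list_homs H S G' \<kappa>') \<le>
       card (list_homs H (\<lambda>_. UNIV) G (\<lambda>_. ())) * order F ^ order H) \<and>
    (\<forall>(H::'h sgraph) \<sigma>. simple_graph H \<longrightarrow> card (list_homs H (\<lambda>x. {\<sigma> x}) G' \<kappa>') \<le>
       card (list_homs H (\<lambda>_. UNIV) G (\<lambda>_. ())))"
proof -
  have fin: "finite (verts G)" "finite (verts F)" using G F by (auto simp: simple_graph_def)
  obtain g where g: "bij_betw g (verts F) {..<order F}"
    using ex_bij_betw_finite_nat[OF fin(2)] by (auto simp: lessThan_atLeast0)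
  define h where "h = inv_into (verts F) g"
  have hg: "h (g a) = a" if "a \<in> verts F" for a
    using g that by (simp add: h_def bij_betw_def)
  have h: "h i \<in> verts F" "g (h i) = i" if "i < order F" for i
    using g that by (auto simp: h_def bij_betw_def inv_into_into f_inv_into_f simp flip: lessThan_iff)
  have hge: "h ` g ` e = e" if "e \<in> edges F" for e
    using hg edge_D(1)[OF F(1) that] by (force simp: image_image subset_iff)
  define V where "V = verts G \<times> {..<order F}"
  define Q where "Q = (\<lambda>e1 e2. e1 \<in> edges G \<and> e2 \<in> (\<lambda>e. g ` e) ` edges F)"
  define G' where "G' = pullback V Q"
  define \<kappa>' where "\<kappa>' = h \<circ> p2"
  have finV: "finite V" using fin by (simp add: V_def)
  have sG: "simple_graph G'" unfolding G'_def using finV by (rule simple_pullback)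
  have cG: "colouring F G' \<kappa>'"
    unfolding G'_def
  proof (rule colouring_pullback)
    fix x y assume "(x, y) \<in> V"
    then show "\<kappa>' (prod_encode (x, y)) \<in> verts F" using h(1) by (simp add: V_def \<kappa>'_def)
  next
    fix e assume "Q (p1 ` e) (p2 ` e)"
    then obtain e' where "e' \<in> edges F" "p2 ` e = g ` e'" by (auto simp: Q_def)
    then have "h ` p2 ` e \<in> edges F" using hge by simp
    then show "\<kappa>' ` e \<in> edges F" by (simp add: \<kappa>'_def image_comp)
  qed
  have oG: "order G' = order G * order F"
    by (simp add: G'_def order_pullback V_def card_cartesian_product)
  define L where "L = (\<lambda>\<psi>. pair_map (verts F) \<psi> g)"
  have emb: "\<psi> \<in> verts F \<rightarrow>\<^sub>E verts G" "inj_on \<psi> (verts F)" "\<And>e. e \<in> edges F \<Longrightarrow> \<psi> ` e \<in> edges G"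
    if "\<psi> \<in> P" for \<psi>
    using P that by (auto simp: packing_def embeddings_def is_hom_def PiE_def)
  have pP: "col_packing F G' \<kappa>' (L ` P)"
  proof (rule col_packingI[OF F(1)])
    fix \<psi> assume "\<psi> \<in> L ` P"
    then obtain f where f: "f \<in> P" "\<psi> = pair_map (verts F) f g" by (auto simp: L_def)
    have inV: "(f a, g a) \<in> V" if "a \<in> verts F" for a
      using emb(1)[OF f(1)] that bij_betw_apply[OF g that] by (auto simp: V_def)
    then show "\<psi> \<in> verts F \<rightarrow>\<^sub>E verts G'" using f(2) by (auto simp: G'_def pullback_def pair_map_def)
    show "\<kappa>' (\<psi> a) = a" if "a \<in> verts F" for a
      using that f(2) hg by (simp add: \<kappa>'_def)
    show "\<psi> ` e \<in> edges G'" if e: "e \<in> edges F" for e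
      unfolding G'_def
    proof (rule pair_map_edge)
      have eF: "e \<subseteq> verts F" "card e = 2" using edge_D[OF F(1) e] by auto
      then show "card e = 2" "\<And>a. a \<in> e \<Longrightarrow> (f a, g a) \<in> V"
        "\<And>a. a \<in> e \<Longrightarrow> \<psi> a = prod_encode (f a, g a)"
        using inV f(2) by auto
      show "inj_on f e \<or> inj_on g e" using emb(2)[OF f(1)] eF by (meson inj_on_subset)
      show "Q (f ` e) (g ` e)" using emb(3)[OF f(1) e] e by (simp add: Q_def)
    qed
  next
    fix \<psi> \<psi>' e assume a: "\<psi> \<in> L ` P" "\<psi>' \<in> L ` P" "e \<in> edges F" "\<psi> ` e = \<psi>' ` e"
    obtain f f' where f: "f \<in> P" "\<psi> = L f" "f' \<in> P" "\<psi>' = L f'" using a by blast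
    have "f ` e = f' ` e"
      using pair_map_proj(1)[OF edge_D(1)[OF F(1) a(3)], of f g]
        pair_map_proj(1)[OF edge_D(1)[OF F(1) a(3)], of f' g] a(4) f by (simp add: L_def)
    then show "\<psi> = \<psi>'" using packing_eqI[OF P f(1,3) a(3)] f by simp
  qed
  have "inj_on L P"
  proof (rule inj_onI)
    fix f f' assume *: "f \<in> P" "f' \<in> P" "L f = L f'"
    obtain e where e: "e \<in> edges F" using F by blast
    have "f ` e = f' ` e"
      using pair_map_proj(1)[OF edge_D(1)[OF F(1) e], of f g]
        pair_map_proj(1)[OF edge_D(1)[OF F(1) e], of f' g] * by (simp add: L_def)
    then show "f = f'" by (rule packing_eqI[OF P *(1,2) e])
  qed
  then have cP: "card (L ` P) = card P" by (rule card_image)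
  have F0: "0 < order F" using edge_D[OF F(1)] F(2) fin(2) by (auto simp: card_gt_0_iff)
  then have "q / real (order F) ^ 2 * real (order G * order F) ^ 2 \<le> real (card (L ` P))"
    using q cP by (simp add: power_mult_distrib)
  then have host: "host F (order G * order F) G' \<kappa>' (q / real (order F) ^ 2)"
    unfolding host_def using sG cG oG pP G(2) F0 by auto
  have proj: "restrict (p1 \<circ> \<phi>) (verts H) \<in> list_homs H (\<lambda>_. UNIV) G (\<lambda>_. ())"
    "\<And>x. x \<in> verts H \<Longrightarrow> p2 (\<phi> x) < order F" "\<And>x. x \<in> verts H \<Longrightarrow> h (p2 (\<phi> x)) \<in> S x"
    if H: "simple_graph H" and \<phi>: "\<phi> \<in> list_homs H S (pullback V Q) \<kappa>'" for H :: "'h sgraph" and S \<phi>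
  proof -
    note E = list_homs_pullbackD[OF H \<phi>]
    have x: "p1 (\<phi> x) \<in> verts G \<and> p2 (\<phi> x) < order F \<and> h (p2 (\<phi> x)) \<in> S x" if "x \<in> verts H" for x
      using E(1)[OF that] E(2)[OF that] by (auto simp: V_def \<kappa>'_def)
    moreover have "restrict (p1 \<circ> \<phi>) (verts H) ` e \<in> edges G" if "e \<in> edges H" for e
      using E(3)[OF that] by (simp add: Q_def)
    ultimately show "restrict (p1 \<circ> \<phi>) (verts H) \<in> list_homs H (\<lambda>_. UNIV) G (\<lambda>_. ())"
      by (auto simp: list_homs_def)
    show "\<And>x. x \<in> verts H \<Longrightarrow> p2 (\<phi> x) < order F" "\<And>x. x \<in> verts H \<Longrightarrow> h (p2 (\<phi> x)) \<in> S x"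
      using x by auto
  qed
  have 1: "card (list_homs H S G' \<kappa>') \<le>
      card (list_homs H (\<lambda>_. UNIV) G (\<lambda>_. ())) * order F ^ order H"
    if H: "simple_graph H" for H :: "'h sgraph" and S
  proof -
    have fH: "finite (verts H)" using H by (simp add: simple_graph_def)
    have "card (list_homs H S (pullback V Q) \<kappa>') \<le>
        card (list_homs H (\<lambda>_. UNIV) G (\<lambda>_. ())) * card (verts H \<rightarrow>\<^sub>E {..<order F})"
    proof (rule list_homs_pullback_le)
      fix \<phi> assume "\<phi> \<in> list_homs H S (pullback V Q) \<kappa>'"
      from proj[OF H this] show "restrict (p1 \<circ> \<phi>) (verts H) \<in> list_homs H (\<lambda>_. UNIV) G (\<lambda>_. ()) \<and>
          restrict (p2 \<circ> \<phi>) (verts H) \<in> verts H \<rightarrow>\<^sub>E {..<order F}" by auto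
    qed (use fH fin in \<open>auto intro: finite_list_homs finite_PiE\<close>)
    then show ?thesis using fH by (simp add: G'_def card_funcsetE)
  qed
  have 2: "card (list_homs H (\<lambda>x. {\<sigma> x}) G' \<kappa>') \<le> card (list_homs H (\<lambda>_. UNIV) G (\<lambda>_. ()))"
    if H: "simple_graph H" for H :: "'h sgraph" and \<sigma>
  proof -
    have fH: "finite (verts H)" using H by (simp add: simple_graph_def)
    have "card (list_homs H (\<lambda>x. {\<sigma> x}) (pullback V Q) \<kappa>') \<le>
        card (list_homs H (\<lambda>_. UNIV) G (\<lambda>_. ())) * card {\<lambda>x\<in>verts H. g (\<sigma> x)}"
    proof (rule list_homs_pullback_le)
      fix \<phi> assume \<phi>: "\<phi> \<in> list_homs H (\<lambda>x. {\<sigma> x}) (pullback V Q) \<kappa>'"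
      have "p2 (\<phi> x) = g (\<sigma> x)" if "x \<in> verts H" for x
        using h(2)[OF proj(2)[OF H \<phi> that]] proj(3)[OF H \<phi> that] by simp
      then show "restrict (p1 \<circ> \<phi>) (verts H) \<in> list_homs H (\<lambda>_. UNIV) G (\<lambda>_. ()) \<and>
          restrict (p2 \<circ> \<phi>) (verts H) \<in> {\<lambda>x\<in>verts H. g (\<sigma> x)}"
        using proj(1)[OF H \<phi>] by (auto simp: restrict_def)
    qed (use fH fin in \<open>auto intro: finite_list_homs\<close>)
    then show ?thesis by (simp add: G'_def)
  qed
  show ?thesis using host 1 2 by blast
qed

section \<open>Triangle-abundance\<close>

lemma K3_simps [simp]: "verts K3 = {0, 1, 2}" "edges K3 = pairs {0, 1, 2}"
  by (simp_all add: K3_def)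

lemma pairs_three: "pairs {0, 1, 2 :: nat} = {{0, 1}, {0, 2}, {1, 2}}"
proof
  show "pairs {0, 1, 2 :: nat} \<subseteq> {{0, 1}, {0, 2}, {1, 2}}"
  proof
    fix e :: "nat set" assume "e \<in> pairs {0, 1, 2}"
    then obtain a b where "e = {a, b}" "a \<noteq> b" "a \<in> {0, 1, 2}" "b \<in> {0, 1, 2}"
      by (auto simp: pairs_def card_2_iff)
    then show "e \<in> {{0, 1}, {0, 2}, {1, 2}}" by auto
  qed
qed (auto simp: pairs_def)

lemma simple_K3: "simple_graph K3" and K3_edges: "edges K3 \<noteq> {}"
proof -
  show "simple_graph K3" unfolding simple_graph_def K3_simps by (auto simp: pairs_def)
  show "edges K3 \<noteq> {}" unfolding K3_simps pairs_three by simp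
qed

lemma K3_vertex_in_edge: "c \<in> verts K3 \<Longrightarrow> \<exists>e\<in>edges K3. c \<in> e"
  unfolding K3_simps pairs_three by auto

text \<open>Edge-disjoint triangles, once their vertices are labelled by \<open>f\<close>, are edge-disjoint
  embeddings of \<open>K3\<close>.\<close>

lemma triangle_packing:
  assumes G: "simple_graph G" and T: "T \<subseteq> triangles G" "disjoint_family_on pairs T"
    and f: "\<And>t. t \<in> T \<Longrightarrow> f t \<in> extensional {0, 1, 2::nat} \<and> bij_betw (f t) {0, 1, 2} t"
  shows "packing K3 G (f ` T) \<and> card (f ` T) = card T"
proof -
  have im: "(\<lambda>e. f t ` e) ` edges K3 \<subseteq> pairs t" if t: "t \<in> T" for t
  proof
    fix e' assume "e' \<in> (\<lambda>e. f t ` e) ` edges K3"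
    then obtain e where e: "e \<subseteq> {0, 1, 2}" "card e = 2" "e' = f t ` e" by (auto simp: pairs_def)
    then have "card e' = 2"
      using f[OF t] by (metis bij_betw_def card_image inj_on_subset)
    then show "e' \<in> pairs t" using e f[OF t] by (auto simp: pairs_def bij_betw_def)
  qed
  have eq: "f t ` {0, 1, 2} = t" if "t \<in> T" for t using f[OF that] by (simp add: bij_betw_def)
  have "f ` T \<subseteq> embeddings K3 G"
  proof
    fix \<psi> assume "\<psi> \<in> f ` T"
    then obtain t where t: "t \<in> T" "\<psi> = f t" by blast
    have "t \<subseteq> verts G" "pairs t \<subseteq> edges G" using t(1) T by (auto simp: triangles_def)
    moreover have "(\<lambda>e. \<psi> ` e) ` edges K3 \<subseteq> pairs t" using im t by blast
    moreover have "\<psi> ` verts K3 = t" "inj_on \<psi> (verts K3)" "\<psi> \<in> extensional (verts K3)"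
      using f[OF t(1)] t(2) by (simp_all add: bij_betw_def)
    ultimately show "\<psi> \<in> embeddings K3 G" unfolding embeddings_def is_hom_def by blast
  qed
  moreover have "disjoint_family_on (\<lambda>\<psi>. (\<lambda>e. \<psi> ` e) ` edges K3) (f ` T)"
    unfolding disjoint_family_on_def
  proof (intro ballI impI)
    fix \<psi> \<psi>' assume "\<psi> \<in> f ` T" "\<psi>' \<in> f ` T" "\<psi> \<noteq> \<psi>'"
    then obtain t t' where t: "t \<in> T" "\<psi> = f t" "t' \<in> T" "\<psi>' = f t'" "t \<noteq> t'" by blast
    have "pairs t \<inter> pairs t' = {}" using T(2) t by (simp add: disjoint_family_on_def)
    then show "(\<lambda>e. \<psi> ` e) ` edges K3 \<inter> (\<lambda>e. \<psi>' ` e) ` edges K3 = {}"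
      using im[OF t(1)] im[OF t(3)] unfolding t(2,4) by blast
  qed
  moreover have "inj_on f T" using eq by (metis inj_onI)
  ultimately show ?thesis by (simp add: packing_def card_image)
qed

lemma packing_triangles:
  assumes P: "col_packing K3 G \<kappa> P"
  defines "T \<equiv> (\<lambda>\<psi>. \<psi> ` {0, 1, 2}) ` P"
  shows "T \<subseteq> triangles G" "\<forall>t\<in>T. \<kappa> ` t = verts K3" "disjoint_family_on pairs T" "card T = card P"
proof -
  note D = col_packingD[OF P]
  have inj: "inj_on \<psi> {0, 1, 2}" if "\<psi> \<in> P" for \<psi> using D(4)[OF that] by simp
  have pre: "\<exists>e'\<in>edges K3. e = \<psi> ` e'" if \<psi>: "\<psi> \<in> P" and e: "e \<in> pairs (\<psi> ` {0, 1, 2})" for \<psi> e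
  proof -
    obtain e' where e': "e' \<subseteq> {0, 1, 2}" "e = \<psi> ` e'"
      using e unfolding pairs_def mem_Collect_eq by (meson subset_imageE)
    then have "card (\<psi> ` e') = card e'"
      using inj[OF \<psi>] by (meson card_image inj_on_subset)
    then have "card e' = 2" using e e' by (simp add: pairs_def)
    then show ?thesis using e' by (auto simp: pairs_def)
  qed
  show "T \<subseteq> triangles G"
  proof
    fix t assume "t \<in> T"
    then obtain \<psi> where \<psi>: "\<psi> \<in> P" "t = \<psi> ` {0, 1, 2}" by (auto simp: T_def)
    have "t \<subseteq> verts G" using D(1)[OF \<psi>(1)] \<psi>(2) by auto
    moreover have "card t = 3" using card_image[OF inj[OF \<psi>(1)]] \<psi>(2) by simp
    moreover have "pairs t \<subseteq> edges G" using pre[OF \<psi>(1)] D(2)[OF \<psi>(1)] \<psi>(2) by blast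
    ultimately show "t \<in> triangles G" by (simp add: triangles_def)
  qed
  show "\<forall>t\<in>T. \<kappa> ` t = verts K3"
  proof
    fix t assume "t \<in> T"
    then obtain \<psi> where \<psi>: "\<psi> \<in> P" "t = \<psi> ` {0, 1, 2}" by (auto simp: T_def)
    show "\<kappa> ` t = verts K3" using D(3)[OF \<psi>(1)] \<psi>(2) by simp
  qed
  have eqI: "\<psi> = \<psi>'" if p: "\<psi> \<in> P" "\<psi>' \<in> P" "e \<in> pairs (\<psi> ` {0, 1, 2})" "e \<in> pairs (\<psi>' ` {0, 1, 2})"
    for \<psi> \<psi>' e
  proof -
    obtain d d' where d: "d \<in> edges K3" "e = \<psi> ` d" "d' \<in> edges K3" "e = \<psi>' ` d'"
      using pre[OF p(1,3)] pre[OF p(2,4)] by blast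
    have fixed: "\<kappa> ` \<psi>'' ` b = b" if "\<psi>'' \<in> P" "b \<in> edges K3" for \<psi>'' b
    proof -
      have "\<kappa> (\<psi>'' a) = a" if "a \<in> b" for a
        using D(3)[OF \<open>\<psi>'' \<in> P\<close>] edge_D(1)[OF simple_K3 \<open>b \<in> edges K3\<close>] that by blast
      then show ?thesis by (simp add: image_image)
    qed
    have "d = d'" using fixed[OF p(1) d(1)] fixed[OF p(2) d(3)] d(2,4) by simp
    then show ?thesis
      using packing_eqI[OF _ p(1,2) d(1)] P d unfolding col_packing_def by blast
  qed
  show "disjoint_family_on pairs T"
    unfolding disjoint_family_on_def T_def using eqI by blast
  have "inj_on (\<lambda>\<psi>. \<psi> ` {0, 1, 2}) P"
  proof (rule inj_onI)
    fix \<psi> \<psi>' assume a: "\<psi> \<in> P" "\<psi>' \<in> P" "\<psi> ` {0, 1, 2} = \<psi>' ` {0, 1, 2}"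
    have "card (\<psi> ` {0, 1}) = card {0, 1 :: nat}"
      using inj[OF a(1)] by (intro card_image) (auto intro: inj_on_subset)
    then have "\<psi> ` {0, 1} \<in> pairs (\<psi> ` {0, 1, 2})" by (auto simp: pairs_def)
    then show "\<psi> = \<psi>'" using eqI[OF a(1,2)] a(3) by simp
  qed
  then show "card T = card P" by (simp add: T_def card_image)
qed

lemma card_automorphisms_pos:
  assumes "simple_graph H"
  shows "0 < card (automorphisms_col H \<sigma>)" "0 < card (automorphisms H)"
proof -
  have fin: "finite (verts H)" using assms by (simp add: simple_graph_def)
  have "automorphisms H \<subseteq> verts H \<rightarrow>\<^sub>E verts H"
    by (auto simp: automorphisms_def bij_betw_def PiE_def)
  then have f: "finite (automorphisms H)" using fin by (meson finite_PiE finite_subset)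
  then have f': "finite (automorphisms_col H \<sigma>)" by (simp add: automorphisms_col_def)
  have "restrict (\<lambda>x. x) (verts H) \<in> automorphisms_col H \<sigma>"
    by (auto simp: automorphisms_col_def automorphisms_def bij_betw_def inj_on_def)
  moreover have "automorphisms_col H \<sigma> \<subseteq> automorphisms H" by (auto simp: automorphisms_col_def)
  ultimately show "0 < card (automorphisms_col H \<sigma>)" "0 < card (automorphisms H)"
    using f f' by (auto simp: card_gt_0_iff)
qed

lemma Emb_list_embs: "Emb H G = card (list_embs H (\<lambda>_. UNIV) G \<kappa>)"
  by (simp add: Emb_def list_embs_def)

lemma Emb_col_list_embs: "Emb_col H \<sigma> G \<kappa> = card (list_embs H (\<lambda>x. {\<sigma> x}) G \<kappa>)"
  by (simp add: Emb_col_def list_embs_def)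

lemma few_copies_few_homs:
  assumes H: "simple_graph H" and G: "simple_graph G" and A: "0 < A"
    and few: "real (card (list_embs H S G \<kappa>)) / real A < \<delta> * real (order G) ^ order H"
    and \<delta>: "0 < \<delta>" "real (order H ^ 2) \<le> \<delta> * real (order G)"
  shows "real (card (list_homs H S G \<kappa>)) \<le> (real A + 1) * \<delta> * real (order G) ^ order H"
proof -
  have "real (card (list_embs H S G \<kappa>)) \<le> real A * (\<delta> * real (order G) ^ order H)"
    using few A by (simp add: divide_less_eq mult.commute)
  then show ?thesis
    using card_list_homs_le_embs[OF H G less_imp_le[OF \<delta>(1)] \<delta>(2), of S \<kappa>] by (simp add: algebra_simps)
qed

lemma large_order:
  fixes \<delta> :: real assumes "0 < \<delta>" "max 1 (nat \<lceil>v / \<delta>\<rceil>) \<le> n"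
  shows "v \<le> \<delta> * real n" "0 < n"
proof -
  have "v / \<delta> \<le> real n" using assms by linarith
  then show "v \<le> \<delta> * real n" using assms(1) by (simp add: divide_le_eq mult.commute)
qed (use assms in auto)

text \<open>This excludes parameters close to \<open>1\<close>, for which a constant factor could not be absorbed
  into a power of \<open>\<epsilon>\<close>.\<close>

lemma eps_le_half:
  assumes F: "simple_graph F" "edges F \<noteq> {}" and G: "simple_graph G" "0 < order G"
    and P: "packing F G P" "\<epsilon> * real (order G) ^ 2 \<le> real (card P)"
  shows "\<epsilon> \<le> 1/2"
proof -
  have "\<epsilon> * real (order G) ^ 2 \<le> (1/2) * real (order G) ^ 2"
    using card_packing_le[OF F G(1) P(1)] P(2) by simp
  then show ?thesis using G(2) by (simp add: mult_le_cancel_right)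
qed

text \<open>The order threshold is chosen after \<open>\<epsilon>\<close>, so that the non-injective homomorphisms
  number at most \<open>\<epsilon> powr C\<close> times \<open>n ^ v\<close>. The tensor product with \<open>K3\<close> then supplies the
  missing colouring.\<close>

lemma not_triangle_abundant_thin:
  assumes H: "simple_graph H" and na: "\<not> triangle_abundant {H}"
  shows "thin K3 H (\<lambda>_. UNIV)"
proof (rule thinI[of 9 "real (card (automorphisms H)) + 1"])
  fix C :: real assume C: "0 < C"
  let ?A = "card (automorphisms H)"
  have A: "0 < ?A" using card_automorphisms_pos[OF H] by blast
  obtain \<epsilon> where \<epsilon>: "0 < \<epsilon>" "\<epsilon> \<le> 1" and ex: "\<forall>n0. \<exists>G::nat sgraph.
      simple_graph G \<and> order G \<ge> n0 \<and> (\<exists>T. T \<subseteq> triangles G \<and> disjoint_family_on pairs T \<and>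
        real (card T) \<ge> \<epsilon> * real (order G) ^ 2) \<and>
      copies H G < \<epsilon> powr C * real (order G) ^ order H"
    using na C unfolding triangle_abundant_def by (simp add: not_le) blast
  define \<delta> where "\<delta> = \<epsilon> powr C"
  have \<delta>: "0 < \<delta>" using \<epsilon> by (simp add: \<delta>_def)
  obtain G :: "nat sgraph" and T where G: "simple_graph G"
    and n: "max 1 (nat \<lceil>real (order H ^ 2) / \<delta>\<rceil>) \<le> order G"
    and T: "T \<subseteq> triangles G" "disjoint_family_on pairs T" "\<epsilon> * real (order G) ^ 2 \<le> real (card T)"
    and few: "copies H G < \<delta> * real (order G) ^ order H"
    using ex unfolding \<delta>_def by meson
  note n = large_order[OF \<delta> n]
  have "\<exists>g. g \<in> extensional {0, 1, 2::nat} \<and> bij_betw g {0, 1, 2} t" if "t \<in> T" for t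
  proof -
    have t: "card t = 3" using that T by (auto simp: triangles_def)
    then have "finite t" by (metis card.infinite zero_neq_numeral)
    then obtain g where "bij_betw g {0, 1, 2::nat} t"
      using finite_same_card_bij[of "{0, 1, 2::nat}" t] t by auto
    then have "bij_betw (restrict g {0, 1, 2}) {0, 1, 2} t"
      by (subst bij_betw_cong[where g = g]) auto
    then show ?thesis by (intro exI[of _ "restrict g {0, 1, 2}"]) simp
  qed
  then obtain f where "\<And>t. t \<in> T \<Longrightarrow> f t \<in> extensional {0, 1, 2::nat} \<and> bij_betw (f t) {0, 1, 2} t"
    by metis
  then have P: "packing K3 G (f ` T)" "card (f ` T) = card T" using triangle_packing[OF G T(1,2)] by auto
  have q: "\<epsilon> * real (order G) ^ 2 \<le> real (card (f ` T))" using T(3) P(2) by simp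
  have half: "\<epsilon> \<le> 1/2" by (rule eps_le_half[OF simple_K3 K3_edges G n(2) P(1) q])
  obtain G' :: "nat sgraph" and \<kappa>' where h: "host K3 (order G * order K3) G' \<kappa>' (\<epsilon> / real (order K3) ^ 2)"
    and le: "card (list_homs H (\<lambda>_. UNIV) G' \<kappa>') \<le>
      card (list_homs H (\<lambda>_. UNIV) G (\<lambda>_. ())) * order K3 ^ order H"
    using host_lift[OF simple_K3 K3_edges G n(2) P(1) q] H by blast
  have K3: "order K3 = 3" by simp
  have "real (card (list_homs H (\<lambda>_. UNIV) G (\<lambda>_. ()))) \<le> (real ?A + 1) * \<delta> * real (order G) ^ order H"
    by (rule few_copies_few_homs[OF H G A _ \<delta> n(1)])
       (use few in \<open>simp add: copies_def Emb_list_embs[where \<kappa> = "\<lambda>_. ()"]\<close>)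
  then have "real (card (list_homs H (\<lambda>_. UNIV) G (\<lambda>_. ()))) * 3 ^ order H \<le>
      (real ?A + 1) * \<delta> * real (order G) ^ order H * 3 ^ order H" by (intro mult_right_mono) auto
  moreover have "real (card (list_homs H (\<lambda>_. UNIV) G' \<kappa>')) \<le>
      real (card (list_homs H (\<lambda>_. UNIV) G (\<lambda>_. ()))) * 3 ^ order H"
    using of_nat_mono[OF le, where 'a = real] K3 by simp
  ultimately have "real (card (list_homs H (\<lambda>_. UNIV) G' \<kappa>')) \<le>
      (real ?A + 1) * \<delta> * real (order G) ^ order H * 3 ^ order H" by linarith
  then have "dens H (\<lambda>_. UNIV) (order G * order K3) G' \<kappa>' \<le> (real ?A + 1) * \<delta>"
    using n(2) K3 by (simp add: dens_def power_mult_distrib divide_le_eq mult_ac)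
  then show "\<exists>\<epsilon> n (G::nat sgraph) \<kappa>. 0 < \<epsilon> \<and> \<epsilon> \<le> 1/2 \<and> host K3 n G \<kappa> (\<epsilon> / 9) \<and>
      dens H (\<lambda>_. UNIV) n G \<kappa> \<le> (real ?A + 1) * \<epsilon> powr C"
    using h \<epsilon> half K3 unfolding \<delta>_def by (intro exI[of _ \<epsilon>] exI[of _ "order G * order K3"]
        exI[of _ G'] exI[of _ \<kappa>']) simp
qed auto

lemma not_triangle_abundant_col_thin:
  assumes H: "simple_graph H" and na: "\<not> triangle_abundant_col {(H, \<sigma>)}"
  shows "thin K3 H (\<lambda>x. {\<sigma> x})"
proof (rule thinI[of 1 "real (card (automorphisms_col H \<sigma>)) + 1"])
  fix C :: real assume C: "0 < C"
  let ?A = "card (automorphisms_col H \<sigma>)"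
  have A: "0 < ?A" using card_automorphisms_pos[OF H] by blast
  obtain \<epsilon> where \<epsilon>: "0 < \<epsilon>" "\<epsilon> \<le> 1" and ex: "\<forall>n0. \<exists>(G::nat sgraph) \<kappa>.
      simple_graph G \<and> colouring K3 G \<kappa> \<and> order G \<ge> n0 \<and>
      (\<exists>T. T \<subseteq> triangles G \<and> (\<forall>t\<in>T. \<kappa> ` t = verts K3) \<and> disjoint_family_on pairs T \<and>
        real (card T) \<ge> \<epsilon> * real (order G) ^ 2) \<and>
      copies_col H \<sigma> G \<kappa> < \<epsilon> powr C * real (order G) ^ order H"
    using na C unfolding triangle_abundant_col_def by (simp add: not_le) meson
  define \<delta> where "\<delta> = \<epsilon> powr C"
  have \<delta>: "0 < \<delta>" using \<epsilon> by (simp add: \<delta>_def)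
  obtain G :: "nat sgraph" and \<kappa> T where G: "simple_graph G" "colouring K3 G \<kappa>"
    and n: "max 1 (nat \<lceil>real (order H ^ 2) / \<delta>\<rceil>) \<le> order G"
    and T: "T \<subseteq> triangles G" "disjoint_family_on pairs T" "\<epsilon> * real (order G) ^ 2 \<le> real (card T)"
      "\<forall>t\<in>T. \<kappa> ` t = verts K3"
    and few: "copies_col H \<sigma> G \<kappa> < \<delta> * real (order G) ^ order H"
    using ex unfolding \<delta>_def by meson
  note n = large_order[OF \<delta> n]
  define f where "f = (\<lambda>t. restrict (inv_into t \<kappa>) {0, 1, 2})"
  have \<kappa>: "bij_betw \<kappa> t {0, 1, 2}" if "t \<in> T" for t
  proof -
    have t: "card t = 3" using that T by (auto simp: triangles_def)
    have im: "\<kappa> ` t = {0, 1, 2}" using T(4) that by simp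
    then have "card (\<kappa> ` t) = card t" using t by simp
    moreover have "finite t" using t by (metis card.infinite zero_neq_numeral)
    ultimately show ?thesis using im by (auto simp: bij_betw_def intro: eq_card_imp_inj_on)
  qed
  have "bij_betw (f t) {0, 1, 2} t" if "t \<in> T" for t
    using bij_betw_inv_into[OF \<kappa>[OF that]] unfolding f_def
    by (subst bij_betw_cong[where g = "inv_into t \<kappa>"]) auto
  then have P: "packing K3 G (f ` T)" "card (f ` T) = card T"
    using triangle_packing[OF G(1) T(1,2), of f] by (auto simp: f_def)
  have "\<kappa> (f t a) = a" if "t \<in> T" "a \<in> verts K3" for t a
    using bij_betw_inv_into_right[OF \<kappa>[OF that(1)]] that(2) by (simp add: f_def)
  then have P': "col_packing K3 G \<kappa> (f ` T)" using P(1) by (auto simp: col_packing_def)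
  have q: "\<epsilon> * real (order G) ^ 2 \<le> real (card (f ` T))" using T(3) P(2) by simp
  have half: "\<epsilon> \<le> 1/2" by (rule eps_le_half[OF simple_K3 K3_edges G(1) n(2) P(1) q])
  have h: "host K3 (order G) G \<kappa> (\<epsilon> / 1)" unfolding host_def using G n(2) P' q by auto
  have "real (card (list_homs H (\<lambda>x. {\<sigma> x}) G \<kappa>)) \<le> (real ?A + 1) * \<delta> * real (order G) ^ order H"
    by (rule few_copies_few_homs[OF H G(1) A _ \<delta> n(1)])
       (use few in \<open>simp add: copies_col_def Emb_col_list_embs\<close>)
  then have "dens H (\<lambda>x. {\<sigma> x}) (order G) G \<kappa> \<le> (real ?A + 1) * \<delta>"
    using n(2) by (simp add: dens_def divide_le_eq)
  then show "\<exists>\<epsilon> n (G::nat sgraph) \<kappa>. 0 < \<epsilon> \<and> \<epsilon> \<le> 1/2 \<and> host K3 n G \<kappa> (\<epsilon> / 1) \<and>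
      dens H (\<lambda>x. {\<sigma> x}) n G \<kappa> \<le> (real ?A + 1) * \<epsilon> powr C"
    using h \<epsilon> half unfolding \<delta>_def by blast
qed auto

lemma thin_family_triangles:
  fixes U :: "('h sgraph \<times> ('h \<Rightarrow> nat set)) set"
  assumes U: "\<forall>(H, S)\<in>U. simple_graph H \<and> thin K3 H S \<and> (\<forall>x\<in>verts H. \<exists>c\<in>S x. c \<in> verts K3)"
    and C: "0 < C"
  shows "\<exists>\<epsilon>. 0 < \<epsilon> \<and> \<epsilon> \<le> 1 \<and> (\<forall>n0. \<exists>(G::nat sgraph) \<kappa> T. simple_graph G \<and> colouring K3 G \<kappa> \<and>
    n0 \<le> order G \<and> T \<subseteq> triangles G \<and> (\<forall>t\<in>T. \<kappa> ` t = verts K3) \<and> disjoint_family_on pairs T \<and>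
    \<epsilon> * real (order G) ^ 2 \<le> real (card T) \<and>
    (\<forall>(H, S)\<in>U. real (card (list_embs H S G \<kappa>)) < \<epsilon> powr C * real (order G) ^ order H))"
proof -
  have U': "simple_graph H" "thin K3 H S" "\<forall>x\<in>verts H. \<exists>c\<in>S x. c \<in> verts K3" if "(H, S) \<in> U" for H S
    using bspec[OF U that] by simp_all
  have "simple_graph H \<and> thin K3 H S \<and> (\<forall>x\<in>verts H. \<exists>c\<in>S x. \<exists>e\<in>edges K3. c \<in> e)"
    if "(H, S) \<in> U" for H S
    using U'[OF that] K3_vertex_in_edge by blast
  from thin_family[OF simple_K3 K3_edges this C] obtain \<epsilon> where \<epsilon>: "0 < \<epsilon>" "\<epsilon> < 1"
    and ex: "\<forall>n0. \<exists>(G::nat sgraph) \<kappa> P. simple_graph G \<and> colouring K3 G \<kappa> \<and>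
    n0 \<le> order G \<and> col_packing K3 G \<kappa> P \<and> \<epsilon> * real (order G) ^ 2 \<le> real (card P) \<and>
    (\<forall>(H, S)\<in>U. real (card (list_homs H S G \<kappa>)) < \<epsilon> powr C * real (order G) ^ order H)"
    by blast
  have "\<exists>(G::nat sgraph) \<kappa> T. simple_graph G \<and> colouring K3 G \<kappa> \<and>
    n0 \<le> order G \<and> T \<subseteq> triangles G \<and> (\<forall>t\<in>T. \<kappa> ` t = verts K3) \<and> disjoint_family_on pairs T \<and>
    \<epsilon> * real (order G) ^ 2 \<le> real (card T) \<and>
    (\<forall>(H, S)\<in>U. real (card (list_embs H S G \<kappa>)) < \<epsilon> powr C * real (order G) ^ order H)" for n0
  proof -
    obtain G :: "nat sgraph" and \<kappa> P where G: "simple_graph G" "colouring K3 G \<kappa>" "n0 \<le> order G"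
      and P: "col_packing K3 G \<kappa> P" "\<epsilon> * real (order G) ^ 2 \<le> real (card P)"
      and few: "\<And>H S. (H, S) \<in> U \<Longrightarrow>
        real (card (list_homs H S G \<kappa>)) < \<epsilon> powr C * real (order G) ^ order H"
      using ex by fast
    have "real (card (list_embs H S G \<kappa>)) < \<epsilon> powr C * real (order G) ^ order H"
      if "(H, S) \<in> U" for H S
    proof -
      have "finite (verts H)" "finite (verts G)" using U'(1)[OF that] G(1) by (auto simp: simple_graph_def)
      then have "real (card (list_embs H S G \<kappa>)) \<le> real (card (list_homs H S G \<kappa>))"
        using card_list_embs_le by fastforce
      then show ?thesis using few[OF that] by linarith
    qed
    then show ?thesis
      using G packing_triangles[OF P(1)] P(2)
      by (intro exI[of _ G] exI[of _ \<kappa>] exI[of _ "(\<lambda>\<psi>. \<psi> ` {0, 1, 2}) ` P"]) auto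
  qed
  then show ?thesis using \<epsilon> by (intro exI[of _ \<epsilon>]) auto
qed

lemma triangle_abundant_mono:
  assumes ab: "triangle_abundant U" and sub: "U \<subseteq> U'"
  shows "triangle_abundant U'"
proof -
  obtain C where C: "0 < C" and all: "\<And>\<epsilon>. 0 < \<epsilon> \<and> \<epsilon> \<le> 1 \<Longrightarrow>
         (\<exists>n0::nat. \<forall>G::nat sgraph.
           simple_graph G \<and> order G \<ge> n0 \<and>
           (\<exists>T. T \<subseteq> triangles G \<and> disjoint_family_on pairs T \<and>
                real (card T) \<ge> \<epsilon> * real (order G) ^ 2) \<longrightarrow>
           (\<exists>H\<in>U. copies H G \<ge> \<epsilon> powr C * real (order G) ^ order H))"
    using ab unfolding triangle_abundant_def by blast
  show ?thesis
    unfolding triangle_abundant_def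
  proof (intro exI[of _ C] conjI C allI impI)
    fix \<epsilon> :: real assume \<epsilon>: "0 < \<epsilon> \<and> \<epsilon> \<le> 1"
    show "\<exists>n0. \<forall>G::nat sgraph. simple_graph G \<and> order G \<ge> n0 \<and>
           (\<exists>T. T \<subseteq> triangles G \<and> disjoint_family_on pairs T \<and>
                real (card T) \<ge> \<epsilon> * real (order G) ^ 2) \<longrightarrow>
           (\<exists>H\<in>U'. copies H G \<ge> \<epsilon> powr C * real (order G) ^ order H)"
      using all[OF \<epsilon>] by (elim ex_forward all_forward imp_forward) (use sub in auto)
  qed
qed

lemma triangle_abundant_col_mono:
  assumes ab: "triangle_abundant_col U" and sub: "U \<subseteq> U'"
  shows "triangle_abundant_col U'"
proof -
  obtain C where C: "0 < C" and all: "\<And>\<epsilon>. 0 < \<epsilon> \<and> \<epsilon> \<le> 1 \<Longrightarrow>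
         (\<exists>n0::nat. \<forall>(G::nat sgraph) \<kappa>.
           simple_graph G \<and> colouring K3 G \<kappa> \<and> order G \<ge> n0 \<and>
           (\<exists>T. T \<subseteq> triangles G \<and> (\<forall>t\<in>T. \<kappa> ` t = verts K3) \<and> disjoint_family_on pairs T \<and>
                real (card T) \<ge> \<epsilon> * real (order G) ^ 2) \<longrightarrow>
           (\<exists>(H, \<sigma>)\<in>U. copies_col H \<sigma> G \<kappa> \<ge> \<epsilon> powr C * real (order G) ^ order H))"
    using ab unfolding triangle_abundant_col_def by blast
  show ?thesis
    unfolding triangle_abundant_col_def
  proof (intro exI[of _ C] conjI C allI impI)
    fix \<epsilon> :: real assume \<epsilon>: "0 < \<epsilon> \<and> \<epsilon> \<le> 1"
    show "\<exists>n0::nat. \<forall>(G::nat sgraph) \<kappa>.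
           simple_graph G \<and> colouring K3 G \<kappa> \<and> order G \<ge> n0 \<and>
           (\<exists>T. T \<subseteq> triangles G \<and> (\<forall>t\<in>T. \<kappa> ` t = verts K3) \<and> disjoint_family_on pairs T \<and>
                real (card T) \<ge> \<epsilon> * real (order G) ^ 2) \<longrightarrow>
           (\<exists>(H, \<sigma>)\<in>U'. copies_col H \<sigma> G \<kappa> \<ge> \<epsilon> powr C * real (order G) ^ order H)"
      using all[OF \<epsilon>] by (elim ex_forward all_forward imp_forward) (use sub in auto)
  qed
qed

lemma triangle_abundant_iff:
  fixes \<U> :: "'a sgraph set"
  assumes simple: "\<forall>H\<in>\<U>. simple_graph H"
  shows "triangle_abundant \<U> \<longleftrightarrow> (\<exists>H\<in>\<U>. triangle_abundant {H})"
proof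
  assume "\<exists>H\<in>\<U>. triangle_abundant {H}"
  then show "triangle_abundant \<U>" using triangle_abundant_mono by (metis empty_subsetI insert_subset)
next
  assume ab: "triangle_abundant \<U>"
  show "\<exists>H\<in>\<U>. triangle_abundant {H}"
  proof (rule ccontr)
    assume none: "\<not> ?thesis"
    obtain C where C: "0 < C" and all: "\<And>\<epsilon>. 0 < \<epsilon> \<and> \<epsilon> \<le> 1 \<Longrightarrow>
         (\<exists>n0::nat. \<forall>G::nat sgraph.
           simple_graph G \<and> order G \<ge> n0 \<and>
           (\<exists>T. T \<subseteq> triangles G \<and> disjoint_family_on pairs T \<and>
                real (card T) \<ge> \<epsilon> * real (order G) ^ 2) \<longrightarrow>
           (\<exists>H\<in>\<U>. copies H G \<ge> \<epsilon> powr C * real (order G) ^ order H))"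
      using ab unfolding triangle_abundant_def by blast
    define U where "U = (\<lambda>H. (H, \<lambda>_::'a. UNIV :: nat set)) ` \<U>"
    have U: "\<forall>(H, S)\<in>U. simple_graph H \<and> thin K3 H S \<and> (\<forall>x\<in>verts H. \<exists>c\<in>S x. c \<in> verts K3)"
      using simple none not_triangle_abundant_thin by (auto simp: U_def)
    obtain \<epsilon> where \<epsilon>: "0 < \<epsilon>" "\<epsilon> \<le> 1" and ex: "\<forall>n0. \<exists>(G::nat sgraph) \<kappa> T. simple_graph G \<and> colouring K3 G \<kappa> \<and>
      n0 \<le> order G \<and> T \<subseteq> triangles G \<and> (\<forall>t\<in>T. \<kappa> ` t = verts K3) \<and> disjoint_family_on pairs T \<and>
      \<epsilon> * real (order G) ^ 2 \<le> real (card T) \<and>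
      (\<forall>(H, S)\<in>U. real (card (list_embs H S G \<kappa>)) < \<epsilon> powr C * real (order G) ^ order H)"
      using thin_family_triangles[OF U C] by (elim exE conjE) (rule that)
    obtain n0 where n0: "\<And>G::nat sgraph. simple_graph G \<and> order G \<ge> n0 \<and>
           (\<exists>T. T \<subseteq> triangles G \<and> disjoint_family_on pairs T \<and>
                real (card T) \<ge> \<epsilon> * real (order G) ^ 2) \<Longrightarrow>
           (\<exists>H\<in>\<U>. copies H G \<ge> \<epsilon> powr C * real (order G) ^ order H)"
      using all \<epsilon> by meson
    obtain G :: "nat sgraph" and \<kappa> T where G: "simple_graph G" "n0 \<le> order G" "T \<subseteq> triangles G"
      "disjoint_family_on pairs T" "\<epsilon> * real (order G) ^ 2 \<le> real (card T)"
      and few: "\<forall>(H, S)\<in>U. real (card (list_embs H S G \<kappa>)) < \<epsilon> powr C * real (order G) ^ order H"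
      using ex by meson
    obtain H where H: "H \<in> \<U>" "copies H G \<ge> \<epsilon> powr C * real (order G) ^ order H"
      using n0 G by meson
    have "1 \<le> card (automorphisms H)"
      using card_automorphisms_pos(2) simple H(1) by (metis One_nat_def Suc_leI)
    then have "copies H G \<le> real (Emb H G)" by (simp add: copies_def divide_le_eq mult_le_cancel_left1)
    also have "\<dots> < \<epsilon> powr C * real (order G) ^ order H"
      using few H(1) Emb_list_embs[of H G \<kappa>] by (auto simp: U_def)
    finally show False using H(2) by linarith
  qed
qed

lemma triangle_abundant_col_iff:
  assumes simple: "\<forall>(H, \<sigma>)\<in>\<H>. simple_graph H \<and> colouring K3 H \<sigma>"
  shows "triangle_abundant_col \<H> \<longleftrightarrow> (\<exists>(H, \<sigma>)\<in>\<H>. triangle_abundant_col {(H, \<sigma>)})"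
proof
  assume "\<exists>(H, \<sigma>)\<in>\<H>. triangle_abundant_col {(H, \<sigma>)}"
  then obtain H \<sigma> where H: "(H, \<sigma>) \<in> \<H>" "triangle_abundant_col {(H, \<sigma>)}" by blast
  then show "triangle_abundant_col \<H>" by (intro triangle_abundant_col_mono[OF H(2)]) simp
next
  assume ab: "triangle_abundant_col \<H>"
  show "\<exists>(H, \<sigma>)\<in>\<H>. triangle_abundant_col {(H, \<sigma>)}"
  proof (rule ccontr)
    assume none: "\<not> ?thesis"
    obtain C where C: "0 < C" and all: "\<And>\<epsilon>. 0 < \<epsilon> \<and> \<epsilon> \<le> 1 \<Longrightarrow>
         (\<exists>n0::nat. \<forall>(G::nat sgraph) \<kappa>.
           simple_graph G \<and> colouring K3 G \<kappa> \<and> order G \<ge> n0 \<and>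
           (\<exists>T. T \<subseteq> triangles G \<and> (\<forall>t\<in>T. \<kappa> ` t = verts K3) \<and> disjoint_family_on pairs T \<and>
                real (card T) \<ge> \<epsilon> * real (order G) ^ 2) \<longrightarrow>
           (\<exists>(H, \<sigma>)\<in>\<H>. copies_col H \<sigma> G \<kappa> \<ge> \<epsilon> powr C * real (order G) ^ order H))"
      using ab unfolding triangle_abundant_col_def by blast
    define U where "U = (\<lambda>(H, \<sigma>). (H, \<lambda>x. {\<sigma> x})) ` \<H>"
    have U: "\<forall>(H, S)\<in>U. simple_graph H \<and> thin K3 H S \<and> (\<forall>x\<in>verts H. \<exists>c\<in>S x. c \<in> verts K3)"
    proof (intro ballI, clarify)
      fix H S assume HU: "(H, S) \<in> U"
      obtain \<sigma> where \<sigma>: "(H, \<sigma>) \<in> \<H>" "S = (\<lambda>x. {\<sigma> x})" using HU by (auto simp: U_def)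
      have "simple_graph H" "colouring K3 H \<sigma>" using simple \<sigma>(1) by auto
      moreover have "\<not> triangle_abundant_col {(H, \<sigma>)}" using none \<sigma>(1) by blast
      ultimately show "simple_graph H \<and> thin K3 H S \<and> (\<forall>x\<in>verts H. \<exists>c\<in>S x. c \<in> verts K3)"
        using not_triangle_abundant_col_thin \<sigma>(2)
        by (auto simp: colouring_def is_hom_def Pi_iff simp del: K3_simps)
    qed
    obtain \<epsilon> where \<epsilon>: "0 < \<epsilon>" "\<epsilon> \<le> 1" and ex: "\<forall>n0. \<exists>(G::nat sgraph) \<kappa> T. simple_graph G \<and> colouring K3 G \<kappa> \<and>
      n0 \<le> order G \<and> T \<subseteq> triangles G \<and> (\<forall>t\<in>T. \<kappa> ` t = verts K3) \<and> disjoint_family_on pairs T \<and>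
      \<epsilon> * real (order G) ^ 2 \<le> real (card T) \<and>
      (\<forall>(H, S)\<in>U. real (card (list_embs H S G \<kappa>)) < \<epsilon> powr C * real (order G) ^ order H)"
      using thin_family_triangles[OF U C] by (elim exE conjE) (rule that)
    obtain n0 where n0: "\<And>(G::nat sgraph) \<kappa>. simple_graph G \<and> colouring K3 G \<kappa> \<and> order G \<ge> n0 \<and>
           (\<exists>T. T \<subseteq> triangles G \<and> (\<forall>t\<in>T. \<kappa> ` t = verts K3) \<and> disjoint_family_on pairs T \<and>
                real (card T) \<ge> \<epsilon> * real (order G) ^ 2) \<Longrightarrow>
           (\<exists>(H, \<sigma>)\<in>\<H>. copies_col H \<sigma> G \<kappa> \<ge> \<epsilon> powr C * real (order G) ^ order H)"
      using all \<epsilon> by meson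
    obtain G :: "nat sgraph" and \<kappa> T where G: "simple_graph G" "colouring K3 G \<kappa>" "n0 \<le> order G"
      "T \<subseteq> triangles G" "\<forall>t\<in>T. \<kappa> ` t = verts K3"
      "disjoint_family_on pairs T" "\<epsilon> * real (order G) ^ 2 \<le> real (card T)"
      and few: "\<forall>(H, S)\<in>U. real (card (list_embs H S G \<kappa>)) < \<epsilon> powr C * real (order G) ^ order H"
      using ex by meson
    have "\<exists>(H, \<sigma>)\<in>\<H>. copies_col H \<sigma> G \<kappa> \<ge> \<epsilon> powr C * real (order G) ^ order H"
      by (rule n0) (use G in blast)
    then obtain H \<sigma> where H: "(H, \<sigma>) \<in> \<H>" "copies_col H \<sigma> G \<kappa> \<ge> \<epsilon> powr C * real (order G) ^ order H"
      by blast
    have "simple_graph H" using simple H(1) by auto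
    then have "1 \<le> card (automorphisms_col H \<sigma>)"
      using card_automorphisms_pos(1) by (metis One_nat_def Suc_leI)
    then have "copies_col H \<sigma> G \<kappa> \<le> real (Emb_col H \<sigma> G \<kappa>)"
      by (simp add: copies_col_def divide_le_eq mult_le_cancel_left1)
    also have "\<dots> < \<epsilon> powr C * real (order G) ^ order H"
      using few H(1) Emb_col_list_embs[of H \<sigma> G \<kappa>] by (auto simp: U_def)
    finally show False using H(2) by linarith
  qed
qed

section \<open>Abundance with respect to a general graph\<close>

text \<open>Double counting of the pairs of a vertex and a member of the packing that covers it.\<close>

lemma uniformly_far_packing:
  assumes F: "simple_graph F" and G: "simple_graph G" and far: "uniformly_far F \<epsilon> G \<kappa>"
  shows "\<exists>P. col_packing F G \<kappa> P \<and> \<epsilon> * real (order G) ^ 2 \<le> real (card P) * real (order F)"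
proof -
  obtain P where P: "P \<subseteq> embeddings F G" "disjoint_family_on (\<lambda>\<psi>. (\<lambda>e. \<psi> ` e) ` edges F) P"
    "\<forall>\<psi>\<in>P. \<forall>a\<in>verts F. \<kappa> (\<psi> a) = a"
    and deg: "\<forall>v\<in>verts G. real (card {\<psi> \<in> P. v \<in> \<psi> ` verts F}) \<ge> \<epsilon> * real (order G)"
    using far unfolding uniformly_far_def by blast
  have fin: "finite (verts F)" "finite (verts G)" using F G by (auto simp: simple_graph_def)
  have fP: "finite P" using P(1) finite_embeddings[OF fin] finite_subset by blast
  let ?X = "SIGMA v:verts G. {\<psi> \<in> P. v \<in> \<psi> ` verts F}"
  have "?X \<subseteq> (\<lambda>(\<psi>, a). (\<psi> a, \<psi>)) ` (P \<times> verts F)" by auto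
  then have "card ?X \<le> card ((\<lambda>(\<psi>, a). (\<psi> a, \<psi>)) ` (P \<times> verts F))"
    using fP fin by (intro card_mono) auto
  also have "\<dots> \<le> card (P \<times> verts F)" using fP fin by (intro card_image_le) auto
  finally have "card ?X \<le> card P * order F" by (simp add: card_cartesian_product)
  moreover have "card ?X = (\<Sum>v\<in>verts G. card {\<psi> \<in> P. v \<in> \<psi> ` verts F})"
    using fP fin by (intro card_SigmaI) auto
  ultimately have "(\<Sum>v\<in>verts G. card {\<psi> \<in> P. v \<in> \<psi> ` verts F}) \<le> card P * order F" by simp
  then have "real (\<Sum>v\<in>verts G. card {\<psi> \<in> P. v \<in> \<psi> ` verts F}) \<le> real (card P * order F)"
    by (rule of_nat_mono)
  moreover have "(\<Sum>v\<in>verts G. \<epsilon> * real (order G)) \<le> (\<Sum>v\<in>verts G. real (card {\<psi> \<in> P. v \<in> \<psi> ` verts F}))"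
    using deg by (intro sum_mono) auto
  ultimately have "\<epsilon> * real (order G) ^ 2 \<le> real (card P) * real (order F)"
    by (simp add: power2_eq_square mult_ac)
  then show ?thesis using P by (intro exI[of _ P]) (simp add: col_packing_def packing_def)
qed

lemma order_pos_if_edge:
  assumes "simple_graph F" "edges F \<noteq> {}" shows "0 < order F"
  using assms edge_D[OF assms(1)] unfolding simple_graph_def by (metis card_gt_0_iff ex_in_conv subset_empty)

text \<open>Here \<open>\<epsilon>\<close> need not be bounded away from \<open>1\<close>. The multiplicative constant in the
  definition of abundance makes up for this: with \<open>c = (1/2) powr C\<close> the bound reads
  \<open>(\<epsilon> / 2) powr C\<close>.\<close>

lemma not_abundant_col_thin:
  assumes F: "simple_graph F" "edges F \<noteq> {}" and H: "simple_graph H" and na: "\<not> abundant_col F H \<sigma>"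
  shows "thin F H (\<lambda>x. {\<sigma> x})"
proof (rule thinI[of "real (order F)" 2])
  have F1: "1 \<le> real (order F)" using order_pos_if_edge[OF F] by simp
  then show "1 \<le> real (order F)" .
  fix C :: real assume C: "0 < C"
  have c: "0 < (1/2 :: real) powr C" by simp
  obtain \<epsilon> where \<epsilon>: "0 < \<epsilon>" "\<epsilon> \<le> 1" and ex: "\<forall>n0. \<exists>(G::nat sgraph) \<kappa>.
      simple_graph G \<and> colouring F G \<kappa> \<and> order G \<ge> n0 \<and> uniformly_far F \<epsilon> G \<kappa> \<and>
      real (Emb_col H \<sigma> G \<kappa>) < (1/2) powr C * \<epsilon> powr C * real (order G) ^ order H"
    using na C c unfolding abundant_col_def by (simp add: not_le del: powr_gt_zero) meson
  define \<delta> where "\<delta> = (\<epsilon> / 2) powr C"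
  have \<delta>: "0 < \<delta>" using \<epsilon> by (simp add: \<delta>_def)
  have \<delta>_eq: "(1/2) powr C * \<epsilon> powr C = \<delta>" using \<epsilon> by (simp add: \<delta>_def powr_mult[symmetric])
  obtain G :: "nat sgraph" and \<kappa> where G: "simple_graph G" "colouring F G \<kappa>"
    and n: "max 1 (nat \<lceil>real (order H ^ 2) / \<delta>\<rceil>) \<le> order G" and far: "uniformly_far F \<epsilon> G \<kappa>"
    and few: "real (Emb_col H \<sigma> G \<kappa>) < \<delta> * real (order G) ^ order H"
    using ex unfolding \<delta>_eq by meson
  note n = large_order[OF \<delta> n]
  obtain P where P: "col_packing F G \<kappa> P"
    "\<epsilon> * real (order G) ^ 2 \<le> real (card P) * real (order F)"
    using uniformly_far_packing[OF F(1) G(1) far] by blast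
  have "(\<epsilon> / 2) / real (order F) * real (order G) ^ 2 \<le> (\<epsilon> * real (order G) ^ 2) / real (order F)"
  proof -
    have "\<epsilon> / 2 * real (order G) ^ 2 \<le> \<epsilon> * real (order G) ^ 2" using \<epsilon> by (intro mult_right_mono) auto
    from divide_right_mono[OF this, of "real (order F)"] show ?thesis by simp
  qed
  also have "\<dots> \<le> real (card P)" using P(2) F1 by (simp add: divide_le_eq)
  finally have h: "host F (order G) G \<kappa> (\<epsilon> / 2 / real (order F))"
    unfolding host_def using G n(2) P(1) by auto
  have "real (card (list_homs H (\<lambda>x. {\<sigma> x}) G \<kappa>)) \<le> (real 1 + 1) * \<delta> * real (order G) ^ order H"
    by (rule few_copies_few_homs[OF H G(1) _ _ \<delta> n(1)])
       (use few in \<open>simp_all add: Emb_col_list_embs\<close>)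
  then have "dens H (\<lambda>x. {\<sigma> x}) (order G) G \<kappa> \<le> 2 * \<delta>"
    using n(2) by (simp add: dens_def divide_le_eq)
  then show "\<exists>\<epsilon> n (G::nat sgraph) \<kappa>. 0 < \<epsilon> \<and> \<epsilon> \<le> 1/2 \<and> host F n G \<kappa> (\<epsilon> / real (order F)) \<and>
      dens H (\<lambda>x. {\<sigma> x}) n G \<kappa> \<le> 2 * \<epsilon> powr C"
    using h \<epsilon> unfolding \<delta>_def by (intro exI[of _ "\<epsilon> / 2"]) auto
qed auto

lemma packing_le_hitting_set:
  assumes G: "simple_graph G" and P: "packing F G P"
    and D: "D \<subseteq> edges G" "is_free F (G\<lparr>edges := edges G - D\<rparr>)"
  shows "card P \<le> card D"
proof -
  have "\<exists>e\<in>edges F. \<psi> ` e \<in> D" if "\<psi> \<in> P" for \<psi>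
  proof (rule ccontr)
    assume "\<not> ?thesis"
    moreover have "\<psi> \<in> embeddings F G" using P that by (auto simp: packing_def)
    ultimately have "\<psi> \<in> embeddings F (G\<lparr>edges := edges G - D\<rparr>)"
      by (auto simp: embeddings_def is_hom_def)
    then show False using D(2) by (auto simp: is_free_def)
  qed
  then obtain f where f: "\<And>\<psi>. \<psi> \<in> P \<Longrightarrow> f \<psi> \<in> edges F \<and> \<psi> ` f \<psi> \<in> D" by metis
  have "inj_on (\<lambda>\<psi>. \<psi> ` f \<psi>) P"
  proof (rule inj_onI)
    fix \<psi> \<psi>' assume a: "\<psi> \<in> P" "\<psi>' \<in> P" "\<psi> ` f \<psi> = \<psi>' ` f \<psi>'"
    show "\<psi> = \<psi>'"
    proof (rule ccontr)
      assume "\<psi> \<noteq> \<psi>'"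
      then have "(\<lambda>e. \<psi> ` e) ` edges F \<inter> (\<lambda>e. \<psi>' ` e) ` edges F = {}"
        using P a(1,2) by (simp add: packing_def disjoint_family_on_def)
      then show False using f[OF a(1)] f[OF a(2)] a(3) by (metis disjoint_iff imageI)
    qed
  qed
  moreover have "(\<lambda>\<psi>. \<psi> ` f \<psi>) ` P \<subseteq> D" using f by blast
  moreover have "finite D" using D(1) simple_graph_finite_edges[OF G] finite_subset by blast
  ultimately show ?thesis by (rule card_inj_on_le)
qed

text \<open>Deleting all edges of a maximal family of edge-disjoint copies leaves no copy.\<close>

lemma far_packing:
  assumes F: "simple_graph F" "edges F \<noteq> {}" and G: "simple_graph G" and far: "far_from_free F \<epsilon> G"
  shows "\<exists>P. packing F G P \<and> \<epsilon> * real (order G) ^ 2 \<le> real (card (edges F)) * real (card P)"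
proof -
  have fin: "finite (verts F)" "finite (verts G)" using F G by (auto simp: simple_graph_def)
  have fe: "finite (embeddings F G)" by (rule finite_embeddings[OF fin])
  have p0: "packing F G {}" by (simp add: packing_def disjoint_family_on_def)
  have pb: "\<forall>P. packing F G P \<longrightarrow> card P < Suc (card (embeddings F G))"
    using fe by (auto simp: packing_def less_Suc_eq_le intro: card_mono)
  obtain P where P: "packing F G P" and max: "\<And>P'. packing F G P' \<Longrightarrow> card P' \<le> card P"
    using ex_has_greatest_nat[of "packing F G", OF p0 pb] by auto
  define D where "D = (\<Union>\<psi>\<in>P. (\<lambda>e. \<psi> ` e) ` edges F)"
  have fP: "finite P" using packing_finite[OF P F(1) G] .
  have DE: "D \<subseteq> edges G" using P by (auto simp: D_def packing_def embeddings_def is_hom_def)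
  have "is_free F (G\<lparr>edges := edges G - D\<rparr>)"
    unfolding is_free_def
  proof (rule ccontr)
    assume "embeddings F (G\<lparr>edges := edges G - D\<rparr>) \<noteq> {}"
    then obtain \<psi> where "\<psi> \<in> embeddings F (G\<lparr>edges := edges G - D\<rparr>)" by blast
    then have \<psi>: "\<psi> \<in> embeddings F G" "\<And>e. e \<in> edges F \<Longrightarrow> \<psi> ` e \<notin> D"
      by (auto simp: embeddings_def is_hom_def)
    have "\<psi> \<notin> P" using \<psi>(2) F(2) by (auto simp: D_def)
    have "packing F G (insert \<psi> P)"
      unfolding packing_def
    proof
      show "insert \<psi> P \<subseteq> embeddings F G" using \<psi>(1) P by (auto simp: packing_def)
      have "(\<lambda>e. \<psi> ` e) ` edges F \<inter> D = {}" using \<psi>(2) by blast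
      then show "disjoint_family_on (\<lambda>\<psi>. (\<lambda>e. \<psi> ` e) ` edges F) (insert \<psi> P)"
        using P \<open>\<psi> \<notin> P\<close> by (simp add: packing_def disjoint_family_on_insert D_def)
    qed
    from max[OF this] show False using \<open>\<psi> \<notin> P\<close> fP by simp
  qed
  then have "\<epsilon> * real (order G) ^ 2 \<le> real (card D)" using far DE by (simp add: far_from_free_def)
  also have "card D \<le> (\<Sum>\<psi>\<in>P. card ((\<lambda>e. \<psi> ` e) ` edges F))"
    unfolding D_def by (rule card_UN_le[OF fP])
  also have "\<dots> \<le> (\<Sum>\<psi>\<in>P. card (edges F))"
    by (intro sum_mono card_image_le simple_graph_finite_edges F(1))
  finally have "\<epsilon> * real (order G) ^ 2 \<le> real (card (edges F)) * real (card P)"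
    by (simp add: mult.commute)
  then show ?thesis using P by blast
qed

text \<open>Among the vertex sets \<open>W\<close> that retain all but \<open>d\<close> members per deleted vertex, one of
  least size has no vertex of degree below \<open>d\<close>, since such a vertex could be deleted as well.\<close>

lemma min_degree_subset:
  fixes d :: real
  assumes V: "finite V" and P: "finite P" "\<And>\<psi>. \<psi> \<in> P \<Longrightarrow> U \<psi> \<subseteq> V"
  shows "\<exists>W\<subseteq>V. real (card P) - d * (real (card V) - real (card W)) \<le> real (card {\<psi> \<in> P. U \<psi> \<subseteq> W}) \<and>
    (\<forall>v\<in>W. d \<le> real (card {\<psi> \<in> P. U \<psi> \<subseteq> W \<and> v \<in> U \<psi>}))"
proof -
  define good where "good W \<longleftrightarrow> W \<subseteq> V \<and>
    real (card P) - d * (real (card V) - real (card W)) \<le> real (card {\<psi> \<in> P. U \<psi> \<subseteq> W})" for W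
  have "{\<psi> \<in> P. U \<psi> \<subseteq> V} = P" using P(2) by blast
  then have "good V" by (simp add: good_def)
  then obtain W where W: "good W" and min: "\<And>W'. good W' \<Longrightarrow> card W \<le> card W'"
    using ex_has_least_nat[of good V card] by auto
  have fW: "finite W" using W V finite_subset unfolding good_def by blast
  have "d \<le> real (card {\<psi> \<in> P. U \<psi> \<subseteq> W \<and> v \<in> U \<psi>})" if v: "v \<in> W" for v
  proof (rule ccontr)
    assume less: "\<not> ?thesis"
    have eq: "{\<psi> \<in> P. U \<psi> \<subseteq> W} = {\<psi> \<in> P. U \<psi> \<subseteq> W - {v}} \<union> {\<psi> \<in> P. U \<psi> \<subseteq> W \<and> v \<in> U \<psi>}" by blast
    have le: "card {\<psi> \<in> P. U \<psi> \<subseteq> W} \<le>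
        card {\<psi> \<in> P. U \<psi> \<subseteq> W - {v}} + card {\<psi> \<in> P. U \<psi> \<subseteq> W \<and> v \<in> U \<psi>}"
      by (subst eq) (rule card_Un_le)
    have c: "real (card W) = real (card (W - {v})) + 1"
      using card.remove[OF fW v] by simp
    from le have "real (card {\<psi> \<in> P. U \<psi> \<subseteq> W}) \<le>
        real (card {\<psi> \<in> P. U \<psi> \<subseteq> W - {v}}) + real (card {\<psi> \<in> P. U \<psi> \<subseteq> W \<and> v \<in> U \<psi>})"
      by linarith
    moreover have "d * (real (card V) - real (card (W - {v}))) = d * (real (card V) - real (card W)) + d"
      unfolding c by (simp add: algebra_simps)
    moreover have "W \<subseteq> V" "real (card P) - d * (real (card V) - real (card W)) \<le> real (card {\<psi> \<in> P. U \<psi> \<subseteq> W})"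
      using W by (auto simp: good_def)
    ultimately have "good (W - {v})"
      using less unfolding good_def by (intro conjI) (blast, linarith)
    from min[OF this] c show False by linarith
  qed
  then show ?thesis using W unfolding good_def by blast
qed

text \<open>The finitely many colourings of \<open>H\<close> have a common host, and every homomorphism from
  \<open>H\<close> into it induces one of them. The nominal order of the host is replaced by its actual order,
  which is at least \<open>exp (- a)\<close> times as large because the packing needs that many vertices; this
  costs \<open>order H\<close> in the exponent. The number of colourings and the constant \<open>c\<close> are absorbed by
  taking \<open>a\<close> large. If \<open>H\<close> has no colouring, the host has no homomorphism from \<open>H\<close> at all.\<close>

lemma abundant_imp_abundant_col:
  fixes F :: "'f sgraph" and H :: "'h sgraph"
  assumes F: "simple_graph F" "edges F \<noteq> {}" and H: "simple_graph H" and ab: "abundant F H"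
  shows "\<exists>\<sigma>. colouring F H \<sigma> \<and> abundant_col F H \<sigma>"
proof (rule ccontr)
  assume none: "\<not> ?thesis"
  obtain c C where c: "0 < c" and C: "0 < C" and all: "\<And>\<epsilon>. 0 < \<epsilon> \<and> \<epsilon> \<le> 1 \<Longrightarrow>
         (\<exists>n0::nat. \<forall>G::nat sgraph.
           simple_graph G \<and> order G \<ge> n0 \<and> far_from_free F \<epsilon> G \<longrightarrow>
           real (Emb H G) \<ge> c * \<epsilon> powr C * real (order G) ^ order H)"
    using ab unfolding abundant_def by blast
  let ?v = "order H"
  have fF: "finite (verts F)" and fH: "finite (verts H)" using F H by (auto simp: simple_graph_def)
  define I where "I = {\<sigma> \<in> verts H \<rightarrow>\<^sub>E verts F. colouring F H \<sigma>}"
  have finI: "finite I" unfolding I_def using fF fH by (simp add: finite_PiE)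
  define J where "J = (\<lambda>\<sigma>. (H, \<lambda>x. {\<sigma> x})) ` I"
  have J: "simple_graph H' \<and> thin F H' S" if HS: "(H', S) \<in> J" for H' S
  proof -
    obtain \<sigma> where \<sigma>: "H' = H" "S = (\<lambda>x. {\<sigma> x})" "colouring F H \<sigma>"
      using HS by (auto simp: J_def I_def)
    then have "\<not> abundant_col F H \<sigma>" using none by blast
    then show ?thesis using not_abundant_col_thin[OF F H] H \<sigma> by simp
  qed
  define C1 where "C1 = real ?v + C + 1"
  have C1: "0 < C1" using C by (simp add: C1_def)
  define N where "N = real (card I) + 1"
  have "\<exists>a n (G::nat sgraph) \<kappa>. ln (N / c) \<le> a \<and> 0 < a \<and> host F n G \<kappa> (exp (- a)) \<and>
    (\<forall>(H, S)\<in>J. dens H S n G \<kappa> \<le> exp (- C1 * a))"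
    by (rule thin_finite_family[OF F _ J C1]) (use finI in \<open>simp_all add: J_def\<close>)
  then obtain a n and G :: "nat sgraph" and \<kappa> where a: "ln (N / c) \<le> a" "0 < a"
    and h: "host F n G \<kappa> (exp (- a))" and dJ: "\<forall>(H, S)\<in>J. dens H S n G \<kappa> \<le> exp (- C1 * a)"
    by blast
  obtain P where G: "simple_graph G" "colouring F G \<kappa>" "order G \<le> n" "0 < n"
    and P: "col_packing F G \<kappa> P" "exp (- a) * real n ^ 2 \<le> real (card P)"
    using h by (auto simp: host_def)
  have fG: "finite (verts G)" using G by (simp add: simple_graph_def)
  have "exp (- a) * real n \<le> real (order G)"
  proof -
    have "(exp (- a) * real n) ^ 2 = exp (- a) * (exp (- a) * real n ^ 2)"
      by (simp add: power2_eq_square)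
    also have "\<dots> \<le> 1 * (exp (- a) * real n ^ 2)" using a(2) by (intro mult_right_mono) auto
    also have "\<dots> \<le> real (order G) ^ 2 / 2"
      using P card_packing_le[OF F G(1)] unfolding col_packing_def by fastforce
    also have "\<dots> \<le> real (order G) ^ 2" by simp
    finally show ?thesis by (rule power2_le_imp_le) simp
  qed
  then have n_le: "real n \<le> exp a * real (order G)" by (simp add: exp_minus field_simps)
  then have oG: "0 < order G" using G(4) by (auto intro: gr0I)
  define L where "L = list_homs H (\<lambda>_. UNIV) G \<kappa>"
  have cL: "real (card L) < c * exp (- C * a) * real (order G) ^ ?v"
  proof -
    have "L \<subseteq> (\<Union>\<sigma>\<in>I. list_homs H (\<lambda>x. {\<sigma> x}) G \<kappa>)"
    proof
      fix \<phi> assume \<phi>: "\<phi> \<in> L"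
      define \<sigma> where "\<sigma> = restrict (\<kappa> \<circ> \<phi>) (verts H)"
      have "\<sigma> ` e \<in> edges F" if e: "e \<in> edges H" for e
      proof -
        have "\<sigma> ` e = \<kappa> ` \<phi> ` e"
          using edge_D(1)[OF H e] by (auto simp: \<sigma>_def image_image intro!: image_cong)
        moreover have "\<phi> ` e \<in> edges G" using \<phi> e by (simp add: L_def list_homs_def)
        ultimately show ?thesis using G(2) by (simp add: colouring_def is_hom_def)
      qed
      moreover have "\<sigma> \<in> verts H \<rightarrow>\<^sub>E verts F"
        using \<phi> G(2) by (auto simp: \<sigma>_def L_def list_homs_def colouring_def is_hom_def)
      ultimately have "\<sigma> \<in> I" by (auto simp: I_def colouring_def is_hom_def PiE_def)
      moreover have "\<phi> \<in> list_homs H (\<lambda>x. {\<sigma> x}) G \<kappa>"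
        using \<phi> by (auto simp: L_def list_homs_def \<sigma>_def)
      ultimately show "\<phi> \<in> (\<Union>\<sigma>\<in>I. list_homs H (\<lambda>x. {\<sigma> x}) G \<kappa>)" by blast
    qed
    then have "card L \<le> card (\<Union>\<sigma>\<in>I. list_homs H (\<lambda>x. {\<sigma> x}) G \<kappa>)"
      using finI finite_list_homs[OF fH fG] by (intro card_mono) auto
    also have "\<dots> \<le> (\<Sum>\<sigma>\<in>I. card (list_homs H (\<lambda>x. {\<sigma> x}) G \<kappa>))" by (rule card_UN_le[OF finI])
    finally have "real (card L) \<le> (\<Sum>\<sigma>\<in>I. real (card (list_homs H (\<lambda>x. {\<sigma> x}) G \<kappa>)))"
      by (metis of_nat_le_iff of_nat_sum)
    also have "\<dots> \<le> (\<Sum>\<sigma>\<in>I. exp (- C1 * a) * real n ^ ?v)"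
    proof (rule sum_mono)
      fix \<sigma> assume "\<sigma> \<in> I"
      then have "dens H (\<lambda>x. {\<sigma> x}) n G \<kappa> \<le> exp (- C1 * a)" using dJ by (auto simp: J_def)
      then show "real (card (list_homs H (\<lambda>x. {\<sigma> x}) G \<kappa>)) \<le> exp (- C1 * a) * real n ^ ?v"
        using G(4) by (simp add: dens_def divide_le_eq)
    qed
    also have "\<dots> = real (card I) * exp (- C1 * a) * real n ^ ?v" by simp
    also have "\<dots> \<le> real (card I) * exp (- C1 * a) * (exp a * real (order G)) ^ ?v"
      using n_le by (intro mult_left_mono power_mono) auto
    also have "\<dots> = real (card I) * exp (- a) * (exp (- C * a) * real (order G) ^ ?v)"
    proof -
      have "exp (- C1 * a) * exp a ^ ?v = exp (- a) * exp (- C * a)"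
        unfolding exp_of_nat_mult[symmetric] exp_add[symmetric] by (simp add: C1_def algebra_simps)
      then show ?thesis by (simp add: power_mult_distrib mult_ac)
    qed
    also have "\<dots> < c * (exp (- C * a) * real (order G) ^ ?v)"
    proof (rule mult_strict_right_mono)
      have N: "0 < N" by (simp add: N_def)
      have "exp (ln (N / c)) \<le> exp a" using a(1) by simp
      then have "N / c \<le> exp a" using N c by simp
      then have "N * exp (- a) \<le> c" using c by (simp add: exp_minus field_simps)
      moreover have "real (card I) * exp (- a) < N * exp (- a)" by (simp add: N_def)
      ultimately show "real (card I) * exp (- a) < c" by linarith
    qed (use oG in simp)
    finally show ?thesis by (simp add: mult.assoc)
  qed
  define \<epsilon> where "\<epsilon> = exp (- a)"
  have \<epsilon>: "0 < \<epsilon> \<and> \<epsilon> \<le> 1" using a(2) by (simp add: \<epsilon>_def)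
  have "\<epsilon> * real (order G) ^ 2 \<le> \<epsilon> * real n ^ 2"
    using G(3) \<epsilon> by (intro mult_left_mono power_mono) auto
  then have "\<epsilon> * real (order G) ^ 2 \<le> real (card P)" using P(2) unfolding \<epsilon>_def by linarith
  then have h': "host F (order G) G \<kappa> \<epsilon>"
    unfolding host_def using G(1,2) oG P(1) by auto
  obtain n0 where n0: "\<And>G::nat sgraph. simple_graph G \<and> order G \<ge> n0 \<and> far_from_free F \<epsilon> G \<Longrightarrow>
      real (Emb H G) \<ge> c * \<epsilon> powr C * real (order G) ^ order H"
    using all[OF \<epsilon>] by blast
  obtain p where p: "prime p" "max (order F) n0 < p" using bigger_prime by blast
  then have pF: "order F < p" by simp
  obtain G2 :: "nat sgraph" and \<kappa>2 where h2: "host F (order G * p) G2 \<kappa>2 \<epsilon>"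
    and o2: "order G2 = order G * p"
    and d2: "\<And>(H::'h sgraph) S. simple_graph H \<Longrightarrow> dens H S (order G * p) G2 \<kappa>2 \<le> dens H S (order G) G \<kappa>"
    using host_blowup[OF F h' p(1) pF] by blast
  obtain P2 where G2: "simple_graph G2" and P2: "col_packing F G2 \<kappa>2 P2"
    "\<epsilon> * real (order G2) ^ 2 \<le> real (card P2)"
    using h2 o2 by (auto simp: host_def)
  have "far_from_free F \<epsilon> G2"
    unfolding far_from_free_def
  proof (intro allI impI)
    fix D assume D: "D \<subseteq> edges G2 \<and> is_free F (G2\<lparr>edges := edges G2 - D\<rparr>)"
    have "packing F G2 P2" using P2(1) by (simp add: col_packing_def)
    then have "card P2 \<le> card D" using packing_le_hitting_set[OF G2] D by blast
    then show "\<epsilon> * real (order G2) ^ 2 \<le> real (card D)" using P2(2) by linarith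
  qed
  moreover have "n0 \<le> order G2"
  proof -
    have "p \<le> order G * p" using oG by simp
    then show ?thesis using p(2) o2 by linarith
  qed
  ultimately have big: "c * \<epsilon> powr C * real (order G2) ^ ?v \<le> real (Emb H G2)" using n0 G2 by blast
  have "real (Emb H G2) \<le> real (card (list_homs H (\<lambda>_. UNIV) G2 \<kappa>2))"
  proof -
    have "finite (verts G2)" using G2 by (simp add: simple_graph_def)
    from card_list_embs_le[OF fH this, of "\<lambda>_. UNIV" \<kappa>2]
    show ?thesis by (simp add: Emb_list_embs[of H G2 \<kappa>2])
  qed
  also have "\<dots> \<le> real (card L) * real p ^ ?v"
    using d2[OF H, of "\<lambda>_. UNIV"] oG p(2) by (simp add: dens_def L_def power_mult_distrib field_simps)
  also have "\<dots> < c * exp (- C * a) * real (order G) ^ ?v * real p ^ ?v"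
    using cL p(2) by (intro mult_strict_right_mono) auto
  also have "\<dots> = c * \<epsilon> powr C * real (order G2) ^ ?v"
    by (simp add: o2 power_mult_distrib \<epsilon>_def powr_def)
  finally show False using big by linarith
qed

lemma uniformly_far_subgraph:
  fixes G :: "nat sgraph" and d :: real
  assumes F: "simple_graph F" "edges F \<noteq> {}" and G: "simple_graph G" "colouring F G \<kappa>"
    and P: "col_packing F G \<kappa> P" and d: "0 \<le> d"
  shows "\<exists>G'. simple_graph G' \<and> colouring F G' \<kappa> \<and> verts G' \<subseteq> verts G \<and> edges G' \<subseteq> edges G \<and>
    real (card P) - d * real (order G) ^ 2 \<le> real (order G') ^ 2 \<and> uniformly_far F d G' \<kappa>"
proof -
  let ?N = "real (order G)"
  have fG: "finite (verts G)" using G by (simp add: simple_graph_def)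
  have fP: "finite P" using P packing_finite F(1) G(1) unfolding col_packing_def by blast
  note D = col_packingD[OF P]
  have "\<psi> ` verts F \<subseteq> verts G" if "\<psi> \<in> P" for \<psi> using D(1)[OF that] by auto
  then obtain W where W: "W \<subseteq> verts G"
    and many: "real (card P) - d * ?N * (?N - real (card W)) \<le> real (card {\<psi> \<in> P. \<psi> ` verts F \<subseteq> W})"
    and deg: "\<And>v. v \<in> W \<Longrightarrow> d * ?N \<le> real (card {\<psi> \<in> P. \<psi> ` verts F \<subseteq> W \<and> v \<in> \<psi> ` verts F})"
    using min_degree_subset[OF fG fP, of "\<lambda>\<psi>. \<psi> ` verts F" "d * ?N"] by blast
  define G' where "G' = \<lparr>verts = W, edges = {e \<in> edges G. e \<subseteq> W}\<rparr>"
  define P' where "P' = {\<psi> \<in> P. \<psi> ` verts F \<subseteq> W}"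
  have WN: "real (card W) \<le> ?N" using card_mono[OF fG W] by simp
  have sG': "simple_graph G'" using G(1) W fG finite_subset by (auto simp: simple_graph_def G'_def)
  have cG': "colouring F G' \<kappa>" using G(2) W by (auto simp: colouring_def is_hom_def G'_def)
  have P': "col_packing F G' \<kappa> P'"
  proof (rule col_packingI[OF F(1)])
    fix \<psi> assume "\<psi> \<in> P'"
    then have p: "\<psi> \<in> P" "\<psi> ` verts F \<subseteq> W" by (auto simp: P'_def)
    show "\<psi> \<in> verts F \<rightarrow>\<^sub>E verts G'" using D(1)[OF p(1)] p(2) by (auto simp: G'_def PiE_def)
    show "\<psi> ` e \<in> edges G'" if "e \<in> edges F" for e
      using D(2)[OF p(1) that] edge_D(1)[OF F(1) that] p(2) by (auto simp: G'_def)
    show "\<kappa> (\<psi> a) = a" if "a \<in> verts F" for a by (rule D(3)[OF p(1) that])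
    fix \<psi>' e assume "\<psi>' \<in> P'" "e \<in> edges F" "\<psi> ` e = \<psi>' ` e"
    moreover have "packing F G P" using P by (simp add: col_packing_def)
    ultimately show "\<psi> = \<psi>'" by (intro packing_eqI[OF _ p(1)]) (simp_all add: P'_def)
  qed
  have "real (card P) - d * ?N ^ 2 \<le> real (card P')"
  proof -
    have "d * ?N * (?N - real (card W)) \<le> d * ?N * ?N" using d by (intro mult_left_mono) auto
    then show ?thesis using many by (simp add: P'_def power2_eq_square mult.assoc)
  qed
  also have "\<dots> \<le> real (order G') ^ 2 / 2"
    using card_packing_le[OF F sG'] P' unfolding col_packing_def by blast
  also have "\<dots> \<le> real (order G') ^ 2" by simp
  finally have size: "real (card P) - d * ?N ^ 2 \<le> real (order G') ^ 2" .
  have "uniformly_far F d G' \<kappa>"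
    unfolding uniformly_far_def
  proof (intro exI[of _ P'] conjI ballI)
    show "P' \<subseteq> embeddings F G'" "disjoint_family_on (\<lambda>\<psi>. (\<lambda>e. \<psi> ` e) ` edges F) P'"
      using P' by (auto simp: col_packing_def packing_def)
    show "\<kappa> (\<psi> a) = a" if "\<psi> \<in> P'" "a \<in> verts F" for \<psi> a
      using P' that by (auto simp: col_packing_def)
    fix v assume "v \<in> verts G'"
    then have "d * ?N \<le> real (card {\<psi> \<in> P'. v \<in> \<psi> ` verts F})"
      using deg[of v] by (simp add: G'_def P'_def conj_assoc)
    moreover have "d * real (order G') \<le> d * ?N" using WN d by (intro mult_left_mono) (auto simp: G'_def)
    ultimately show "d * real (order G') \<le> real (card {\<psi> \<in> P'. v \<in> \<psi> ` verts F})" by linarith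
  qed
  then show ?thesis using sG' cG' size W by (intro exI[of _ G']) (auto simp: G'_def)
qed

text \<open>In the tensor product of a far graph \<open>G\<close> with \<open>F\<close> a uniformly far subgraph of order at
  least \<open>x n\<close> is found, where \<open>x\<close> is proportional to \<open>\<epsilon>\<close>. It contains many copies of
  \<open>(H, \<sigma>)\<close>, whose first coordinates are distinct homomorphisms from \<open>H\<close> to \<open>G\<close>, and all but a
  negligible number of these are embeddings.\<close>

lemma abundant_col_imp_abundant:
  fixes F :: "'f sgraph" and H :: "'h sgraph"
  assumes F: "simple_graph F" "edges F \<noteq> {}" and H: "simple_graph H" and ab: "abundant_col F H \<sigma>"
  shows "abundant F H"
proof -
  obtain c C where c: "0 < c" and C: "0 < C" and all: "\<And>\<epsilon>. 0 < \<epsilon> \<and> \<epsilon> \<le> 1 \<Longrightarrow>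
         (\<exists>n0::nat. \<forall>(G::nat sgraph) \<kappa>.
           simple_graph G \<and> colouring F G \<kappa> \<and> order G \<ge> n0 \<and> uniformly_far F \<epsilon> G \<kappa> \<longrightarrow>
           real (Emb_col H \<sigma> G \<kappa>) \<ge> c * \<epsilon> powr C * real (order G) ^ order H)"
    using ab unfolding abundant_col_def by blast
  let ?v = "order H"
  define m where "m = real (card (edges F))"
  define f where "f = real (order F)"
  have m: "1 \<le> m" using F simple_graph_finite_edges[OF F(1)] by (simp add: m_def Suc_leI card_gt_0_iff)
  have f: "1 \<le> f" using order_pos_if_edge[OF F] by (simp add: f_def)
  define K where "K = 2 * m * f ^ 2"
  have "1 \<le> f ^ 2" using f by (rule one_le_power)
  then have K: "1 \<le> K" using m mult_mono[of 1 m 1 "f ^ 2"] by (simp add: K_def)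
  \<comment> \<open>The factor \<open>1/2\<close> pays for the non-injective homomorphisms; the others turn powers of
      \<open>\<epsilon> / K\<close> and \<open>\<epsilon> / (2 m)\<close> into powers of \<open>\<epsilon>\<close>.\<close>
  define c' where "c' = c / 2 * (1 / K) powr C * (1 / (2 * m)) ^ ?v"
  have c': "0 < c'" using c K m by (simp add: c'_def)
  have "\<exists>n0. \<forall>G::nat sgraph. simple_graph G \<and> order G \<ge> n0 \<and> far_from_free F \<epsilon> G \<longrightarrow>
      real (Emb H G) \<ge> c' * \<epsilon> powr (C + real ?v) * real (order G) ^ ?v"
    if \<epsilon>: "0 < \<epsilon> \<and> \<epsilon> \<le> 1" for \<epsilon> :: real
  proof -
    \<comment> \<open>With \<open>N\<close> the order of the tensor product, \<open>d N\<^sup>2 = x n\<^sup>2\<close> is at most half the number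
        of copies of \<open>F\<close> in the packing; pruning at degree \<open>d N\<close> therefore keeps at least half.\<close>
    define d where "d = \<epsilon> / K"
    have d: "0 < d \<and> d \<le> 1" using \<epsilon> K by (simp add: d_def divide_le_eq)
    define x where "x = \<epsilon> / (2 * m)"
    have x: "0 < x" "x \<le> 1" using \<epsilon> m by (auto simp: x_def divide_le_eq)
    obtain n1 where n1: "\<And>(G::nat sgraph) \<kappa>. simple_graph G \<and> colouring F G \<kappa> \<and> order G \<ge> n1 \<and>
        uniformly_far F d G \<kappa> \<Longrightarrow> real (Emb_col H \<sigma> G \<kappa>) \<ge> c * d powr C * real (order G) ^ order H"
      using all[OF d] by blast
    define \<delta> where "\<delta> = c / 2 * d powr C * x ^ ?v"
    have \<delta>: "0 < \<delta>" using c d x by (simp add: \<delta>_def)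
    have \<delta>_eq: "\<delta> = c' * \<epsilon> powr (C + real ?v)"
    proof -
      have "d powr C = (1 / K) powr C * \<epsilon> powr C"
        using \<epsilon> K by (simp add: d_def powr_mult[symmetric])
      moreover have "x ^ ?v = (1 / (2 * m)) ^ ?v * \<epsilon> powr real ?v"
        using \<epsilon> by (simp add: x_def powr_realpow power_mult_distrib[symmetric])
      ultimately show ?thesis by (simp add: \<delta>_def c'_def powr_add)
    qed
    define n0 where "n0 = max (nat \<lceil>real n1 / x\<rceil>) (max 1 (nat \<lceil>real (?v ^ 2) / \<delta>\<rceil>))"
    have "c' * \<epsilon> powr (C + real ?v) * real (order G) ^ ?v \<le> real (Emb H G)"
      if G: "simple_graph G" "order G \<ge> n0" "far_from_free F \<epsilon> G" for G :: "nat sgraph"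
    proof -
      let ?n = "real (order G)"
      have "max 1 (nat \<lceil>real (?v ^ 2) / \<delta>\<rceil>) \<le> order G" using G(2) by (simp add: n0_def)
      note n = large_order[OF \<delta> this]
      obtain P where P: "packing F G P" "\<epsilon> * ?n ^ 2 \<le> m * real (card P)"
        using far_packing[OF F G(1,3)] by (auto simp: m_def)
      then have q: "\<epsilon> / m * ?n ^ 2 \<le> real (card P)" using m by (simp add: divide_le_eq mult.commute)
      obtain G' :: "nat sgraph" and \<kappa>' where h: "host F (order G * order F) G' \<kappa>' (\<epsilon> / m / real (order F) ^ 2)"
        and le: "card (list_homs H (\<lambda>x. {\<sigma> x}) G' \<kappa>') \<le> card (list_homs H (\<lambda>_. UNIV) G (\<lambda>_. ()))"
        using host_lift[OF F G(1) n(2) P(1) q] H by blast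
      obtain P' where G': "simple_graph G'" "colouring F G' \<kappa>'" "order G' \<le> order G * order F"
        and P': "col_packing F G' \<kappa>' P'"
          "\<epsilon> / m / real (order F) ^ 2 * real (order G * order F) ^ 2 \<le> real (card P')"
        using h by (auto simp: host_def)
      have "0 \<le> d" using d by simp
      from uniformly_far_subgraph[OF F G'(1,2) P'(1) this] obtain W where
        W: "simple_graph W" "colouring F W \<kappa>'" "verts W \<subseteq> verts G'" "edges W \<subseteq> edges G'"
        and size: "real (card P') - d * real (order G') ^ 2 \<le> real (order W) ^ 2"
        and far: "uniformly_far F d W \<kappa>'"
        by blast
      have "x * ?n \<le> real (order W)"
      proof -
        have "2 * x * ?n ^ 2 \<le> real (card P')"
          using P'(2) f by (simp add: x_def f_def power_mult_distrib)
        moreover have "d * real (order G') ^ 2 \<le> x * ?n ^ 2"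
        proof -
          have "d * real (order G') ^ 2 \<le> d * real (order G * order F) ^ 2"
            using G'(3) d by (intro mult_left_mono power_mono of_nat_mono) auto
          also have "\<dots> = x * ?n ^ 2"
            using f m by (simp add: d_def K_def x_def power_mult_distrib f_def)
          finally show ?thesis .
        qed
        moreover have "(x * ?n) ^ 2 \<le> x * ?n ^ 2"
        proof -
          have "x * (x * ?n ^ 2) \<le> 1 * (x * ?n ^ 2)" using x by (intro mult_right_mono) auto
          then show ?thesis by (simp add: power2_eq_square mult_ac)
        qed
        ultimately have "(x * ?n) ^ 2 \<le> real (order W) ^ 2" using size by linarith
        then show ?thesis by (rule power2_le_imp_le) simp
      qed
      moreover have "real n1 \<le> x * ?n"
      proof -
        have "nat \<lceil>real n1 / x\<rceil> \<le> order G" using G(2) by (simp add: n0_def)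
        then have "real n1 / x \<le> ?n" by linarith
        then show ?thesis using x by (simp add: divide_le_eq mult.commute)
      qed
      ultimately have big: "n1 \<le> order W" "x * ?n \<le> real (order W)" by linarith+
      have "2 * \<delta> * ?n ^ ?v = c * d powr C * (x * ?n) ^ ?v" by (simp add: \<delta>_def power_mult_distrib)
      also have "\<dots> \<le> c * d powr C * real (order W) ^ ?v"
        using big(2) c x by (intro mult_left_mono power_mono) auto
      also have "\<dots> \<le> real (Emb_col H \<sigma> W \<kappa>')" using n1 W(1,2) big(1) far by blast
      also have "\<dots> \<le> real (card (list_homs H (\<lambda>x. {\<sigma> x}) G' \<kappa>'))"
      proof -
        have "list_homs H (\<lambda>x. {\<sigma> x}) W \<kappa>' \<subseteq> list_homs H (\<lambda>x. {\<sigma> x}) G' \<kappa>'"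
          using W(3,4) by (auto simp: list_homs_def PiE_def)
        then have "list_embs H (\<lambda>x. {\<sigma> x}) W \<kappa>' \<subseteq> list_homs H (\<lambda>x. {\<sigma> x}) G' \<kappa>'"
          using list_embs_subset by (rule order_trans[rotated])
        moreover have "finite (list_homs H (\<lambda>x. {\<sigma> x}) G' \<kappa>')"
          using H G'(1) by (intro finite_list_homs) (auto simp: simple_graph_def)
        ultimately show ?thesis by (simp add: Emb_col_list_embs card_mono)
      qed
      also have "\<dots> \<le> real (card (list_homs H (\<lambda>_. UNIV) G (\<lambda>_. ())))" using le by simp
      also have "\<dots> \<le> real (Emb H G) + \<delta> * ?n ^ ?v"
        using card_list_homs_le_embs[OF H G(1) less_imp_le[OF \<delta>] n(1), of "\<lambda>_. UNIV" "\<lambda>_. ()"]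
        by (simp add: Emb_list_embs[where \<kappa> = "\<lambda>_. ()"])
      finally show ?thesis unfolding \<delta>_eq[symmetric] by simp
    qed
    then show ?thesis by blast
  qed
  moreover have "0 < C + real ?v" using C by simp
  ultimately show ?thesis unfolding abundant_def using c' by blast
qed

theorem corollary1p7:
  "(\<forall>\<U> :: 'a sgraph set. (\<forall>H\<in>\<U>. simple_graph H) \<longrightarrow>
      (triangle_abundant \<U> \<longleftrightarrow> (\<exists>H\<in>\<U>. triangle_abundant {H}))) \<and>
   (\<forall>\<H> :: ('b sgraph \<times> ('b \<Rightarrow> nat)) set.
      (\<forall>(H, \<sigma>)\<in>\<H>. simple_graph H \<and> colouring K3 H \<sigma>) \<longrightarrow>
      (triangle_abundant_col \<H> \<longleftrightarrow> (\<exists>(H, \<sigma>)\<in>\<H>. triangle_abundant_col {(H, \<sigma>)}))) \<and>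
   (\<forall>(F :: 'f sgraph) (H :: 'h sgraph).
      simple_graph F \<and> simple_graph H \<and> card (edges F) > 0 \<longrightarrow>
      (abundant F H \<longleftrightarrow> (\<exists>\<sigma>. colouring F H \<sigma> \<and> abundant_col F H \<sigma>)))"
proof (intro conjI allI impI)
  fix \<U> :: "'a sgraph set" assume "\<forall>H\<in>\<U>. simple_graph H"
  then show "triangle_abundant \<U> \<longleftrightarrow> (\<exists>H\<in>\<U>. triangle_abundant {H})" by (rule triangle_abundant_iff)
next
  fix \<H> :: "('b sgraph \<times> ('b \<Rightarrow> nat)) set"
  assume "\<forall>(H, \<sigma>)\<in>\<H>. simple_graph H \<and> colouring K3 H \<sigma>"
  then show "triangle_abundant_col \<H> \<longleftrightarrow> (\<exists>(H, \<sigma>)\<in>\<H>. triangle_abundant_col {(H, \<sigma>)})"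
    by (rule triangle_abundant_col_iff)
next
  fix F :: "'f sgraph" and H :: "'h sgraph"
  assume "simple_graph F \<and> simple_graph H \<and> card (edges F) > 0"
  then have "simple_graph F" "edges F \<noteq> {}" "simple_graph H" by auto
  then show "abundant F H \<longleftrightarrow> (\<exists>\<sigma>. colouring F H \<sigma> \<and> abundant_col F H \<sigma>)"
    using abundant_imp_abundant_col abundant_col_imp_abundant by blast
qed

end
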